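(* Let $R$ be a ring and $M$ a module. Then: (i) $M$ is $\aleph_1$-projective if and only if it is a flat Mittag-Leffler module. (ii) If $\kappa$ is a regular uncountable cardinal and $M$ is $\kappa$-projective, then $M$ is a flat Mittag-Leffler module.
   Context: Rings are associative with $1$, modules are unital, and "module" means right $R$-module. A module $M$ is Mittag-Leffler if for each family $(Q_i\mid i\in I)$ of left $R$-modules the canonical map $M\otimes_R\prod_{i\in I}Q_i\to\prod_{i\in I}(M\otimes_R Q_i)$ is injective. For a regular uncountable cardinal $\kappa$, a direct system (i.e. a family directed by inclusion) $\mathcal{C}$ of submodules of $M$ is a $\kappa$-dense system in $M$ if (1) $\mathcal{C}$ is closed under unions of well-ordered ascending chains of length $<\kappa$, and (2) every subset of $M$ of cardinality $<\kappa$ is contained in an element of $\mathcal{C}$. A module is $<\kappa$-generated if it has a generating set of cardinality $<\kappa$. A module $M$ is $\kappa$-projective if $M$ has a $\kappa$-dense system consisting of $<\kappa$-generated projective modules. *)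

theory Defs
  imports HOL.Hull "HOL-Algebra.Free_Abelian_Groups" "HOL-Algebra.Module" "HOL-Algebra.AbelCoset"
begin

text \<open>
  The locale \<^locale>\<open>module\<close> of the library is restricted to commutative rings.  Only its record
  type is used here (together with \<^locale>\<open>submodule\<close>, which does not depend on the side):
  of a record \<open>M\<close> only the carrier, the additive structure and the scalar action matter, and the
  ring fields \<open>mult\<close> and \<open>one\<close> are meaningless.  For a right module, \<open>r \<odot>\<^bsub>M\<^esub> x\<close> stands for the
  product usually written \<open>x r\<close>.  Unlike the class \<open>ring_1\<close>, the locale \<^locale>\<open>ring\<close> admits the
  zero ring.
\<close>

locale left_module = R?: ring R + M?: abelian_group M
  for R :: "('r, 'a) ring_scheme" (structure) and M :: "('r, 'm, 'b) module_scheme" (structure) +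
  assumes smult_closed: "\<lbrakk>r \<in> carrier R; x \<in> carrier M\<rbrakk> \<Longrightarrow> r \<odot>\<^bsub>M\<^esub> x \<in> carrier M"
    and smult_l_distr: "\<lbrakk>r \<in> carrier R; s \<in> carrier R; x \<in> carrier M\<rbrakk> \<Longrightarrow>
      (r \<oplus> s) \<odot>\<^bsub>M\<^esub> x = r \<odot>\<^bsub>M\<^esub> x \<oplus>\<^bsub>M\<^esub> s \<odot>\<^bsub>M\<^esub> x"
    and smult_r_distr: "\<lbrakk>r \<in> carrier R; x \<in> carrier M; y \<in> carrier M\<rbrakk> \<Longrightarrow>
      r \<odot>\<^bsub>M\<^esub> (x \<oplus>\<^bsub>M\<^esub> y) = r \<odot>\<^bsub>M\<^esub> x \<oplus>\<^bsub>M\<^esub> r \<odot>\<^bsub>M\<^esub> y"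
    and smult_assoc: "\<lbrakk>r \<in> carrier R; s \<in> carrier R; x \<in> carrier M\<rbrakk> \<Longrightarrow>
      (r \<otimes> s) \<odot>\<^bsub>M\<^esub> x = r \<odot>\<^bsub>M\<^esub> (s \<odot>\<^bsub>M\<^esub> x)"
    and smult_one: "x \<in> carrier M \<Longrightarrow> \<one> \<odot>\<^bsub>M\<^esub> x = x"

locale right_module = R?: ring R + M?: abelian_group M
  for R :: "('r, 'a) ring_scheme" (structure) and M :: "('r, 'm, 'b) module_scheme" (structure) +
  assumes smult_closed: "\<lbrakk>r \<in> carrier R; x \<in> carrier M\<rbrakk> \<Longrightarrow> r \<odot>\<^bsub>M\<^esub> x \<in> carrier M"
    and smult_l_distr: "\<lbrakk>r \<in> carrier R; s \<in> carrier R; x \<in> carrier M\<rbrakk> \<Longrightarrow>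
      (r \<oplus> s) \<odot>\<^bsub>M\<^esub> x = r \<odot>\<^bsub>M\<^esub> x \<oplus>\<^bsub>M\<^esub> s \<odot>\<^bsub>M\<^esub> x"
    and smult_r_distr: "\<lbrakk>r \<in> carrier R; x \<in> carrier M; y \<in> carrier M\<rbrakk> \<Longrightarrow>
      r \<odot>\<^bsub>M\<^esub> (x \<oplus>\<^bsub>M\<^esub> y) = r \<odot>\<^bsub>M\<^esub> x \<oplus>\<^bsub>M\<^esub> r \<odot>\<^bsub>M\<^esub> y"
    and smult_assoc: "\<lbrakk>r \<in> carrier R; s \<in> carrier R; x \<in> carrier M\<rbrakk> \<Longrightarrow>
      (r \<otimes> s) \<odot>\<^bsub>M\<^esub> x = s \<odot>\<^bsub>M\<^esub> (r \<odot>\<^bsub>M\<^esub> x)"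
    and smult_one: "x \<in> carrier M \<Longrightarrow> \<one> \<odot>\<^bsub>M\<^esub> x = x"

definition mod_hom :: "'r ring \<Rightarrow> ('r, 'm) module \<Rightarrow> ('r, 'n) module \<Rightarrow> ('m \<Rightarrow> 'n) set"
  where "mod_hom R M N = {f \<in> hom (add_monoid M) (add_monoid N).
    \<forall>r \<in> carrier R. \<forall>x \<in> carrier M. f (r \<odot>\<^bsub>M\<^esub> x) = r \<odot>\<^bsub>N\<^esub> f x}"

definition prod_module :: "'i set \<Rightarrow> ('i \<Rightarrow> ('r, 'q) module) \<Rightarrow> ('r, 'i \<Rightarrow> 'q) module"
  where "prod_module I Q =
    \<lparr>carrier = (\<Pi>\<^sub>E i\<in>I. carrier (Q i)),
     monoid.mult = undefined,
     one = undefined,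
     zero = (\<lambda>i\<in>I. \<zero>\<^bsub>Q i\<^esub>),
     add = (\<lambda>x y. \<lambda>i\<in>I. x i \<oplus>\<^bsub>Q i\<^esub> y i),
     smult = (\<lambda>r x. \<lambda>i\<in>I. r \<odot>\<^bsub>Q i\<^esub> x i)\<rparr>"


subsection \<open>Tensor products over a noncommutative ring\<close>

definition tensor_relations ::
  "'r ring \<Rightarrow> ('r, 'm) module \<Rightarrow> ('r, 'q) module \<Rightarrow> ('m \<times> 'q \<Rightarrow>\<^sub>0 int) set"
  where "tensor_relations R M Q =
    {frag_of (x \<oplus>\<^bsub>M\<^esub> y, q) - frag_of (x, q) - frag_of (y, q) | x y q.
       x \<in> carrier M \<and> y \<in> carrier M \<and> q \<in> carrier Q} \<union>
    {frag_of (x, p \<oplus>\<^bsub>Q\<^esub> q) - frag_of (x, p) - frag_of (x, q) | x p q.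
       x \<in> carrier M \<and> p \<in> carrier Q \<and> q \<in> carrier Q} \<union>
    {frag_of (r \<odot>\<^bsub>M\<^esub> x, q) - frag_of (x, r \<odot>\<^bsub>Q\<^esub> q) | r x q.
       r \<in> carrier R \<and> x \<in> carrier M \<and> q \<in> carrier Q}"

definition tensor_kernel ::
  "'r ring \<Rightarrow> ('r, 'm) module \<Rightarrow> ('r, 'q) module \<Rightarrow> ('m \<times> 'q \<Rightarrow>\<^sub>0 int) set"
  where "tensor_kernel R M Q =
    generate (free_Abelian_group (carrier M \<times> carrier Q)) (tensor_relations R M Q)"

definition tensor ::
  "'r ring \<Rightarrow> ('r, 'm) module \<Rightarrow> ('r, 'q) module \<Rightarrow> ('m \<times> 'q \<Rightarrow>\<^sub>0 int) set monoid"
  where "tensor R M Q =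
    free_Abelian_group (carrier M \<times> carrier Q) Mod tensor_kernel R M Q"

definition pure_tensor ::
  "'r ring \<Rightarrow> ('r, 'm) module \<Rightarrow> ('r, 'q) module \<Rightarrow> 'm \<Rightarrow> 'q \<Rightarrow> ('m \<times> 'q \<Rightarrow>\<^sub>0 int) set"
  where "pure_tensor R M Q x q =
    tensor_kernel R M Q #>\<^bsub>free_Abelian_group (carrier M \<times> carrier Q)\<^esub> frag_of (x, q)"

text \<open>The map induced on \<open>M \<otimes> A\<close> by a homomorphism \<open>f\<close> from \<open>A\<close> to \<open>B\<close>.  A coset is sent to the
  coset containing the images of its elements under the linear extension of
  \<open>(x, a) \<mapsto> (x, f a)\<close>; see \<open>tensor_map_hom\<close> and \<open>tensor_map_pure\<close> below.\<close>

definition tensor_map ::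
  "'r ring \<Rightarrow> ('r, 'm) module \<Rightarrow> ('r, 'a) module \<Rightarrow> ('r, 'b) module \<Rightarrow> ('a \<Rightarrow> 'b) \<Rightarrow>
    ('m \<times> 'a \<Rightarrow>\<^sub>0 int) set \<Rightarrow> ('m \<times> 'b \<Rightarrow>\<^sub>0 int) set"
  where "tensor_map R M A B f X =
    tensor_kernel R M B <#>\<^bsub>free_Abelian_group (carrier M \<times> carrier B)\<^esub>
      (frag_extend (\<lambda>(x, a). frag_of (x, f a)) ` X)"

lemma tensor_kernel_normal:
  assumes "abelian_group M" "abelian_group Q"
    and "\<And>r x. \<lbrakk>r \<in> carrier R; x \<in> carrier M\<rbrakk> \<Longrightarrow> r \<odot>\<^bsub>M\<^esub> x \<in> carrier M"
    and "\<And>r q. \<lbrakk>r \<in> carrier R; q \<in> carrier Q\<rbrakk> \<Longrightarrow> r \<odot>\<^bsub>Q\<^esub> q \<in> carrier Q"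
  shows "tensor_kernel R M Q \<lhd> free_Abelian_group (carrier M \<times> carrier Q)"
proof -
  interpret M: abelian_group M by fact
  interpret Q: abelian_group Q by fact
  interpret F: comm_group "free_Abelian_group (carrier M \<times> carrier Q)"
    by (rule abelian_free_Abelian_group)
  have diff: "a - b \<in> carrier (free_Abelian_group (carrier M \<times> carrier Q))"
    if "a \<in> carrier (free_Abelian_group (carrier M \<times> carrier Q))"
      "b \<in> carrier (free_Abelian_group (carrier M \<times> carrier Q))" for a b
    using that keys_diff[of a b] unfolding free_Abelian_group_def by auto
  have gen: "frag_of (x, q) \<in> carrier (free_Abelian_group (carrier M \<times> carrier Q))"
    if "x \<in> carrier M" "q \<in> carrier Q" for x q
    using that by (simp add: free_Abelian_group_def)
  have "tensor_relations R M Q \<subseteq> carrier (free_Abelian_group (carrier M \<times> carrier Q))"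
    unfolding tensor_relations_def
    by (intro Un_least subsetI; elim CollectE exE conjE; hypsubst; intro diff gen)
      (simp_all add: assms(3,4))
  then have "subgroup (tensor_kernel R M Q) (free_Abelian_group (carrier M \<times> carrier Q))"
    unfolding tensor_kernel_def by (rule F.generate_is_subgroup)
  then show ?thesis
    by (rule F.subgroup_imp_normal)
qed

lemma tensor_map_coset:
  assumes M: "right_module R M" and A: "left_module R A" and B: "left_module R B"
    and f: "f \<in> mod_hom R A B"
    and c: "c \<in> carrier (free_Abelian_group (carrier M \<times> carrier A))"
  defines "\<phi> \<equiv> frag_extend (\<lambda>(x, a). frag_of (x, f a))"
  shows "\<phi> c \<in> carrier (free_Abelian_group (carrier M \<times> carrier B))"
    and "tensor_map R M A B f
          (tensor_kernel R M A #>\<^bsub>free_Abelian_group (carrier M \<times> carrier A)\<^esub> c) =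
         tensor_kernel R M B #>\<^bsub>free_Abelian_group (carrier M \<times> carrier B)\<^esub> \<phi> c"
proof -
  let ?FA = "free_Abelian_group (carrier M \<times> carrier A)"
  let ?FB = "free_Abelian_group (carrier M \<times> carrier B)"
  let ?KA = "tensor_kernel R M A" and ?KB = "tensor_kernel R M B"
  interpret M: right_module R M by fact
  interpret A: left_module R A by fact
  interpret B: left_module R B by fact
  interpret NA: normal ?KA ?FA
    by (intro tensor_kernel_normal M.M.abelian_group_axioms A.M.abelian_group_axioms
        M.smult_closed A.smult_closed)
  interpret NB: normal ?KB ?FB
    by (intro tensor_kernel_normal M.M.abelian_group_axioms B.M.abelian_group_axioms
        M.smult_closed B.smult_closed)
  have fc: "f a \<in> carrier B" if "a \<in> carrier A" for a
    using f that by (auto simp: mod_hom_def hom_def)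
  have fadd: "f (a \<oplus>\<^bsub>A\<^esub> b) = f a \<oplus>\<^bsub>B\<^esub> f b" if "a \<in> carrier A" "b \<in> carrier A" for a b
    using f that by (auto simp: mod_hom_def hom_def)
  have fsm: "f (r \<odot>\<^bsub>A\<^esub> a) = r \<odot>\<^bsub>B\<^esub> f a" if "r \<in> carrier R" "a \<in> carrier A" for r a
    using f that by (auto simp: mod_hom_def)
  have carr: "\<phi> c \<in> carrier ?FB" if "c \<in> carrier ?FA" for c
  proof -
    have "Poly_Mapping.keys (\<phi> c) \<subseteq> (\<Union>(x, a) \<in> Poly_Mapping.keys c. {(x, f a)})"
      using keys_frag_extend[of "\<lambda>(x, a). frag_of (x, f a)" c]
      by (simp add: \<phi>_def case_prod_unfold)
    also have "\<dots> \<subseteq> carrier M \<times> carrier B"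
      using that fc by (auto simp: free_Abelian_group_def)
    finally show ?thesis by (simp add: free_Abelian_group_def)
  qed
  have hom: "\<phi> (a + b) = \<phi> a + \<phi> b" for a b
    by (simp add: \<phi>_def frag_extend_add)
  interpret H: group_hom ?FA ?FB \<phi>
    by unfold_locales (use carr hom in \<open>auto simp: hom_def\<close>)
  have rel: "\<phi> ` tensor_relations R M A \<subseteq> tensor_relations R M B"
  proof
    fix y assume "y \<in> \<phi> ` tensor_relations R M A"
    then obtain z where z: "z \<in> tensor_relations R M A" and y: "y = \<phi> z" by blast
    from z consider
        (1) x x' a where "z = frag_of (x \<oplus>\<^bsub>M\<^esub> x', a) - frag_of (x, a) - frag_of (x', a)"
          "x \<in> carrier M" "x' \<in> carrier M" "a \<in> carrier A"
      | (2) x a a' where "z = frag_of (x, a \<oplus>\<^bsub>A\<^esub> a') - frag_of (x, a) - frag_of (x, a')"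
          "x \<in> carrier M" "a \<in> carrier A" "a' \<in> carrier A"
      | (3) r x a where "z = frag_of (r \<odot>\<^bsub>M\<^esub> x, a) - frag_of (x, r \<odot>\<^bsub>A\<^esub> a)"
          "r \<in> carrier R" "x \<in> carrier M" "a \<in> carrier A"
      unfolding tensor_relations_def by blast
    then show "y \<in> tensor_relations R M B"
    proof cases
      case 1
      then have "y = frag_of (x \<oplus>\<^bsub>M\<^esub> x', f a) - frag_of (x, f a) - frag_of (x', f a)"
        by (simp add: y \<phi>_def frag_extend_diff)
      with 1 fc show ?thesis unfolding tensor_relations_def by blast
    next
      case 2
      then have "y = frag_of (x, f a \<oplus>\<^bsub>B\<^esub> f a') - frag_of (x, f a) - frag_of (x, f a')"
        by (simp add: y \<phi>_def frag_extend_diff fadd)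
      with 2 fc show ?thesis unfolding tensor_relations_def by blast
    next
      case 3
      then have "y = frag_of (r \<odot>\<^bsub>M\<^esub> x, f a) - frag_of (x, r \<odot>\<^bsub>B\<^esub> f a)"
        by (simp add: y \<phi>_def frag_extend_diff fsm)
      with 3 fc show ?thesis unfolding tensor_relations_def by blast
    qed
  qed
  have relc: "tensor_relations R M A \<subseteq> carrier ?FA"
    using NA.subset generate.incl[of _ "tensor_relations R M A" ?FA]
    unfolding tensor_kernel_def by blast
  have "\<phi> ` ?KA = generate ?FB (\<phi> ` tensor_relations R M A)"
    unfolding tensor_kernel_def using H.generate_img[OF relc] by simp
  also have "\<dots> \<subseteq> ?KB"
    unfolding tensor_kernel_def using rel by (rule NB.mono_generate)
  finally have ker: "\<phi> ` ?KA \<subseteq> ?KB" .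
  show "\<phi> c \<in> carrier ?FB" by (rule carr[OF c])
  have 0: "0 \<in> ?KA" using subgroup.one_closed[OF NA.subgroup_axioms] by simp
  have Kadd: "a + b \<in> ?KB" if "a \<in> ?KB" "b \<in> ?KB" for a b
    using subgroup.m_closed[OF NB.subgroup_axioms that] by simp
  have "tensor_map R M A B f (?KA #>\<^bsub>?FA\<^esub> c) = {l + (\<phi> k + \<phi> c) | l k. l \<in> ?KB \<and> k \<in> ?KA}"
    unfolding tensor_map_def \<phi>_def[symmetric] set_mult_def r_coset_def by (auto simp: hom)
  also have "\<dots> = ?KB #>\<^bsub>?FB\<^esub> \<phi> c"
  proof (intro equalityI subsetI)
    fix y assume "y \<in> {l + (\<phi> k + \<phi> c) | l k. l \<in> ?KB \<and> k \<in> ?KA}"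
    then obtain l k where "l \<in> ?KB" "k \<in> ?KA" and y: "y = (l + \<phi> k) + \<phi> c"
      by (auto simp: add.assoc)
    then have "l + \<phi> k \<in> ?KB" using ker Kadd by blast
    then show "y \<in> ?KB #>\<^bsub>?FB\<^esub> \<phi> c" unfolding r_coset_def y by auto
  next
    fix y assume "y \<in> ?KB #>\<^bsub>?FB\<^esub> \<phi> c"
    then obtain l where l: "l \<in> ?KB" "y = l + \<phi> c" unfolding r_coset_def by auto
    have "\<phi> 0 = 0" by (simp add: \<phi>_def)
    with l have "y = l + (\<phi> 0 + \<phi> c)" by simp
    then show "y \<in> {l + (\<phi> k + \<phi> c) | l k. l \<in> ?KB \<and> k \<in> ?KA}" using l(1) 0 by blast
  qed
  finally show "tensor_map R M A B f (?KA #>\<^bsub>?FA\<^esub> c) = ?KB #>\<^bsub>?FB\<^esub> \<phi> c" .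
qed

lemma tensor_map_pure:
  assumes "right_module R M" "left_module R A" "left_module R B" "f \<in> mod_hom R A B"
    and "x \<in> carrier M" "a \<in> carrier A"
  shows "tensor_map R M A B f (pure_tensor R M A x a) = pure_tensor R M B x (f a)"
  using tensor_map_coset(2)[OF assms(1-4), of "frag_of (x, a)"] assms(5,6)
  by (simp add: pure_tensor_def free_Abelian_group_def)

lemma tensor_map_hom:
  assumes M: "right_module R M" and A: "left_module R A" and B: "left_module R B"
    and f: "f \<in> mod_hom R A B"
  shows "tensor_map R M A B f \<in> hom (tensor R M A) (tensor R M B)"
proof -
  let ?FA = "free_Abelian_group (carrier M \<times> carrier A)"
  let ?FB = "free_Abelian_group (carrier M \<times> carrier B)"
  let ?KA = "tensor_kernel R M A" and ?KB = "tensor_kernel R M B"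
  let ?\<phi> = "frag_extend (\<lambda>(x, a). frag_of (x, f a))"
  interpret M: right_module R M by fact
  interpret A: left_module R A by fact
  interpret B: left_module R B by fact
  interpret NA: normal ?KA ?FA
    by (intro tensor_kernel_normal M.M.abelian_group_axioms A.M.abelian_group_axioms
        M.smult_closed A.smult_closed)
  interpret NB: normal ?KB ?FB
    by (intro tensor_kernel_normal M.M.abelian_group_axioms B.M.abelian_group_axioms
        M.smult_closed B.smult_closed)
  note coset = tensor_map_coset[OF M A B f]
  show ?thesis
  proof (rule homI)
    fix X assume "X \<in> carrier (tensor R M A)"
    then obtain c where "c \<in> carrier ?FA" "X = ?KA #>\<^bsub>?FA\<^esub> c"
      by (auto simp: tensor_def carrier_FactGroup)
    then show "tensor_map R M A B f X \<in> carrier (tensor R M B)"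
      using coset by (auto simp: tensor_def carrier_FactGroup)
  next
    fix X Y assume "X \<in> carrier (tensor R M A)" "Y \<in> carrier (tensor R M A)"
    then obtain c d where c: "c \<in> carrier ?FA" "X = ?KA #>\<^bsub>?FA\<^esub> c"
      and d: "d \<in> carrier ?FA" "Y = ?KA #>\<^bsub>?FA\<^esub> d"
      by (auto simp: tensor_def carrier_FactGroup)
    have "X \<otimes>\<^bsub>tensor R M A\<^esub> Y = ?KA #>\<^bsub>?FA\<^esub> (c \<otimes>\<^bsub>?FA\<^esub> d)"
      using c d by (simp add: tensor_def FactGroup_def NA.rcos_sum)
    moreover have "c \<otimes>\<^bsub>?FA\<^esub> d \<in> carrier ?FA"
      using c(1) d(1) by (rule NA.m_closed)
    moreover have "?\<phi> (c \<otimes>\<^bsub>?FA\<^esub> d) = ?\<phi> c \<otimes>\<^bsub>?FB\<^esub> ?\<phi> d"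
      by (simp add: frag_extend_add)
    ultimately show "tensor_map R M A B f (X \<otimes>\<^bsub>tensor R M A\<^esub> Y) =
        tensor_map R M A B f X \<otimes>\<^bsub>tensor R M B\<^esub> tensor_map R M A B f Y"
      using c d coset NB.rcos_sum by (simp add: tensor_def FactGroup_def)
  qed
qed

text \<open>The canonical map from \<open>M \<otimes> (\<Prod> Q i)\<close> to \<open>\<Prod> (M \<otimes> Q i)\<close>: its components are induced by the
  projections.\<close>

definition tensor_prod_map ::
  "'r ring \<Rightarrow> ('r, 'm) module \<Rightarrow> 'i set \<Rightarrow> ('i \<Rightarrow> ('r, 'q) module) \<Rightarrow>
    ('m \<times> ('i \<Rightarrow> 'q) \<Rightarrow>\<^sub>0 int) set \<Rightarrow> 'i \<Rightarrow> ('m \<times> 'q \<Rightarrow>\<^sub>0 int) set"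
  where "tensor_prod_map R M I Q X =
    (\<lambda>i\<in>I. tensor_map R M (prod_module I Q) (Q i) (\<lambda>q. q i) X)"


subsection \<open>Flat and Mittag-Leffler modules\<close>

text \<open>Both notions quantify over all left modules.  A definition in HOL cannot quantify over types,
  so the types of the elements of the test modules and of the indices of the families are
  parameters.\<close>

definition flat_module :: "'q itself \<Rightarrow> 'r ring \<Rightarrow> ('r, 'm) module \<Rightarrow> bool"
  where "flat_module _ R M \<longleftrightarrow>
    (\<forall>(A :: ('r, 'q) module) (B :: ('r, 'q) module) f.
       left_module R A \<and> left_module R B \<and> f \<in> mod_hom R A B \<and> inj_on f (carrier A) \<longrightarrow>
       inj_on (tensor_map R M A B f) (carrier (tensor R M A)))"

definition mittag_leffler :: "'i itself \<Rightarrow> 'q itself \<Rightarrow> 'r ring \<Rightarrow> ('r, 'm) module \<Rightarrow> bool"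
  where "mittag_leffler _ _ R M \<longleftrightarrow>
    (\<forall>(I :: 'i set) (Q :: 'i \<Rightarrow> ('r, 'q) module).
       (\<forall>i\<in>I. left_module R (Q i)) \<longrightarrow>
       inj_on (tensor_prod_map R M I Q) (carrier (tensor R M (prod_module I Q))))"

text \<open>\<open>'u\<close> is large enough to contain test objects for modules of the size of \<open>M\<close>.  Such a type
  exists for all \<open>R\<close> and \<open>M\<close>, and every type embeds into one.\<close>

definition large_type :: "'u itself \<Rightarrow> 'r ring \<Rightarrow> ('r, 'm) module \<Rightarrow> bool"
  where "large_type _ R M \<longleftrightarrow> infinite (UNIV :: 'u set) \<and>
    |carrier R| \<le>o |UNIV :: 'u set| \<and> |carrier M| \<le>o |UNIV :: 'u set|"


subsection \<open>Projective modules\<close>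

definition free_module :: "'r ring \<Rightarrow> 'x set \<Rightarrow> ('r, 'x \<Rightarrow> 'r) module"
  where "free_module R X =
    \<lparr>carrier = {f \<in> X \<rightarrow>\<^sub>E carrier R. finite {x \<in> X. f x \<noteq> \<zero>\<^bsub>R\<^esub>}},
     monoid.mult = undefined,
     one = undefined,
     zero = (\<lambda>x\<in>X. \<zero>\<^bsub>R\<^esub>),
     add = (\<lambda>f g. \<lambda>x\<in>X. f x \<oplus>\<^bsub>R\<^esub> g x),
     smult = (\<lambda>r f. \<lambda>x\<in>X. f x \<otimes>\<^bsub>R\<^esub> r)\<rparr>"

text \<open>Projective right modules: isomorphic to a direct summand of a free module.  Bases \<open>X\<close> in the
  type \<open>'m\<close> suffice, because a projective \<open>P\<close> is a direct summand of the free module with basis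
  \<open>carrier P\<close>.\<close>

definition projective_module :: "'r ring \<Rightarrow> ('r, 'm) module \<Rightarrow> bool"
  where "projective_module R P \<longleftrightarrow>
    (\<exists>(X :: 'm set) A B h.
       submodule A R (free_module R X) \<and> submodule B R (free_module R X) \<and>
       A \<inter> B = {\<zero>\<^bsub>free_module R X\<^esub>} \<and>
       A <+>\<^bsub>free_module R X\<^esub> B = carrier (free_module R X) \<and>
       h \<in> mod_hom R P ((free_module R X)\<lparr>carrier := A\<rparr>) \<and> bij_betw h (carrier P) A)"


subsection \<open>Dense systems\<close>

definition regular_uncountable :: "'k rel \<Rightarrow> bool"
  where "regular_uncountable \<kappa> \<longleftrightarrow> Card_order \<kappa> \<and> regularCard \<kappa> \<and> natLeq <o \<kappa>"

abbreviation aleph1 :: "nat set rel"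
  where "aleph1 \<equiv> cardSuc natLeq"

definition less_generated :: "'k rel \<Rightarrow> 'r ring \<Rightarrow> ('r, 'm) module \<Rightarrow> bool"
  where "less_generated \<kappa> R N \<longleftrightarrow>
    (\<exists>S \<subseteq> carrier N. |S| <o \<kappa> \<and> (\<lambda>H. submodule H R N) hull S = carrier N)"

text \<open>The chains are indexed by well-orders \<open>\<rho>\<close> shorter than \<open>\<kappa>\<close>; each of these has a copy on the
  type \<open>'k\<close>.  The empty chain is excluded, as its union is not a submodule.\<close>

definition dense_system :: "'k rel \<Rightarrow> 'r ring \<Rightarrow> ('r, 'm) module \<Rightarrow> 'm set set \<Rightarrow> bool"
  where "dense_system \<kappa> R M \<C> \<longleftrightarrow>
    (\<forall>N\<in>\<C>. submodule N R M) \<and>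
    \<C> \<noteq> {} \<and> (\<forall>N\<in>\<C>. \<forall>N'\<in>\<C>. \<exists>N''\<in>\<C>. N \<union> N' \<subseteq> N'') \<and>
    (\<forall>(\<rho> :: 'k rel) N. Well_order \<rho> \<and> \<rho> <o \<kappa> \<and> Field \<rho> \<noteq> {} \<and> relChain \<rho> N \<and>
       (\<forall>\<alpha> \<in> Field \<rho>. N \<alpha> \<in> \<C>) \<longrightarrow> (\<Union>\<alpha> \<in> Field \<rho>. N \<alpha>) \<in> \<C>) \<and>
    (\<forall>S \<subseteq> carrier M. |S| <o \<kappa> \<longrightarrow> (\<exists>N\<in>\<C>. S \<subseteq> N))"

definition kappa_projective :: "'k rel \<Rightarrow> 'r ring \<Rightarrow> ('r, 'm) module \<Rightarrow> bool"
  where "kappa_projective \<kappa> R M \<longleftrightarrow>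
    (\<exists>\<C>. dense_system \<kappa> R M \<C> \<and>
      (\<forall>N\<in>\<C>. less_generated \<kappa> R (M\<lparr>carrier := N\<rparr>) \<and> projective_module R (M\<lparr>carrier := N\<rparr>)))"

end

theory Submission
  imports Defs "HOL-Library.Countable_Set_Type"
begin

text \<open>The proof passes through a property of right modules that mentions neither tensor products nor
  projectivity.  Let \<open>X\<close> be a finite subset of \<open>M\<close>.  A row, that is a function \<open>c\<close> from \<open>X\<close>
  to \<open>R\<close>, is called stable if it extends to a linear form on the span of every finite
  \<open>Z\<close> with \<open>X \<subseteq> Z \<subseteq> M\<close>.  The module is stably coordinatized if every finite \<open>X\<close> admits finitely
  many \<open>y\<^sub>b \<in> M\<close> and stable rows \<open>c\<^sub>b\<close> such that \<open>x = \<Sum> y\<^sub>b c\<^sub>b(x)\<close> for all \<open>x \<in> X\<close>.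
  Flat Mittag-Leffler modules, stably coordinatized modules and \<open>\<aleph>\<^sub>1\<close>-projective modules are the
  same, and \<open>\<kappa>\<close>-projective modules are stably coordinatized for every uncountable \<open>\<kappa>\<close>.

  \<^item> From \<open>\<kappa>\<close>-projective to stable coordinates (\<open>kappa_projective_imp_stably_coordinatized\<close>).
    Let \<open>N\<close> run through the members of a dense system that contain \<open>X\<close>.  A projective \<open>N\<close> gives
    coordinates of \<open>X\<close> by forms on \<open>N\<close>.  When \<open>N\<close> grows, fewer rows on \<open>X\<close> extend to forms on \<open>N\<close>.
    If this never became stationary, there would be a sequence \<open>N\<^sub>0 \<subseteq> N\<^sub>1 \<subseteq> \<dots>\<close> in the system
    along which the set of these rows shrinks strictly.  Its union \<open>U\<close> is again in the system, since
    \<open>\<kappa>\<close> is uncountable, and the finitely many vectors \<open>y\<^sub>b\<close> in the coordinates \<open>x = \<Sum> y\<^sub>b \<psi>\<^sub>b(x)\<close> over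
    \<open>U\<close> lie in some \<open>N\<^sub>n\<close>.  Every form \<open>\<chi>\<close> on \<open>N\<^sub>n\<close> then agrees on \<open>X\<close> with
    \<open>\<Sum> \<chi>(y\<^sub>b) \<psi>\<^sub>b\<close>, which is a form on all of \<open>U\<close>: a contradiction.

  \<^item> From stable coordinates to flat and Mittag-Leffler (\<open>tensor_zero_criterion\<close>).  If a tensor
    over \<open>M\<close> vanishes, it does so over a finitely generated submodule; a stable row
    extends to a form there, so it pairs the tensor to zero.  Conversely a tensor is determined by
    finitely many such pairings.  Pairings commute with maps of the second factor, in particular with
    injections and with the projections of a product.

  \<^item> From flat and Mittag-Leffler to stable coordinates
    (\<open>flat_mittag_leffler_imp_stably_coordinatized\<close>).  Call a left submodule \<open>D\<close> of
    \<open>R\<^sup>X\<close> admissible if \<open>X\<close> has coordinates with rows in \<open>D\<close>.  The tensor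
    \<open>\<Sum> x \<otimes> e\<^sub>x\<close> vanishes in \<open>M \<otimes> R\<^sup>X/D\<close> for every admissible \<open>D\<close>.  By the Mittag-Leffler property,
    applied to the finitely generated \<open>D\<close>, the corresponding tensor over the product of the modules
    \<open>R\<^sup>X/D\<close> vanishes, and as \<open>M\<close> is flat, this provides coordinates whose rows lie in the intersection of all admissible \<open>D\<close>.  Such minimal rows
    respect every linear relation between the elements of \<open>X\<close>, and they extend to
    minimal rows on larger finite sets; so they are stable.  The large types in the statement
    have room for the modules \<open>R\<^sup>X/D\<close> and for the index set of this family.

  \<^item> From stable coordinates to \<open>\<aleph>\<^sub>1\<close>-projective
    (\<open>stably_coordinatized_imp_aleph1_projective\<close>).  A stable row on \<open>X\<close> extends to a stable row
    on any larger finite set, hence to a form on any countably generated submodule that contains \<open>X\<close>.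
    The dense system consists of the countably generated submodules that contain coordinates for all
    their finite subsets.  Over such a submodule \<open>N\<close> the identity of every finite subset factors
    through a free module, and these local factorizations can be glued along a countable set of
    generators, so that \<open>N\<close> is a direct summand of a free module.\<close>

section \<open>Submodules and spans\<close>

definition lincomb :: "('r, 'm) module \<Rightarrow> ('r \<times> 'm) list \<Rightarrow> 'm"
  where "lincomb M l = foldr (\<lambda>(r, x) s. r \<odot>\<^bsub>M\<^esub> x \<oplus>\<^bsub>M\<^esub> s) l \<zero>\<^bsub>M\<^esub>"

definition lspan :: "'r ring \<Rightarrow> ('r, 'm) module \<Rightarrow> 'm set \<Rightarrow> 'm set"
  where "lspan R M S = {lincomb M l | l. set l \<subseteq> carrier R \<times> S}"

text \<open>The functions \<open>c\<close> act as coordinates with respect to the vectors \<open>y\<close>: the typical statement is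
  \<open>coord_sum M ps x = x\<close>.\<close>

definition coord_sum :: "('r, 'm) module \<Rightarrow> ('m \<times> ('x \<Rightarrow> 'r)) list \<Rightarrow> 'x \<Rightarrow> 'm"
  where "coord_sum M ps x = lincomb M (map (\<lambda>(y, c). (c x, y)) ps)"

lemma lincomb_Nil [simp]: "lincomb M [] = \<zero>\<^bsub>M\<^esub>"
  and lincomb_Cons [simp]: "lincomb M ((r, x) # l) = r \<odot>\<^bsub>M\<^esub> x \<oplus>\<^bsub>M\<^esub> lincomb M l"
  and lincomb_carrier_update [simp]: "lincomb (M\<lparr>carrier := H\<rparr>) l = lincomb M l"
  by (simp_all add: lincomb_def)

lemma coord_sum_Nil [simp]: "coord_sum M [] x = \<zero>\<^bsub>M\<^esub>"
  and coord_sum_Cons [simp]: "coord_sum M ((y, c) # ps) x = c x \<odot>\<^bsub>M\<^esub> y \<oplus>\<^bsub>M\<^esub> coord_sum M ps x"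
  and coord_sum_carrier_update [simp]: "coord_sum (M\<lparr>carrier := H\<rparr>) ps x = coord_sum M ps x"
  by (simp_all add: coord_sum_def)

lemma lspan_carrier_update [simp]: "lspan R (M\<lparr>carrier := H\<rparr>) S = lspan R M S"
  by (simp add: lspan_def)

text \<open>Left and right modules have the same theory of submodules and spans.  All that is needed of
  associativity is that the composition of two scalar actions is again a scalar action; the last
  axiom says this without fixing the order of the factors.\<close>

locale sided_module = R?: ring R + M?: abelian_group M
  for R :: "'r ring" and M :: "('r, 'm) module" +
  assumes smult_closed: "\<lbrakk>r \<in> carrier R; x \<in> carrier M\<rbrakk> \<Longrightarrow> r \<odot>\<^bsub>M\<^esub> x \<in> carrier M"
    and smult_l_distr: "\<lbrakk>r \<in> carrier R; s \<in> carrier R; x \<in> carrier M\<rbrakk> \<Longrightarrow>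
      (r \<oplus>\<^bsub>R\<^esub> s) \<odot>\<^bsub>M\<^esub> x = r \<odot>\<^bsub>M\<^esub> x \<oplus>\<^bsub>M\<^esub> s \<odot>\<^bsub>M\<^esub> x"
    and smult_r_distr: "\<lbrakk>r \<in> carrier R; x \<in> carrier M; y \<in> carrier M\<rbrakk> \<Longrightarrow>
      r \<odot>\<^bsub>M\<^esub> (x \<oplus>\<^bsub>M\<^esub> y) = r \<odot>\<^bsub>M\<^esub> x \<oplus>\<^bsub>M\<^esub> r \<odot>\<^bsub>M\<^esub> y"
    and smult_one: "x \<in> carrier M \<Longrightarrow> \<one>\<^bsub>R\<^esub> \<odot>\<^bsub>M\<^esub> x = x"
    and smult_smult: "\<lbrakk>r \<in> carrier R; s \<in> carrier R\<rbrakk> \<Longrightarrow>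
      \<exists>t\<in>carrier R. \<forall>x\<in>carrier M. r \<odot>\<^bsub>M\<^esub> (s \<odot>\<^bsub>M\<^esub> x) = t \<odot>\<^bsub>M\<^esub> x"

lemma left_module_sided: "left_module R M \<Longrightarrow> sided_module R M"
  for R :: "'r ring" and M :: "('r, 'm) module"
proof -
  assume "left_module R M"
  then interpret left_module R M .
  show ?thesis
    by unfold_locales (auto simp: smult_closed smult_l_distr smult_r_distr smult_one
        intro: smult_assoc[symmetric] bexI[of _ "_ \<otimes>\<^bsub>R\<^esub> _"])
qed

lemma right_module_sided: "right_module R M \<Longrightarrow> sided_module R M"
  for R :: "'r ring" and M :: "('r, 'm) module"
proof -
  assume "right_module R M"
  then interpret right_module R M .
  show ?thesis
  proof unfold_locales
    fix r s assume rs: "r \<in> carrier R" "s \<in> carrier R"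
    show "\<exists>t\<in>carrier R. \<forall>x\<in>carrier M. r \<odot>\<^bsub>M\<^esub> (s \<odot>\<^bsub>M\<^esub> x) = t \<odot>\<^bsub>M\<^esub> x"
      by (rule bexI[of _ "s \<otimes>\<^bsub>R\<^esub> r"]) (simp_all add: rs smult_assoc)
  qed (simp_all add: smult_closed smult_l_distr smult_r_distr smult_one)
qed

context sided_module
begin

lemma smult_l_zero: "x \<in> carrier M \<Longrightarrow> \<zero>\<^bsub>R\<^esub> \<odot>\<^bsub>M\<^esub> x = \<zero>\<^bsub>M\<^esub>"
  using smult_l_distr[of "\<zero>\<^bsub>R\<^esub>" "\<zero>\<^bsub>R\<^esub>" x] smult_closed[of "\<zero>\<^bsub>R\<^esub>" x]
  by (metis M.add.r_cancel_one' R.l_zero R.zero_closed)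

lemma smult_r_zero: "r \<in> carrier R \<Longrightarrow> r \<odot>\<^bsub>M\<^esub> \<zero>\<^bsub>M\<^esub> = \<zero>\<^bsub>M\<^esub>"
  using smult_r_distr[of r "\<zero>\<^bsub>M\<^esub>" "\<zero>\<^bsub>M\<^esub>"] smult_closed[of r "\<zero>\<^bsub>M\<^esub>"]
  by (metis M.add.r_cancel_one' M.l_zero M.zero_closed)

lemma smult_l_minus: "\<lbrakk>r \<in> carrier R; x \<in> carrier M\<rbrakk> \<Longrightarrow> (\<ominus>\<^bsub>R\<^esub> r) \<odot>\<^bsub>M\<^esub> x = \<ominus>\<^bsub>M\<^esub> (r \<odot>\<^bsub>M\<^esub> x)"
  using smult_l_distr[of "\<ominus>\<^bsub>R\<^esub> r" r x] smult_closed
  by (metis M.minus_equality R.a_inv_closed R.l_neg smult_l_zero)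

lemma smult_r_minus: "\<lbrakk>r \<in> carrier R; x \<in> carrier M\<rbrakk> \<Longrightarrow> r \<odot>\<^bsub>M\<^esub> (\<ominus>\<^bsub>M\<^esub> x) = \<ominus>\<^bsub>M\<^esub> (r \<odot>\<^bsub>M\<^esub> x)"
  using smult_r_distr[of r "\<ominus>\<^bsub>M\<^esub> x" x] smult_closed
  by (metis M.minus_equality M.a_inv_closed M.l_neg smult_r_zero)

lemma smult_minus_one: "x \<in> carrier M \<Longrightarrow> (\<ominus>\<^bsub>R\<^esub> \<one>\<^bsub>R\<^esub>) \<odot>\<^bsub>M\<^esub> x = \<ominus>\<^bsub>M\<^esub> x"
  by (simp add: smult_l_minus smult_one)

lemma minus_zero: "\<ominus>\<^bsub>M\<^esub> \<zero>\<^bsub>M\<^esub> = \<zero>\<^bsub>M\<^esub>"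
  by (rule M.minus_equality) simp_all

lemma add_minus_both:
  assumes "x \<in> carrier M" "y \<in> carrier M"
  shows "x \<oplus>\<^bsub>M\<^esub> y \<ominus>\<^bsub>M\<^esub> x \<ominus>\<^bsub>M\<^esub> y = \<zero>\<^bsub>M\<^esub>"
proof -
  have "x \<oplus>\<^bsub>M\<^esub> y \<ominus>\<^bsub>M\<^esub> x \<ominus>\<^bsub>M\<^esub> y = (x \<ominus>\<^bsub>M\<^esub> x) \<oplus>\<^bsub>M\<^esub> (y \<ominus>\<^bsub>M\<^esub> y)"
    using assms by (simp add: M.minus_eq M.a_ac)
  then show ?thesis using assms by (simp add: M.minus_eq M.r_neg)
qed

lemma submoduleI:
  assumes "H \<subseteq> carrier M" "\<zero>\<^bsub>M\<^esub> \<in> H"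
    and "\<And>x y. \<lbrakk>x \<in> H; y \<in> H\<rbrakk> \<Longrightarrow> x \<oplus>\<^bsub>M\<^esub> y \<in> H"
    and "\<And>r x. \<lbrakk>r \<in> carrier R; x \<in> H\<rbrakk> \<Longrightarrow> r \<odot>\<^bsub>M\<^esub> x \<in> H"
  shows "submodule H R M"
proof -
  have "\<ominus>\<^bsub>M\<^esub> x \<in> H" if "x \<in> H" for x
    using assms(4)[of "\<ominus>\<^bsub>R\<^esub> \<one>\<^bsub>R\<^esub>" x] smult_minus_one[of x] that assms(1) by auto
  then show ?thesis
    using assms by (auto simp: submodule_def submodule_axioms_def subgroup_def a_inv_def)
qed

lemma
  assumes "submodule H R M"
  shows submodule_subset: "H \<subseteq> carrier M"
    and submodule_zero: "\<zero>\<^bsub>M\<^esub> \<in> H"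
    and submodule_add: "\<lbrakk>x \<in> H; y \<in> H\<rbrakk> \<Longrightarrow> x \<oplus>\<^bsub>M\<^esub> y \<in> H"
    and submodule_minus: "x \<in> H \<Longrightarrow> \<ominus>\<^bsub>M\<^esub> x \<in> H"
    and submodule_smult: "\<lbrakk>r \<in> carrier R; x \<in> H\<rbrakk> \<Longrightarrow> r \<odot>\<^bsub>M\<^esub> x \<in> H"
  using assms by (auto simp: submodule_def submodule_axioms_def subgroup_def a_inv_def)

lemma submodule_carrier: "submodule (carrier M) R M"
  by (rule submoduleI) (auto simp: smult_closed)

lemma lincomb_in_submodule:
  assumes "submodule H R M" "set l \<subseteq> carrier R \<times> H"
  shows "lincomb M l \<in> H"
  using assms(2)
proof (induction l)
  case Nil
  then show ?case using submodule_zero[OF assms(1)] by simp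
next
  case (Cons p l)
  obtain r x where "p = (r, x)" by (cases p)
  with Cons show ?case
    by (simp add: submodule_add[OF assms(1)] submodule_smult[OF assms(1)])
qed

lemma lincomb_closed: "set l \<subseteq> carrier R \<times> carrier M \<Longrightarrow> lincomb M l \<in> carrier M"
  by (rule lincomb_in_submodule[OF submodule_carrier])

lemma lincomb_append:
  "\<lbrakk>set l \<subseteq> carrier R \<times> carrier M; set l' \<subseteq> carrier R \<times> carrier M\<rbrakk> \<Longrightarrow>
    lincomb M (l @ l') = lincomb M l \<oplus>\<^bsub>M\<^esub> lincomb M l'"
proof (induction l)
  case (Cons p l)
  obtain r x where "p = (r, x)" by (cases p)
  with Cons show ?case
    by (simp add: M.a_assoc smult_closed lincomb_closed)
qed (simp add: lincomb_closed)

lemma coord_sum_in_submodule: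
  assumes "submodule H R M" "\<And>y c. (y, c) \<in> set ps \<Longrightarrow> y \<in> H \<and> c x \<in> carrier R"
  shows "coord_sum M ps x \<in> H"
  unfolding coord_sum_def by (rule lincomb_in_submodule[OF assms(1)]) (use assms(2) in auto)

lemma coord_sum_closed:
  "(\<And>y c. (y, c) \<in> set ps \<Longrightarrow> y \<in> carrier M \<and> c x \<in> carrier R) \<Longrightarrow> coord_sum M ps x \<in> carrier M"
  by (rule coord_sum_in_submodule[OF submodule_carrier])

lemma lspan_submodule:
  assumes "S \<subseteq> carrier M"
  shows "submodule (lspan R M S) R M"
proof (rule submoduleI)
  have sub: "carrier R \<times> S \<subseteq> carrier R \<times> carrier M" using assms by blast
  show "lspan R M S \<subseteq> carrier M"
    using lincomb_closed sub by (auto simp: lspan_def)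
  show "\<zero>\<^bsub>M\<^esub> \<in> lspan R M S"
    unfolding lspan_def by (rule CollectI, rule exI[of _ "[]"]) simp
  show "x \<oplus>\<^bsub>M\<^esub> y \<in> lspan R M S" if "x \<in> lspan R M S" "y \<in> lspan R M S" for x y
  proof -
    from that obtain l l' where "set l \<subseteq> carrier R \<times> S" "set l' \<subseteq> carrier R \<times> S"
      "x = lincomb M l" "y = lincomb M l'" by (auto simp: lspan_def)
    then show ?thesis unfolding lspan_def
      by (intro CollectI exI[of _ "l @ l'"]) (use sub lincomb_append[of l l'] in auto)
  qed
  show "r \<odot>\<^bsub>M\<^esub> x \<in> lspan R M S" if r: "r \<in> carrier R" and x: "x \<in> lspan R M S" for r x
  proof -
    from x obtain l where l: "set l \<subseteq> carrier R \<times> S" and x: "x = lincomb M l" by (auto simp: lspan_def)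
    have "\<exists>l'. set l' \<subseteq> carrier R \<times> S \<and> r \<odot>\<^bsub>M\<^esub> lincomb M l = lincomb M l'" using l
    proof (induction l)
      case Nil
      then show ?case using r by (intro exI[of _ "[]"]) (simp add: smult_r_zero)
    next
      case (Cons p l)
      obtain s z where p: "p = (s, z)" by (cases p)
      from Cons obtain l' where l': "set l' \<subseteq> carrier R \<times> S" "r \<odot>\<^bsub>M\<^esub> lincomb M l = lincomb M l'" by auto
      obtain t where t: "t \<in> carrier R" "r \<odot>\<^bsub>M\<^esub> (s \<odot>\<^bsub>M\<^esub> z) = t \<odot>\<^bsub>M\<^esub> z"
        using smult_smult[of r s] Cons.prems p r sub by force
      have "r \<odot>\<^bsub>M\<^esub> lincomb M (p # l) = lincomb M ((t, z) # l')"
        using Cons.prems p r l' t assms sub lincomb_closed[of l]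
        by (auto simp: smult_r_distr smult_closed)
      then show ?case using Cons.prems p t l'
        by (intro exI[of _ "(t, z) # l'"]) auto
    qed
    then show ?thesis unfolding x lspan_def by blast
  qed
qed

lemma lspan_incl: "S \<subseteq> carrier M \<Longrightarrow> S \<subseteq> lspan R M S"
proof
  fix x assume "S \<subseteq> carrier M" "x \<in> S"
  then show "x \<in> lspan R M S" unfolding lspan_def
    by (intro CollectI exI[of _ "[(\<one>\<^bsub>R\<^esub>, x)]"]) (auto simp: smult_one)
qed

lemma lspan_minimal: "\<lbrakk>submodule H R M; S \<subseteq> H\<rbrakk> \<Longrightarrow> lspan R M S \<subseteq> H"
  by (auto simp: lspan_def intro!: lincomb_in_submodule)

lemma lspan_mono: "S \<subseteq> T \<Longrightarrow> lspan R M S \<subseteq> lspan R M T"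
  by (force simp: lspan_def)

lemma lspan_closed: "S \<subseteq> carrier M \<Longrightarrow> lspan R M S \<subseteq> carrier M"
  by (rule lspan_minimal[OF submodule_carrier])

lemma lspan_eq_hull:
  assumes "S \<subseteq> carrier M"
  shows "(\<lambda>H. submodule H R M) hull S = lspan R M S"
  by (rule hull_unique) (use assms lspan_incl lspan_submodule lspan_minimal in auto)

lemma lspan_finite_support:
  assumes "finite U" "U \<subseteq> lspan R M S"
  obtains X where "finite X" "X \<subseteq> S" "U \<subseteq> lspan R M X"
proof -
  have "\<exists>l. set l \<subseteq> carrier R \<times> S \<and> u = lincomb M l" if "u \<in> U" for u
    using that assms(2) by (auto simp: lspan_def)
  then obtain l where l: "\<And>u. u \<in> U \<Longrightarrow> set (l u) \<subseteq> carrier R \<times> S \<and> u = lincomb M (l u)"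
    by metis
  let ?X = "\<Union>u\<in>U. snd ` set (l u)"
  have "U \<subseteq> lspan R M ?X"
  proof
    fix u assume u: "u \<in> U"
    have "set (l u) \<subseteq> carrier R \<times> ?X" using l[OF u] u by force
    then show "u \<in> lspan R M ?X" using l[OF u] by (auto simp: lspan_def)
  qed
  then show ?thesis
    using l assms(1) by (intro that[of ?X]) (auto, force)
qed

lemma submodule_Union_directed:
  assumes "\<A> \<noteq> {}" "\<And>A. A \<in> \<A> \<Longrightarrow> submodule A R M"
    and "\<And>A B. \<lbrakk>A \<in> \<A>; B \<in> \<A>\<rbrakk> \<Longrightarrow> \<exists>C\<in>\<A>. A \<union> B \<subseteq> C"
  shows "submodule (\<Union>\<A>) R M"
proof (rule submoduleI)
  show "x \<oplus>\<^bsub>M\<^esub> y \<in> \<Union>\<A>" if xy: "x \<in> \<Union>\<A>" "y \<in> \<Union>\<A>" for x y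
  proof -
    from xy obtain A B where "A \<in> \<A>" "B \<in> \<A>" "x \<in> A" "y \<in> B" by blast
    with assms(3)[of A B] obtain C where "C \<in> \<A>" "x \<in> C" "y \<in> C" by blast
    then show ?thesis using submodule_add[OF assms(2)] by blast
  qed
qed (use assms(1,2) submodule_subset submodule_zero submodule_smult in blast)+

lemma submodule_abelian_group:
  assumes H: "submodule H R M"
  shows "abelian_group (M\<lparr>carrier := H\<rparr>)"
proof (rule abelian_groupI)
  note [simp] = subsetD[OF submodule_subset[OF H]] submodule_add[OF H] submodule_zero[OF H]
  fix x assume x: "x \<in> carrier (M\<lparr>carrier := H\<rparr>)"
  show "\<exists>y\<in>carrier (M\<lparr>carrier := H\<rparr>). y \<oplus>\<^bsub>M\<lparr>carrier := H\<rparr>\<^esub> x = \<zero>\<^bsub>M\<lparr>carrier := H\<rparr>\<^esub>"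
    using x submodule_minus[OF H, of x] by (auto intro!: bexI[of _ "\<ominus>\<^bsub>M\<^esub> x"] M.l_neg dest: subsetD[OF submodule_subset[OF H]])
qed (use submodule_subset[OF H] in \<open>auto simp: M.a_ac submodule_add[OF H] submodule_zero[OF H] subset_iff\<close>)

end

lemma submodule_as_right_module:
  fixes R :: "'r ring" and M :: "('r, 'm) module"
  assumes M: "right_module R M" and H: "submodule H R M"
  shows "right_module R (M\<lparr>carrier := H\<rparr>)"
proof -
  interpret right_module R M by fact
  interpret S: sided_module R M by (rule right_module_sided[OF M])
  note [simp] = subsetD[OF S.submodule_subset[OF H]] S.submodule_add[OF H] S.submodule_zero[OF H]
    S.submodule_smult[OF H] S.submodule_minus[OF H]
  show ?thesis using S.submodule_abelian_group[OF H]
    by (intro right_module.intro right_module_axioms.intro)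
      (auto simp: R.ring_axioms smult_l_distr smult_r_distr smult_assoc smult_one)
qed

lemma submodule_as_left_module:
  fixes R :: "'r ring" and M :: "('r, 'm) module"
  assumes M: "left_module R M" and H: "submodule H R M"
  shows "left_module R (M\<lparr>carrier := H\<rparr>)"
proof -
  interpret left_module R M by fact
  interpret S: sided_module R M by (rule left_module_sided[OF M])
  note [simp] = subsetD[OF S.submodule_subset[OF H]] S.submodule_add[OF H] S.submodule_zero[OF H]
    S.submodule_smult[OF H] S.submodule_minus[OF H]
  show ?thesis using S.submodule_abelian_group[OF H]
    by (intro left_module.intro left_module_axioms.intro)
      (auto simp: R.ring_axioms smult_l_distr smult_r_distr smult_assoc smult_one)
qed

section \<open>Linear forms and coordinates\<close>

definition left_regular :: "'r ring \<Rightarrow> ('r, 'r) module"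
  where "left_regular R =
    \<lparr>carrier = carrier R, monoid.mult = undefined, one = undefined, zero = \<zero>\<^bsub>R\<^esub>,
     add = (\<oplus>\<^bsub>R\<^esub>), smult = (\<otimes>\<^bsub>R\<^esub>)\<rparr>"

lemma left_regular_simps [simp]:
  "carrier (left_regular R) = carrier R" "\<zero>\<^bsub>left_regular R\<^esub> = \<zero>\<^bsub>R\<^esub>"
  "x \<oplus>\<^bsub>left_regular R\<^esub> y = x \<oplus>\<^bsub>R\<^esub> y" "r \<odot>\<^bsub>left_regular R\<^esub> x = r \<otimes>\<^bsub>R\<^esub> x"
  by (simp_all add: left_regular_def)

lemma left_module_left_regular:
  fixes R :: "'r ring"
  assumes "ring R"
  shows "left_module R (left_regular R)"
proof -
  interpret ring R by fact
  have "abelian_group (left_regular R)"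
    by (rule abelian_groupI) (auto simp: a_ac intro!: bexI[of _ "\<ominus>\<^bsub>R\<^esub> _"] l_neg)
  then show ?thesis
    by (intro left_module.intro left_module_axioms.intro)
      (auto simp: assms l_distr r_distr m_assoc)
qed

text \<open>Homomorphisms to the right module \<open>R\<close>: in the convention for right modules, \<open>r \<odot>\<^bsub>M\<^esub> x\<close> is the
  product \<open>x r\<close>, so the scalar moves to the right of the value.\<close>

definition linear_form :: "'r ring \<Rightarrow> ('r, 'm) module \<Rightarrow> 'm set \<Rightarrow> ('m \<Rightarrow> 'r) \<Rightarrow> bool"
  where "linear_form R M N \<psi> \<longleftrightarrow>
    (\<forall>x\<in>N. \<psi> x \<in> carrier R) \<and>
    (\<forall>x\<in>N. \<forall>y\<in>N. \<psi> (x \<oplus>\<^bsub>M\<^esub> y) = \<psi> x \<oplus>\<^bsub>R\<^esub> \<psi> y) \<and>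
    (\<forall>r\<in>carrier R. \<forall>x\<in>N. \<psi> (r \<odot>\<^bsub>M\<^esub> x) = \<psi> x \<otimes>\<^bsub>R\<^esub> r)"

lemma linear_form_mono: "\<lbrakk>linear_form R M N \<psi>; N' \<subseteq> N\<rbrakk> \<Longrightarrow> linear_form R M N' \<psi>"
  unfolding linear_form_def by blast

lemma linear_form_carrier_update [simp]:
  "linear_form R (M\<lparr>carrier := H\<rparr>) N \<psi> \<longleftrightarrow> linear_form R M N \<psi>"
  by (simp add: linear_form_def)

definition row_comb :: "'r ring \<Rightarrow> ('r \<times> ('x \<Rightarrow> 'r)) list \<Rightarrow> 'x \<Rightarrow> 'r"
  where "row_comb R qs x = lincomb (left_regular R) (map (\<lambda>(a, c). (a, c x)) qs)"

lemma row_comb_Nil [simp]: "row_comb R [] x = \<zero>\<^bsub>R\<^esub>"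
  and row_comb_Cons [simp]: "row_comb R ((a, c) # qs) x = a \<otimes>\<^bsub>R\<^esub> c x \<oplus>\<^bsub>R\<^esub> row_comb R qs x"
  by (simp_all add: row_comb_def)

locale right_mod = right_module R M for R :: "'r ring" and M :: "('r, 'm) module" 
begin

sublocale sided_module R M
  by (rule right_module_sided) unfold_locales

sublocale left_reg: sided_module R "left_regular R"
  by (intro left_module_sided left_module_left_regular) unfold_locales

lemma
  assumes "linear_form R M N \<psi>"
  shows linear_form_closed: "x \<in> N \<Longrightarrow> \<psi> x \<in> carrier R"
    and linear_form_add: "\<lbrakk>x \<in> N; y \<in> N\<rbrakk> \<Longrightarrow> \<psi> (x \<oplus>\<^bsub>M\<^esub> y) = \<psi> x \<oplus>\<^bsub>R\<^esub> \<psi> y"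
    and linear_form_smult: "\<lbrakk>r \<in> carrier R; x \<in> N\<rbrakk> \<Longrightarrow> \<psi> (r \<odot>\<^bsub>M\<^esub> x) = \<psi> x \<otimes>\<^bsub>R\<^esub> r"
  using assms by (auto simp: linear_form_def)

lemma linear_form_zero:
  assumes "linear_form R M N \<psi>" "submodule N R M"
  shows "\<psi> \<zero>\<^bsub>M\<^esub> = \<zero>\<^bsub>R\<^esub>"
proof -
  have 0: "\<zero>\<^bsub>M\<^esub> \<in> N" by (rule submodule_zero[OF assms(2)])
  have "\<psi> (\<zero>\<^bsub>R\<^esub> \<odot>\<^bsub>M\<^esub> \<zero>\<^bsub>M\<^esub>) = \<psi> \<zero>\<^bsub>M\<^esub> \<otimes>\<^bsub>R\<^esub> \<zero>\<^bsub>R\<^esub>"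
    using linear_form_smult[OF assms(1) _ 0] by simp
  then show ?thesis
    using linear_form_closed[OF assms(1) 0] smult_r_zero by simp
qed

lemma linear_form_eq_on_lspan:
  assumes "linear_form R M N \<psi>" "linear_form R M N' \<psi>'" "submodule N R M" "submodule N' R M"
    and "S \<subseteq> N" "S \<subseteq> N'" "\<And>x. x \<in> S \<Longrightarrow> \<psi> x = \<psi>' x" and x: "x \<in> lspan R M S"
  shows "\<psi> x = \<psi>' x"
proof -
  have "submodule {x \<in> N \<inter> N'. \<psi> x = \<psi>' x} R M"
    using assms(1-4)
    by (intro submoduleI)
      (auto simp: submodule_zero submodule_add submodule_smult linear_form_zero
        linear_form_add linear_form_smult dest: submodule_subset)
  then have "lspan R M S \<subseteq> {x \<in> N \<inter> N'. \<psi> x = \<psi>' x}"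
    by (rule lspan_minimal) (use assms in auto)
  then show ?thesis using x by blast
qed

lemma coord_sum_linear:
  assumes "submodule N R M" "\<And>y c. (y, c) \<in> set ps \<Longrightarrow> y \<in> carrier M \<and> linear_form R M N c"
  shows coord_sum_add:
      "\<lbrakk>x \<in> N; x' \<in> N\<rbrakk> \<Longrightarrow> coord_sum M ps (x \<oplus>\<^bsub>M\<^esub> x') = coord_sum M ps x \<oplus>\<^bsub>M\<^esub> coord_sum M ps x'"
    and coord_sum_smult:
      "\<lbrakk>r \<in> carrier R; x \<in> N\<rbrakk> \<Longrightarrow> coord_sum M ps (r \<odot>\<^bsub>M\<^esub> x) = r \<odot>\<^bsub>M\<^esub> coord_sum M ps x"
    and coord_sum_zero: "coord_sum M ps \<zero>\<^bsub>M\<^esub> = \<zero>\<^bsub>M\<^esub>"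
proof -
  have cl: "coord_sum M qs x \<in> carrier M" if "set qs \<subseteq> set ps" "x \<in> N" for qs x
    using that assms(2) by (intro coord_sum_closed) (auto simp: linear_form_def)
  have "coord_sum M qs (x \<oplus>\<^bsub>M\<^esub> x') = coord_sum M qs x \<oplus>\<^bsub>M\<^esub> coord_sum M qs x'"
    if "x \<in> N" "x' \<in> N" "set qs \<subseteq> set ps" for qs x x'
    using that(3)
  proof (induction qs)
    case (Cons p qs)
    obtain y c where p: "p = (y, c)" by (cases p)
    then have "y \<in> carrier M" "linear_form R M N c" using assms(2) Cons.prems by auto
    then show ?case using Cons that p cl[of qs]
      by (simp add: linear_form_add linear_form_closed smult_l_distr smult_closed M.a_ac)
  qed simp
  then show "coord_sum M ps (x \<oplus>\<^bsub>M\<^esub> x') = coord_sum M ps x \<oplus>\<^bsub>M\<^esub> coord_sum M ps x'"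
    if "x \<in> N" "x' \<in> N" using that by blast
  have "coord_sum M qs (r \<odot>\<^bsub>M\<^esub> x) = r \<odot>\<^bsub>M\<^esub> coord_sum M qs x"
    if "x \<in> N" "r \<in> carrier R" "set qs \<subseteq> set ps" for qs x r
    using that(3)
  proof (induction qs)
    case (Cons p qs)
    obtain y c where p: "p = (y, c)" by (cases p)
    then have "y \<in> carrier M" "linear_form R M N c" using assms(2) Cons.prems by auto
    then show ?case using Cons that p cl[of qs]
      by (simp add: linear_form_smult linear_form_closed smult_assoc smult_r_distr smult_closed)
  qed (use that smult_r_zero in simp)
  then show smult: "coord_sum M ps (r \<odot>\<^bsub>M\<^esub> x) = r \<odot>\<^bsub>M\<^esub> coord_sum M ps x"
    if "r \<in> carrier R" "x \<in> N" for r x using that by blast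
  show "coord_sum M ps \<zero>\<^bsub>M\<^esub> = \<zero>\<^bsub>M\<^esub>"
    using smult[of "\<zero>\<^bsub>R\<^esub>" "\<zero>\<^bsub>M\<^esub>"] cl[of ps "\<zero>\<^bsub>M\<^esub>"] submodule_zero[OF assms(1)]
    by (simp add: smult_l_zero)
qed

text \<open>Both sides are linear as long as the coordinate functions are forms, so a coordinate
  identity needs to be checked on generators only.\<close>

lemma coord_sum_reproduces_lspan:
  assumes N: "submodule N R M" and ps: "\<And>y c. (y, c) \<in> set ps \<Longrightarrow> y \<in> carrier M \<and> linear_form R M N c"
    and S: "S \<subseteq> N" "\<And>x. x \<in> S \<Longrightarrow> coord_sum M ps x = x" and x: "x \<in> lspan R M S"
  shows "coord_sum M ps x = x"
proof -
  have "submodule {x \<in> N. coord_sum M ps x = x} R M"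
    using N coord_sum_linear[OF N ps]
    by (intro submoduleI) (auto simp: submodule_zero submodule_add submodule_smult
        dest: submodule_subset)
  then have "lspan R M S \<subseteq> {x \<in> N. coord_sum M ps x = x}"
    by (rule lspan_minimal) (use S in auto)
  then show ?thesis using x by blast
qed

text \<open>Evaluating a form at a vector given by its coordinates expresses the form as a left
  combination of the coordinate functions.  So a set of rows that is closed under left combinations
  and suffices to coordinatize \<open>X\<close> in \<open>N\<close> contains the restriction to \<open>X\<close> of every form on \<open>N\<close>.\<close>

lemma linear_form_coord_sum:
  assumes N: "submodule N R M" and \<chi>: "linear_form R M N \<chi>"
    and ps: "\<And>y c. (y, c) \<in> set ps \<Longrightarrow> y \<in> N \<and> c x \<in> carrier R"
  shows "\<chi> (coord_sum M ps x) = row_comb R (map (\<lambda>(y, c). (\<chi> y, c)) ps) x"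
  using ps
proof (induction ps)
  case Nil
  then show ?case using linear_form_zero[OF \<chi> N] by simp
next
  case (Cons p ps)
  obtain y c where p: "p = (y, c)" by (cases p)
  have "coord_sum M ps x \<in> N"
    by (rule coord_sum_in_submodule[OF N]) (use Cons.prems in auto)
  moreover have "y \<in> N" "c x \<in> carrier R" using Cons.prems p by auto
  moreover have "\<chi> (coord_sum M ps x) = row_comb R (map (\<lambda>(y, c). (\<chi> y, c)) ps) x"
    by (rule Cons.IH) (use Cons.prems in auto)
  ultimately show ?case using p
    by (simp add: linear_form_add[OF \<chi>] linear_form_smult[OF \<chi>] submodule_smult[OF N])
qed

lemma row_comb_closed_under:
  assumes "P (\<lambda>x. \<zero>\<^bsub>R\<^esub>)" "\<And>c d. \<lbrakk>P c; P d\<rbrakk> \<Longrightarrow> P (\<lambda>x. c x \<oplus>\<^bsub>R\<^esub> d x)"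
    and "\<And>a c. \<lbrakk>a \<in> carrier R; P c\<rbrakk> \<Longrightarrow> P (\<lambda>x. a \<otimes>\<^bsub>R\<^esub> c x)"
    and "\<And>a c. (a, c) \<in> set qs \<Longrightarrow> a \<in> carrier R \<and> P c"
  shows "P (row_comb R qs)"
  using assms(4)
proof (induction qs)
  case Nil
  then show ?case using assms(1) by (simp add: row_comb_def)
next
  case (Cons q qs)
  obtain a c where q: "q = (a, c)" by (cases q)
  have "row_comb R (q # qs) = (\<lambda>x. a \<otimes>\<^bsub>R\<^esub> c x \<oplus>\<^bsub>R\<^esub> row_comb R qs x)" by (simp add: q fun_eq_iff)
  moreover have "a \<in> carrier R" "P c" using Cons.prems q by auto
  moreover have "P (row_comb R qs)" using Cons.IH Cons.prems by (meson list.set_intros(2))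
  ultimately show ?case by (simp add: assms(2)[OF assms(3)])
qed

lemma linear_form_zero_fun: "linear_form R M N (\<lambda>x. \<zero>\<^bsub>R\<^esub>)"
  and linear_form_plus: "\<lbrakk>linear_form R M N c; linear_form R M N d\<rbrakk> \<Longrightarrow>
    linear_form R M N (\<lambda>x. c x \<oplus>\<^bsub>R\<^esub> d x)"
  and linear_form_lmult: "\<lbrakk>a \<in> carrier R; linear_form R M N c\<rbrakk> \<Longrightarrow>
    linear_form R M N (\<lambda>x. a \<otimes>\<^bsub>R\<^esub> c x)"
  by (auto simp: linear_form_def R.a_ac R.l_distr R.m_assoc R.r_distr)

lemma linear_form_row_comb:
  assumes "\<And>a c. (a, c) \<in> set qs \<Longrightarrow> a \<in> carrier R \<and> linear_form R M N c"
  shows "linear_form R M N (row_comb R qs)"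
  by (rule row_comb_closed_under[OF linear_form_zero_fun linear_form_plus linear_form_lmult assms])

end

section \<open>Projective modules have finite coordinates\<close>

definition basis_vector :: "'r ring \<Rightarrow> 'x set \<Rightarrow> 'x \<Rightarrow> ('x \<Rightarrow> 'r)"
  where "basis_vector R X x = (\<lambda>y\<in>X. if y = x then \<one>\<^bsub>R\<^esub> else \<zero>\<^bsub>R\<^esub>)"

lemma free_module_simps [simp]:
  "\<zero>\<^bsub>free_module R X\<^esub> = (\<lambda>x\<in>X. \<zero>\<^bsub>R\<^esub>)"
  "f \<oplus>\<^bsub>free_module R X\<^esub> g = (\<lambda>x\<in>X. f x \<oplus>\<^bsub>R\<^esub> g x)"
  "r \<odot>\<^bsub>free_module R X\<^esub> f = (\<lambda>x\<in>X. f x \<otimes>\<^bsub>R\<^esub> r)"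
  by (simp_all add: free_module_def)

lemma free_module_carrier: "carrier (free_module R X) = {f \<in> X \<rightarrow>\<^sub>E carrier R. finite {x \<in> X. f x \<noteq> \<zero>\<^bsub>R\<^esub>}}"
  by (simp add: free_module_def)

lemma right_module_free_module:
  fixes R :: "'r ring"
  assumes "ring R"
  shows "right_module R (free_module R X)"
proof -
  interpret ring R by fact
  have mem: "f \<in> carrier (free_module R X) \<longleftrightarrow> f \<in> X \<rightarrow>\<^sub>E carrier R \<and> finite {x \<in> X. f x \<noteq> \<zero>\<^bsub>R\<^esub>}" for f
    by (simp add: free_module_carrier)
  have memI: "(\<lambda>x\<in>X. f x) \<in> carrier (free_module R X)"
    if "\<And>x. x \<in> X \<Longrightarrow> f x \<in> carrier R" "finite S" "\<And>x. \<lbrakk>x \<in> X; f x \<noteq> \<zero>\<^bsub>R\<^esub>\<rbrakk> \<Longrightarrow> x \<in> S" for f S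
  proof -
    have "{x \<in> X. restrict f X x \<noteq> \<zero>\<^bsub>R\<^esub>} \<subseteq> S" using that(3) by auto
    then have "finite {x \<in> X. restrict f X x \<noteq> \<zero>\<^bsub>R\<^esub>}" using that(2) by (rule finite_subset)
    moreover have "restrict f X \<in> X \<rightarrow>\<^sub>E carrier R" using that(1) by auto
    ultimately show ?thesis unfolding mem by blast
  qed
  note memD = mem[THEN iffD1, THEN conjunct1, THEN PiE_mem] mem[THEN iffD1, THEN conjunct2]
  have ext: "f \<in> carrier (free_module R X) \<Longrightarrow> (\<lambda>x\<in>X. f x) = f" for f
    by (auto simp: mem PiE_iff extensional_restrict)
  have add: "f \<oplus>\<^bsub>free_module R X\<^esub> g \<in> carrier (free_module R X)"
    if f: "f \<in> carrier (free_module R X)" and g: "g \<in> carrier (free_module R X)" for f g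
    unfolding free_module_simps
    by (rule memI[where S = "{x \<in> X. f x \<noteq> \<zero>\<^bsub>R\<^esub>} \<union> {x \<in> X. g x \<noteq> \<zero>\<^bsub>R\<^esub>}"])
      (use memD[OF f] memD[OF g] in auto)
  have smult: "r \<odot>\<^bsub>free_module R X\<^esub> f \<in> carrier (free_module R X)"
    if f: "f \<in> carrier (free_module R X)" and r: "r \<in> carrier R" for f r
    unfolding free_module_simps
    by (rule memI[where S = "{x \<in> X. f x \<noteq> \<zero>\<^bsub>R\<^esub>}"]) (use memD[OF f] r in auto)
  have "abelian_group (free_module R X)"
  proof (rule abelian_groupI)
    fix f assume f: "f \<in> carrier (free_module R X)"
    have "(\<lambda>x\<in>X. \<ominus>\<^bsub>R\<^esub> f x) \<in> carrier (free_module R X)"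
      by (rule memI[where S = "{x \<in> X. f x \<noteq> \<zero>\<^bsub>R\<^esub>}"]) (use memD[OF f] in auto)
    moreover have "(\<lambda>x\<in>X. \<ominus>\<^bsub>R\<^esub> f x) \<oplus>\<^bsub>free_module R X\<^esub> f = \<zero>\<^bsub>free_module R X\<^esub>"
      using memD(1)[OF f] by (auto simp: l_neg intro!: restrict_ext)
    ultimately show "\<exists>g\<in>carrier (free_module R X). g \<oplus>\<^bsub>free_module R X\<^esub> f = \<zero>\<^bsub>free_module R X\<^esub>"
      by blast
    have "\<zero>\<^bsub>free_module R X\<^esub> \<oplus>\<^bsub>free_module R X\<^esub> f = (\<lambda>x\<in>X. f x)"
      using memD(1)[OF f] by (auto intro!: restrict_ext)
    then show "\<zero>\<^bsub>free_module R X\<^esub> \<oplus>\<^bsub>free_module R X\<^esub> f = f" using ext[OF f] by simp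
  next
    show "\<zero>\<^bsub>free_module R X\<^esub> \<in> carrier (free_module R X)"
      unfolding free_module_simps by (rule memI[of _ "{}"]) auto
  next
    fix f g assume fg: "f \<in> carrier (free_module R X)" "g \<in> carrier (free_module R X)"
    show "f \<oplus>\<^bsub>free_module R X\<^esub> g \<in> carrier (free_module R X)" by (rule add[OF fg])
    note fgc = memD(1)[OF fg(1)] memD(1)[OF fg(2)]
    show "f \<oplus>\<^bsub>free_module R X\<^esub> g = g \<oplus>\<^bsub>free_module R X\<^esub> f"
      using fgc by (auto intro!: restrict_ext simp: a_ac)
    fix h assume "h \<in> carrier (free_module R X)"
    then show "f \<oplus>\<^bsub>free_module R X\<^esub> g \<oplus>\<^bsub>free_module R X\<^esub> h = f \<oplus>\<^bsub>free_module R X\<^esub> (g \<oplus>\<^bsub>free_module R X\<^esub> h)"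
      using fgc memD(1) by (auto intro!: restrict_ext simp: a_ac)
  qed
  moreover have "\<one>\<^bsub>R\<^esub> \<odot>\<^bsub>free_module R X\<^esub> f = f" if f: "f \<in> carrier (free_module R X)" for f
  proof -
    have "\<one>\<^bsub>R\<^esub> \<odot>\<^bsub>free_module R X\<^esub> f = (\<lambda>x\<in>X. f x)"
      using memD(1)[OF f] by (auto intro!: restrict_ext)
    then show ?thesis using ext[OF f] by simp
  qed
  ultimately show ?thesis
    using smult
    by (intro right_module.intro right_module_axioms.intro)
      (auto simp: assms memD(1) l_distr r_distr m_assoc intro!: restrict_ext)
qed

lemma basis_vector_in_free_module:
  assumes "ring R"
  shows "basis_vector R X x \<in> carrier (free_module R X)"
proof -
  interpret ring R by fact
  have "{y \<in> X. basis_vector R X x y \<noteq> \<zero>\<^bsub>R\<^esub>} \<subseteq> {x}" by (auto simp: basis_vector_def)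
  then have "finite {y \<in> X. basis_vector R X x y \<noteq> \<zero>\<^bsub>R\<^esub>}" by (rule finite_subset) simp
  moreover have "basis_vector R X x \<in> X \<rightarrow>\<^sub>E carrier R" by (auto simp: basis_vector_def)
  ultimately show ?thesis unfolding free_module_carrier by blast
qed

lemma
  assumes "f \<in> mod_hom R M N"
  shows mod_hom_closed: "x \<in> carrier M \<Longrightarrow> f x \<in> carrier N"
    and mod_hom_add: "\<lbrakk>x \<in> carrier M; y \<in> carrier M\<rbrakk> \<Longrightarrow> f (x \<oplus>\<^bsub>M\<^esub> y) = f x \<oplus>\<^bsub>N\<^esub> f y"
    and mod_hom_smult: "\<lbrakk>r \<in> carrier R; x \<in> carrier M\<rbrakk> \<Longrightarrow> f (r \<odot>\<^bsub>M\<^esub> x) = r \<odot>\<^bsub>N\<^esub> f x"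
  using assms by (auto simp: mod_hom_def hom_def)

lemma mod_homI:
  assumes "\<And>x. x \<in> carrier M \<Longrightarrow> f x \<in> carrier N"
    and "\<And>x y. \<lbrakk>x \<in> carrier M; y \<in> carrier M\<rbrakk> \<Longrightarrow> f (x \<oplus>\<^bsub>M\<^esub> y) = f x \<oplus>\<^bsub>N\<^esub> f y"
    and "\<And>r x. \<lbrakk>r \<in> carrier R; x \<in> carrier M\<rbrakk> \<Longrightarrow> f (r \<odot>\<^bsub>M\<^esub> x) = r \<odot>\<^bsub>N\<^esub> f x"
  shows "f \<in> mod_hom R M N"
  using assms by (auto simp: mod_hom_def hom_def)

lemma mod_hom_zero:
  assumes "sided_module R M" "sided_module R N" "f \<in> mod_hom R M N"
  shows "f \<zero>\<^bsub>M\<^esub> = \<zero>\<^bsub>N\<^esub>"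
proof -
  interpret M: sided_module R M by fact
  interpret N: sided_module R N by fact
  show ?thesis
    using mod_hom_smult[OF assms(3), of "\<zero>\<^bsub>R\<^esub>" "\<zero>\<^bsub>M\<^esub>"] mod_hom_closed[OF assms(3), of "\<zero>\<^bsub>M\<^esub>"]
    by (simp add: M.smult_l_zero N.smult_l_zero)
qed

lemma mod_hom_lincomb:
  assumes "sided_module R M" "sided_module R N" "f \<in> mod_hom R M N"
    and "set l \<subseteq> carrier R \<times> carrier M"
  shows "f (lincomb M l) = lincomb N (map (\<lambda>(r, x). (r, f x)) l)"
proof -
  interpret M: sided_module R M by fact
  show ?thesis using assms(4)
  proof (induction l)
    case (Cons p l)
    obtain r x where "p = (r, x)" by (cases p)
    with Cons show ?case
      by (simp add: mod_hom_add[OF assms(3)] mod_hom_smult[OF assms(3)] M.lincomb_closed M.smult_closed)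
  qed (simp add: mod_hom_zero[OF assms(1-3)])
qed

text \<open>Listing more basis vectors than the support of \<open>f\<close> does no harm; this allows one list to serve
  finitely many elements.\<close>

lemma free_module_expansion:
  assumes R: "ring R" and f: "f \<in> carrier (free_module R X)"
    and xs: "distinct xs" "{x \<in> X. f x \<noteq> \<zero>\<^bsub>R\<^esub>} \<subseteq> set xs" "set xs \<subseteq> X"
  shows "lincomb (free_module R X) (map (\<lambda>x. (f x, basis_vector R X x)) xs) = f"
    (is "lincomb ?F _ = _")
proof -
  interpret ring R by fact
  have fc: "f x \<in> carrier R" if "x \<in> X" for x using f that by (auto simp: free_module_carrier)
  have "lincomb ?F (map (\<lambda>x. (f x, basis_vector R X x)) ys) =
      (\<lambda>x\<in>X. if x \<in> set ys then f x else \<zero>\<^bsub>R\<^esub>)" if "distinct ys" "set ys \<subseteq> X" for ys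
    using that
  proof (induction ys)
    case (Cons y ys)
    then show ?case by (auto simp: basis_vector_def fc intro!: restrict_ext)
  qed simp
  also have "(\<lambda>x\<in>X. if x \<in> set xs then f x else \<zero>\<^bsub>R\<^esub>) = f"
    using f xs by (auto simp: free_module_carrier fun_eq_iff PiE_iff extensional_def)
  finally show ?thesis using xs by blast
qed

lemma direct_sum_projection:
  assumes F: "sided_module R F" and A: "submodule A R F" and B: "submodule B R F"
    and AB: "A \<inter> B = {\<zero>\<^bsub>F\<^esub>}" "A <+>\<^bsub>F\<^esub> B = carrier F"
  obtains p where "p \<in> mod_hom R F (F\<lparr>carrier := A\<rparr>)" "\<And>a. a \<in> A \<Longrightarrow> p a = a"
proof -
  interpret F: sided_module R F by fact
  note AF = subsetD[OF F.submodule_subset[OF A]] and BF = subsetD[OF F.submodule_subset[OF B]]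
  have unique: "a = a'" if "a \<in> A" "a' \<in> A" "b \<in> B" "b' \<in> B" "a \<oplus>\<^bsub>F\<^esub> b = a' \<oplus>\<^bsub>F\<^esub> b'" for a a' b b'
  proof -
    have "a \<oplus>\<^bsub>F\<^esub> \<ominus>\<^bsub>F\<^esub> a' = b' \<oplus>\<^bsub>F\<^esub> \<ominus>\<^bsub>F\<^esub> b"
    proof -
      have "a \<oplus>\<^bsub>F\<^esub> \<ominus>\<^bsub>F\<^esub> a' = (a \<oplus>\<^bsub>F\<^esub> b) \<oplus>\<^bsub>F\<^esub> (\<ominus>\<^bsub>F\<^esub> a' \<oplus>\<^bsub>F\<^esub> \<ominus>\<^bsub>F\<^esub> b)"
        using that(1-4) AF BF by (simp add: F.M.a_ac F.M.r_neg F.M.r_neg1 F.M.r_neg2)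
      also have "\<dots> = (a' \<oplus>\<^bsub>F\<^esub> \<ominus>\<^bsub>F\<^esub> a') \<oplus>\<^bsub>F\<^esub> (b' \<oplus>\<^bsub>F\<^esub> \<ominus>\<^bsub>F\<^esub> b)"
        unfolding that(5) using that(1-4) AF BF by (simp add: F.M.a_ac)
      also have "\<dots> = b' \<oplus>\<^bsub>F\<^esub> \<ominus>\<^bsub>F\<^esub> b"
        using that(1-4) AF BF by (simp add: F.M.r_neg)
      finally show ?thesis .
    qed
    moreover have "a \<oplus>\<^bsub>F\<^esub> \<ominus>\<^bsub>F\<^esub> a' \<in> A" "b' \<oplus>\<^bsub>F\<^esub> \<ominus>\<^bsub>F\<^esub> b \<in> B"
      using that(1-4) F.submodule_add F.submodule_minus A B by blast+
    ultimately have "a \<oplus>\<^bsub>F\<^esub> \<ominus>\<^bsub>F\<^esub> a' = \<zero>\<^bsub>F\<^esub>" using AB(1) by auto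
    then show ?thesis
      using that(1,2) AF by (metis F.M.minus_equality F.M.minus_minus F.M.a_inv_closed)
  qed
  have "\<exists>a\<in>A. \<exists>b\<in>B. f = a \<oplus>\<^bsub>F\<^esub> b" if "f \<in> carrier F" for f
  proof -
    have "f \<in> A <+>\<^bsub>F\<^esub> B" using that AB(2) by simp
    then show ?thesis unfolding set_add_def set_mult_def by auto
  qed
  then obtain p q where p: "\<And>f. f \<in> carrier F \<Longrightarrow> p f \<in> A \<and> q f \<in> B \<and> f = p f \<oplus>\<^bsub>F\<^esub> q f"
    by metis
  note pA = p[THEN conjunct1] and qB = p[THEN conjunct2, THEN conjunct1]
    and pq = p[THEN conjunct2, THEN conjunct2]
  have pI: "p f = a" if "f = a \<oplus>\<^bsub>F\<^esub> b" "a \<in> A" "b \<in> B" for f a b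
    using unique[of "p f" a "q f" b] p[of f] that AF BF by auto
  show ?thesis
  proof (rule that[OF mod_homI])
    fix f assume f: "f \<in> carrier F"
    then show "p f \<in> carrier (F\<lparr>carrier := A\<rparr>)" using p by simp
    fix g assume g: "g \<in> carrier F"
    have "f \<oplus>\<^bsub>F\<^esub> g = (p f \<oplus>\<^bsub>F\<^esub> q f) \<oplus>\<^bsub>F\<^esub> (p g \<oplus>\<^bsub>F\<^esub> q g)" using pq[OF f] pq[OF g] by simp
    also have "\<dots> = (p f \<oplus>\<^bsub>F\<^esub> p g) \<oplus>\<^bsub>F\<^esub> (q f \<oplus>\<^bsub>F\<^esub> q g)"
      using AF[OF pA[OF f]] AF[OF pA[OF g]] BF[OF qB[OF f]] BF[OF qB[OF g]] by (simp add: F.M.a_ac)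
    finally show "p (f \<oplus>\<^bsub>F\<^esub> g) = p f \<oplus>\<^bsub>F\<lparr>carrier := A\<rparr>\<^esub> p g"
      using F.submodule_add[OF A pA[OF f] pA[OF g]] F.submodule_add[OF B qB[OF f] qB[OF g]]
      by (simp add: pI)
  next
    fix r f assume r: "r \<in> carrier R" and f: "f \<in> carrier F"
    have "r \<odot>\<^bsub>F\<^esub> f = r \<odot>\<^bsub>F\<^esub> (p f \<oplus>\<^bsub>F\<^esub> q f)" using pq[OF f] by simp
    also have "\<dots> = r \<odot>\<^bsub>F\<^esub> p f \<oplus>\<^bsub>F\<^esub> r \<odot>\<^bsub>F\<^esub> q f"
      using AF[OF pA[OF f]] BF[OF qB[OF f]] r by (simp add: F.smult_r_distr)
    finally show "p (r \<odot>\<^bsub>F\<^esub> f) = r \<odot>\<^bsub>F\<lparr>carrier := A\<rparr>\<^esub> p f"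
      using F.submodule_smult[OF A r pA[OF f]] F.submodule_smult[OF B r qB[OF f]] by (simp add: pI)
  next
    fix a assume "a \<in> A"
    then show "p a = a" using F.submodule_zero[OF B] AF by (intro pI[of _ _ "\<zero>\<^bsub>F\<^esub>"]) auto
  qed
qed

text \<open>Finite part of a dual basis.  Embed \<open>P\<close> as a direct summand of a free module: the coordinates
  there are forms, the vectors are the projections of the basis vectors to \<open>P\<close>, and only the
  basis vectors in the supports of the finitely many elements matter.\<close>

lemma projective_imp_coordinates:
  assumes P: "right_module R P" and "projective_module R P" and X: "finite X" "X \<subseteq> carrier P"
  obtains ps where "\<And>y \<psi>. (y, \<psi>) \<in> set ps \<Longrightarrow> y \<in> carrier P \<and> linear_form R P (carrier P) \<psi>"
    "\<And>x. x \<in> X \<Longrightarrow> coord_sum P ps x = x"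
proof -
  from assms(2) obtain E :: "'b set" and A B h where
    A: "submodule A R (free_module R E)" and B: "submodule B R (free_module R E)"
    and AB: "A \<inter> B = {\<zero>\<^bsub>free_module R E\<^esub>}" "A <+>\<^bsub>free_module R E\<^esub> B = carrier (free_module R E)"
    and h: "h \<in> mod_hom R P ((free_module R E)\<lparr>carrier := A\<rparr>)" and bij: "bij_betw h (carrier P) A"
    unfolding projective_module_def by blast
  interpret right_mod R P using P by (rule right_mod.intro)
  let ?F = "free_module R E"
  note RF = right_module_free_module[OF R.ring_axioms, of E]
  interpret F: sided_module R ?F by (rule right_module_sided[OF RF])
  interpret FA: sided_module R "?F\<lparr>carrier := A\<rparr>"
    by (rule right_module_sided[OF submodule_as_right_module[OF RF A]])
  obtain p where p: "p \<in> mod_hom R ?F (?F\<lparr>carrier := A\<rparr>)" "\<And>a. a \<in> A \<Longrightarrow> p a = a"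
    using direct_sum_projection[OF F.sided_module_axioms A B AB] by metis
  define k where "k = inv_into (carrier P) h"
  have kh: "k (h x) = x" if "x \<in> carrier P" for x
    using bij that by (simp add: k_def bij_betw_def)
  have hk: "k a \<in> carrier P" "h (k a) = a" if "a \<in> A" for a
    using bij that by (auto simp: k_def bij_betw_def inv_into_into f_inv_into_f)
  have hA: "h x \<in> A" if "x \<in> carrier P" for x using mod_hom_closed[OF h] that by simp
  have k: "k \<in> mod_hom R (?F\<lparr>carrier := A\<rparr>) P"
  proof (rule mod_homI)
    fix a b assume "a \<in> carrier (?F\<lparr>carrier := A\<rparr>)" "b \<in> carrier (?F\<lparr>carrier := A\<rparr>)"
    then show "k (a \<oplus>\<^bsub>?F\<lparr>carrier := A\<rparr>\<^esub> b) = k a \<oplus>\<^bsub>P\<^esub> k b"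
      using kh[of "k a \<oplus>\<^bsub>P\<^esub> k b"] hk by (simp add: mod_hom_add[OF h] del: free_module_simps)
  next
    fix r a assume "r \<in> carrier R" "a \<in> carrier (?F\<lparr>carrier := A\<rparr>)"
    then show "k (r \<odot>\<^bsub>?F\<lparr>carrier := A\<rparr>\<^esub> a) = r \<odot>\<^bsub>P\<^esub> k a"
      using kh[of "r \<odot>\<^bsub>P\<^esub> k a"] hk
      by (simp add: mod_hom_smult[OF h] smult_closed del: free_module_simps)
  qed (use hk in simp)
  have hF: "h x \<in> carrier ?F" if "x \<in> carrier P" for x
    using F.submodule_subset[OF A] hA that by blast
  have fin: "finite (\<Union>x\<in>X. {e \<in> E. h x e \<noteq> \<zero>\<^bsub>R\<^esub>})"
    using X hF by (auto simp: free_module_carrier)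
  obtain es where es: "distinct es" "set es = (\<Union>x\<in>X. {e \<in> E. h x e \<noteq> \<zero>\<^bsub>R\<^esub>})"
    using finite_distinct_list[OF fin] by blast
  define ps where "ps = map (\<lambda>e. (k (p (basis_vector R E e)), \<lambda>x. h x e)) es"
  show ?thesis
  proof (rule that)
    fix y \<psi> assume "(y, \<psi>) \<in> set ps"
    then obtain e where e: "e \<in> E" "y = k (p (basis_vector R E e))" "\<psi> = (\<lambda>x. h x e)"
      unfolding ps_def using es(2) by auto
    have "y \<in> carrier P"
      unfolding e using mod_hom_closed[OF p(1) basis_vector_in_free_module[OF R.ring_axioms]] hk(1) by simp
    moreover have "linear_form R P (carrier P) \<psi>"
      unfolding linear_form_def e using e(1) hF
      by (auto simp: mod_hom_add[OF h] mod_hom_smult[OF h] free_module_carrier)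
    ultimately show "y \<in> carrier P \<and> linear_form R P (carrier P) \<psi>" ..
  next
    fix x assume x: "x \<in> X"
    let ?l = "map (\<lambda>e. (h x e, basis_vector R E e)) es"
    have xP: "x \<in> carrier P" using x X by blast
    have hR: "h x e \<in> carrier R" if "e \<in> E" for e
      using hF[OF xP] that by (auto simp: free_module_carrier)
    have pA: "p (basis_vector R E e) \<in> A" for e
      using mod_hom_closed[OF p(1) basis_vector_in_free_module[OF R.ring_axioms]] by simp
    from hR have l: "set ?l \<subseteq> carrier R \<times> carrier ?F"
      using basis_vector_in_free_module[OF R.ring_axioms] es(2) by auto
    have l': "set (map (\<lambda>(r, x). (r, p x)) ?l) \<subseteq> carrier R \<times> carrier (?F\<lparr>carrier := A\<rparr>)"
      using hR pA es(2) by auto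
    have "h x = lincomb ?F ?l"
      by (rule free_module_expansion[OF R.ring_axioms hF[OF xP] es(1), symmetric]) (use es(2) x in auto)
    then have "x = k (p (lincomb ?F ?l))" using kh[OF xP] p(2)[OF hA[OF xP]] by simp
    also have "\<dots> = k (lincomb (?F\<lparr>carrier := A\<rparr>) (map (\<lambda>(r, x). (r, p x)) ?l))"
      using mod_hom_lincomb[OF F.sided_module_axioms FA.sided_module_axioms p(1) l] by simp
    also have "\<dots> = lincomb P (map (\<lambda>(r, x). (r, k x)) (map (\<lambda>(r, x). (r, p x)) ?l))"
      by (rule mod_hom_lincomb[OF FA.sided_module_axioms sided_module_axioms k l'])
    also have "\<dots> = coord_sum P ps x"
      by (simp add: coord_sum_def ps_def comp_def)
    finally show "coord_sum P ps x = x" by simp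
  qed
qed

section \<open>Countably generated modules with finite coordinates\<close>

lemma free_module_universal:
  fixes R :: "'r ring" and N :: "('r, 'n) module"
  assumes N: "right_module R N" and b: "\<And>x. x \<in> X \<Longrightarrow> b x \<in> carrier N"
  obtains \<pi> where "\<pi> \<in> mod_hom R (free_module R X) N"
    "\<And>x. x \<in> X \<Longrightarrow> \<pi> (basis_vector R X x) = b x"
proof -
  interpret right_mod R N using N by (rule right_mod.intro)
  let ?F = "free_module R X"
  interpret F: sided_module R ?F
    by (rule right_module_sided[OF right_module_free_module[OF R.ring_axioms]])
  define \<pi> where "\<pi> f = finsum N (\<lambda>x. f x \<odot>\<^bsub>N\<^esub> b x) {x \<in> X. f x \<noteq> \<zero>\<^bsub>R\<^esub>}" for f
  have fc: "f x \<in> carrier R" if "f \<in> carrier ?F" "x \<in> X" for f x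
    using that by (auto simp: free_module_carrier)
  have ffin: "finite {x \<in> X. f x \<noteq> \<zero>\<^bsub>R\<^esub>}" if "f \<in> carrier ?F" for f
    using that by (auto simp: free_module_carrier)
  have larger: "\<pi> f = finsum N (\<lambda>x. f x \<odot>\<^bsub>N\<^esub> b x) S"
    if f: "f \<in> carrier ?F" and S: "finite S" "S \<subseteq> X" "{x \<in> X. f x \<noteq> \<zero>\<^bsub>R\<^esub>} \<subseteq> S" for f S
    unfolding \<pi>_def
    by (rule M.add.finprod_mono_neutral_cong_left[OF S(1,3)])
      (use S fc[OF f] b smult_l_zero smult_closed in auto)
  have "\<pi> \<in> mod_hom R ?F N"
  proof (rule mod_homI)
    fix f assume f: "f \<in> carrier ?F"
    then show "\<pi> f \<in> carrier N"
      unfolding \<pi>_def by (intro M.finsum_closed) (auto simp: fc b smult_closed)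
    fix g assume g: "g \<in> carrier ?F"
    let ?S = "{x \<in> X. f x \<noteq> \<zero>\<^bsub>R\<^esub>} \<union> {x \<in> X. g x \<noteq> \<zero>\<^bsub>R\<^esub>}"
    have S: "finite ?S" "?S \<subseteq> X" using ffin f g by auto
    have fg: "f \<oplus>\<^bsub>?F\<^esub> g \<in> carrier ?F" using f g by (rule F.M.add.m_closed)
    have "\<pi> (f \<oplus>\<^bsub>?F\<^esub> g) = finsum N (\<lambda>x. (f \<oplus>\<^bsub>?F\<^esub> g) x \<odot>\<^bsub>N\<^esub> b x) ?S"
      by (rule larger[OF fg S]) (use fc[OF f] fc[OF g] in auto)
    also have "\<dots> = finsum N (\<lambda>x. f x \<odot>\<^bsub>N\<^esub> b x \<oplus>\<^bsub>N\<^esub> g x \<odot>\<^bsub>N\<^esub> b x) ?S"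
      by (rule M.finsum_cong') (use fc[OF f] fc[OF g] b in \<open>auto simp: smult_l_distr smult_closed\<close>)
    also have "\<dots> = finsum N (\<lambda>x. f x \<odot>\<^bsub>N\<^esub> b x) ?S \<oplus>\<^bsub>N\<^esub> finsum N (\<lambda>x. g x \<odot>\<^bsub>N\<^esub> b x) ?S"
      by (rule M.finsum_addf) (use fc[OF f] fc[OF g] b in \<open>auto simp: smult_closed\<close>)
    also have "\<dots> = \<pi> f \<oplus>\<^bsub>N\<^esub> \<pi> g"
      using larger[OF f S] larger[OF g S] by simp
    finally show "\<pi> (f \<oplus>\<^bsub>?F\<^esub> g) = \<pi> f \<oplus>\<^bsub>N\<^esub> \<pi> g" .
  next
    fix r f assume r: "r \<in> carrier R" and f: "f \<in> carrier ?F"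
    let ?S = "{x \<in> X. f x \<noteq> \<zero>\<^bsub>R\<^esub>}"
    have "\<pi> (r \<odot>\<^bsub>?F\<^esub> f) = finsum N (\<lambda>x. (r \<odot>\<^bsub>?F\<^esub> f) x \<odot>\<^bsub>N\<^esub> b x) ?S"
      by (rule larger[OF F.smult_closed[OF r f] ffin[OF f]]) (use r in auto)
    also have "\<dots> = finsum N (\<lambda>x. r \<odot>\<^bsub>N\<^esub> (f x \<odot>\<^bsub>N\<^esub> b x)) ?S"
      by (rule M.finsum_cong') (use fc[OF f] b r in \<open>auto simp: smult_assoc smult_closed\<close>)
    also have "\<dots> = r \<odot>\<^bsub>N\<^esub> finsum N (\<lambda>x. f x \<odot>\<^bsub>N\<^esub> b x) S" if "S = ?S" for S
    proof -
      have "finite S" "S \<subseteq> X" using that ffin[OF f] by auto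
      then have "finsum N (\<lambda>x. r \<odot>\<^bsub>N\<^esub> (f x \<odot>\<^bsub>N\<^esub> b x)) S = r \<odot>\<^bsub>N\<^esub> finsum N (\<lambda>x. f x \<odot>\<^bsub>N\<^esub> b x) S"
      proof (induction S rule: finite_induct)
        case (insert x S)
        then have "(\<lambda>x. f x \<odot>\<^bsub>N\<^esub> b x) \<in> S \<rightarrow> carrier N" "f x \<odot>\<^bsub>N\<^esub> b x \<in> carrier N"
          using fc[OF f] b by (auto simp: smult_closed)
        with insert show ?case using r
          by (simp add: smult_r_distr smult_closed M.finsum_closed Pi_def)
      qed (simp add: smult_r_zero r)
      then show ?thesis using that by simp
    qed
    finally show "\<pi> (r \<odot>\<^bsub>?F\<^esub> f) = r \<odot>\<^bsub>N\<^esub> \<pi> f" by (simp add: \<pi>_def)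
  qed
  moreover have "\<pi> (basis_vector R X x) = b x" if x: "x \<in> X" for x
  proof -
    have "\<pi> (basis_vector R X x) = finsum N (\<lambda>y. basis_vector R X x y \<odot>\<^bsub>N\<^esub> b y) {x}"
      by (rule larger[OF basis_vector_in_free_module[OF R.ring_axioms]]) (use x in \<open>auto simp: basis_vector_def\<close>)
    also have "\<dots> = b x"
      using x b[OF x] by (simp add: basis_vector_def smult_one)
    finally show ?thesis .
  qed
  ultimately show ?thesis by (rule that)
qed

lemma retract_of_free_imp_projective:
  fixes R :: "'r ring" and N :: "('r, 'n) module" and X :: "'n set"
  assumes N: "right_module R N"
    and s: "s \<in> mod_hom R N (free_module R X)" and \<pi>: "\<pi> \<in> mod_hom R (free_module R X) N"
    and id: "\<And>x. x \<in> carrier N \<Longrightarrow> \<pi> (s x) = x"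
  shows "projective_module R N"
proof -
  interpret right_mod R N using N by (rule right_mod.intro)
  let ?F = "free_module R X"
  note RF = right_module_free_module[OF R.ring_axioms, of X]
  interpret F: sided_module R ?F by (rule right_module_sided[OF RF])
  let ?A = "s ` carrier N" and ?B = "{f \<in> carrier ?F. \<pi> f = \<zero>\<^bsub>N\<^esub>}"
  note sz = mod_hom_zero[OF sided_module_axioms F.sided_module_axioms s]
    and pz = mod_hom_zero[OF F.sided_module_axioms sided_module_axioms \<pi>]
  have sF: "s x \<in> carrier ?F" if "x \<in> carrier N" for x using mod_hom_closed[OF s that] .
  have pN: "\<pi> f \<in> carrier N" if "f \<in> carrier ?F" for f using mod_hom_closed[OF \<pi> that] .
  have A: "submodule ?A R ?F"
  proof (rule F.submoduleI)
    show "\<zero>\<^bsub>?F\<^esub> \<in> ?A" using sz by (metis M.zero_closed image_eqI)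
    show "f \<oplus>\<^bsub>?F\<^esub> g \<in> ?A" if "f \<in> ?A" "g \<in> ?A" for f g
      using that mod_hom_add[OF s] by (metis (no_types, lifting) M.add.m_closed image_iff)
    show "r \<odot>\<^bsub>?F\<^esub> f \<in> ?A" if "r \<in> carrier R" "f \<in> ?A" for r f
      using that mod_hom_smult[OF s] by (metis (no_types, lifting) smult_closed image_iff)
  qed (use sF in auto)
  have B: "submodule ?B R ?F"
    by (rule F.submoduleI)
      (auto simp: pz mod_hom_add[OF \<pi>] mod_hom_smult[OF \<pi>] smult_r_zero F.smult_closed
        simp del: free_module_simps)
  have "?A \<inter> ?B = {\<zero>\<^bsub>?F\<^esub>}"
  proof
    show "?A \<inter> ?B \<subseteq> {\<zero>\<^bsub>?F\<^esub>}" using id sz by auto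
    show "{\<zero>\<^bsub>?F\<^esub>} \<subseteq> ?A \<inter> ?B" using F.submodule_zero[OF A] F.submodule_zero[OF B] by simp
  qed
  moreover have "?A <+>\<^bsub>?F\<^esub> ?B = carrier ?F"
  proof
    show "?A <+>\<^bsub>?F\<^esub> ?B \<subseteq> carrier ?F"
      unfolding set_add_def set_mult_def using sF F.M.add.m_closed by auto
    show "carrier ?F \<subseteq> ?A <+>\<^bsub>?F\<^esub> ?B"
    proof
      fix f assume f: "f \<in> carrier ?F"
      let ?b = "\<ominus>\<^bsub>?F\<^esub> s (\<pi> f) \<oplus>\<^bsub>?F\<^esub> f"
      have sp: "s (\<pi> f) \<in> carrier ?F" using sF pN f by blast
      have neg: "\<ominus>\<^bsub>?F\<^esub> s (\<pi> f) = (\<ominus>\<^bsub>R\<^esub> \<one>\<^bsub>R\<^esub>) \<odot>\<^bsub>?F\<^esub> s (\<pi> f)"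
        using F.smult_minus_one[OF sp] by simp
      have "\<pi> (\<ominus>\<^bsub>?F\<^esub> s (\<pi> f)) = \<ominus>\<^bsub>N\<^esub> \<pi> f"
        unfolding neg using mod_hom_smult[OF \<pi> _ sp] id[OF pN[OF f]] smult_minus_one[OF pN[OF f]]
        by (simp del: free_module_simps)
      then have "\<pi> ?b = \<zero>\<^bsub>N\<^esub>"
        using mod_hom_add[OF \<pi> F.M.a_inv_closed[OF sp] f] pN[OF f] by (simp add: M.l_neg)
      moreover have "?b \<in> carrier ?F" using sp f by (intro F.M.add.m_closed F.M.a_inv_closed)
      moreover have "f = s (\<pi> f) \<oplus>\<^bsub>?F\<^esub> ?b" using sp f F.M.r_neg2 by metis
      ultimately show "f \<in> ?A <+>\<^bsub>?F\<^esub> ?B"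
        unfolding set_add_def set_mult_def using pN[OF f] by (auto simp del: free_module_simps)
    qed
  qed
  moreover have "s \<in> mod_hom R N (?F\<lparr>carrier := ?A\<rparr>)"
    by (rule mod_homI) (auto simp: mod_hom_add[OF s] mod_hom_smult[OF s])
  moreover have "bij_betw s (carrier N) ?A"
    unfolding bij_betw_def by (auto intro: inj_on_inverseI[of _ \<pi>] id)
  ultimately show ?thesis unfolding projective_module_def
    using A B by blast
qed

lemma mod_hom_plus:
  assumes "sided_module R N" "f \<in> mod_hom R M N" "g \<in> mod_hom R M N"
  shows "(\<lambda>x. f x \<oplus>\<^bsub>N\<^esub> g x) \<in> mod_hom R M N"
proof -
  interpret N: sided_module R N by fact
  show ?thesis
    using mod_hom_closed[OF assms(2)] mod_hom_closed[OF assms(3)]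
    by (intro mod_homI) (auto simp: mod_hom_add[OF assms(2)] mod_hom_add[OF assms(3)]
      mod_hom_smult[OF assms(2)] mod_hom_smult[OF assms(3)] N.M.a_ac N.smult_r_distr)
qed

lemma mod_hom_minus:
  assumes "sided_module R N" "f \<in> mod_hom R M N"
  shows "(\<lambda>x. \<ominus>\<^bsub>N\<^esub> f x) \<in> mod_hom R M N"
proof -
  interpret N: sided_module R N by fact
  show ?thesis
    using mod_hom_closed[OF assms(2)]
    by (intro mod_homI) (auto simp: mod_hom_add[OF assms(2)] mod_hom_smult[OF assms(2)]
      N.M.minus_add N.smult_r_minus)
qed

lemma mod_hom_comp:
  "\<lbrakk>f \<in> mod_hom R M N; g \<in> mod_hom R N P\<rbrakk> \<Longrightarrow> (\<lambda>x. g (f x)) \<in> mod_hom R M P"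
  by (auto simp: mod_hom_def hom_def Pi_iff)

lemma mod_hom_id: "(\<lambda>x. x) \<in> mod_hom R M M"
  by (auto simp: mod_hom_def hom_def)

lemma mod_hom_agree_submodule:
  assumes "sided_module R M" "sided_module R N" "f \<in> mod_hom R M N" "g \<in> mod_hom R M N"
  shows "submodule {x \<in> carrier M. f x = g x} R M"
proof -
  interpret M: sided_module R M by fact
  show ?thesis
    by (rule M.submoduleI)
      (auto simp: mod_hom_add[OF assms(3)] mod_hom_add[OF assms(4)] M.smult_closed
      mod_hom_smult[OF assms(3)] mod_hom_smult[OF assms(4)]
      mod_hom_zero[OF assms(1,2,3)] mod_hom_zero[OF assms(1,2,4)])
qed

text \<open>If \<open>\<pi>\<close> splits over every finite subset, it splits over a countably generated \<open>N\<close>.  A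
  section \<open>s\<close> on the first generators is corrected without changing it where it already is a section:
  choose \<open>\<sigma>\<close> that is a section on the finitely many errors \<open>d x = x - \<pi> (s x)\<close> of the next
  generators and replace \<open>s\<close> by \<open>s + \<sigma> \<circ> d\<close>.  The corrected sections are eventually constant at each
  element, and their limit is a section.\<close>

lemma countably_generated_splitting:
  fixes R :: "'r ring" and N :: "('r, 'n) module" and F :: "('r, 'f) module"
  assumes N: "sided_module R N" and F: "sided_module R F" and \<pi>: "\<pi> \<in> mod_hom R F N"
    and e: "range (e :: nat \<Rightarrow> 'n) \<subseteq> carrier N" "lspan R N (range e) = carrier N"
    and local: "\<And>U. \<lbrakk>finite U; U \<subseteq> carrier N\<rbrakk> \<Longrightarrow> \<exists>\<sigma>\<in>mod_hom R N F. \<forall>u\<in>U. \<pi> (\<sigma> u) = u"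
  obtains s where "s \<in> mod_hom R N F" "\<And>x. x \<in> carrier N \<Longrightarrow> \<pi> (s x) = x"
proof -
  interpret N: sided_module R N by fact
  interpret F: sided_module R F by fact
  let ?P = "\<lambda>n s. s \<in> mod_hom R N F \<and> (\<forall>j<n. \<pi> (s (e j)) = e j)"
  let ?Q = "\<lambda>s s'. \<forall>x\<in>carrier N. \<pi> (s x) = x \<longrightarrow> s' x = s x"
  have "\<exists>s. \<forall>n. ?P n (s n) \<and> ?Q (s n) (s (Suc n))"
  proof (rule dependent_nat_choice)
    show "\<exists>s. ?P 0 s" using local[of "{}"] by auto
    fix s n assume s: "?P n s"
    then have sh: "s \<in> mod_hom R N F" by simp
    define d where "d = (\<lambda>x. x \<oplus>\<^bsub>N\<^esub> \<ominus>\<^bsub>N\<^esub> \<pi> (s x))"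
    have d: "d \<in> mod_hom R N N"
      unfolding d_def by (intro mod_hom_plus mod_hom_minus mod_hom_id mod_hom_comp[OF sh \<pi>] N)
    have "(\<lambda>j. d (e j)) ` {..n} \<subseteq> carrier N"
    proof -
      have "e j \<in> carrier N" for j using e(1) by auto
      then show ?thesis using mod_hom_closed[OF d] by auto
    qed
    then obtain \<sigma> where \<sigma>: "\<sigma> \<in> mod_hom R N F" "\<And>j. j \<le> n \<Longrightarrow> \<pi> (\<sigma> (d (e j))) = d (e j)"
      using local[of "(\<lambda>j. d (e j)) ` {..n}"] by auto
    define s' where "s' = (\<lambda>x. s x \<oplus>\<^bsub>F\<^esub> \<sigma> (d x))"
    have "s' \<in> mod_hom R N F"
      unfolding s'_def by (intro mod_hom_plus mod_hom_comp[OF d] F sh \<sigma>(1))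
    moreover have "\<pi> (s' (e j)) = e j" if "j < Suc n" for j
    proof -
      have ej: "e j \<in> carrier N" using e(1) by auto
      then have p: "\<pi> (s (e j)) \<in> carrier N" using mod_hom_closed[OF \<pi>] mod_hom_closed[OF sh] by blast
      have "\<pi> (s' (e j)) = \<pi> (s (e j)) \<oplus>\<^bsub>N\<^esub> d (e j)"
        using that \<sigma>(2)[of j] ej
        by (simp add: s'_def mod_hom_add[OF \<pi>] mod_hom_closed[OF sh] mod_hom_closed[OF \<sigma>(1)]
            mod_hom_closed[OF d])
      also have "\<dots> = e j" using ej p by (simp add: d_def N.M.a_ac N.M.r_neg1 N.M.r_neg2 N.M.r_neg)
      finally show ?thesis .
    qed
    moreover have "s' x = s x" if x: "x \<in> carrier N" "\<pi> (s x) = x" for x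
    proof -
      have "d x = \<zero>\<^bsub>N\<^esub>" using x by (simp add: d_def N.M.r_neg)
      then show ?thesis
        using mod_hom_zero[OF N F \<sigma>(1)] mod_hom_closed[OF sh x(1)] by (simp add: s'_def)
    qed
    ultimately show "\<exists>s'. ?P (Suc n) s' \<and> ?Q s s'" by blast
  qed
  then obtain s where sh: "\<And>n. s n \<in> mod_hom R N F" and se: "\<And>n j. j < n \<Longrightarrow> \<pi> (s n (e j)) = e j"
    and step: "\<And>n x. \<lbrakk>x \<in> carrier N; \<pi> (s n x) = x\<rbrakk> \<Longrightarrow> s (Suc n) x = s n x" by blast
  have "\<exists>m. \<forall>n\<ge>m. \<pi> (s n x) = x" if x: "x \<in> carrier N" for x
  proof -
    obtain X where X: "finite X" "X \<subseteq> range e" "x \<in> lspan R N X"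
      using N.lspan_finite_support[of "{x}" "range e"] x e(2) by auto
    then obtain J where J: "finite J" "X = e ` J" by (meson finite_subset_image)
    show ?thesis
    proof (intro exI allI impI)
      fix n assume n: "Suc (Max (insert 0 J)) \<le> n"
      have "lspan R N X \<subseteq> {x \<in> carrier N. \<pi> (s n x) = x}"
      proof (rule N.lspan_minimal)
        show "submodule {x \<in> carrier N. \<pi> (s n x) = x} R N"
          by (rule mod_hom_agree_submodule[OF N N mod_hom_comp[OF sh \<pi>] mod_hom_id])
        have "j < n" if "j \<in> J" for j
        proof -
          have "j \<le> Max (insert 0 J)" using that J(1) by (intro Max_ge) auto
          with n show ?thesis by linarith
        qed
        then show "X \<subseteq> {x \<in> carrier N. \<pi> (s n x) = x}" using J e(1) se by auto
      qed
      then show "\<pi> (s n x) = x" using X by auto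
    qed
  qed
  then obtain m where m: "\<And>x n. \<lbrakk>x \<in> carrier N; n \<ge> m x\<rbrakk> \<Longrightarrow> \<pi> (s n x) = x" by metis
  have const: "s n x = s (m x) x" if "x \<in> carrier N" "n \<ge> m x" for n x
    using that(2) by (induction n rule: dec_induct) (use that(1) step m in auto)
  define t where "t = (\<lambda>x. s (m x) x)"
  have t: "s n x = t x" if "x \<in> carrier N" "n \<ge> m x" for n x
    using const[OF that] by (simp add: t_def)
  show ?thesis
  proof (rule that[OF mod_homI])
    fix x assume x: "x \<in> carrier N"
    show "t x \<in> carrier F" using mod_hom_closed[OF sh x] by (simp add: t_def)
    show "\<pi> (t x) = x" using m[OF x] by (simp add: t_def)
  next
    fix x y assume xy: "x \<in> carrier N" "y \<in> carrier N"
    let ?n = "max (m (x \<oplus>\<^bsub>N\<^esub> y)) (max (m x) (m y))"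
    show "t (x \<oplus>\<^bsub>N\<^esub> y) = t x \<oplus>\<^bsub>F\<^esub> t y"
      using mod_hom_add[OF sh[of ?n] xy] xy t[of "x \<oplus>\<^bsub>N\<^esub> y" ?n] t[of x ?n] t[of y ?n] by simp
  next
    fix r x assume rx: "r \<in> carrier R" "x \<in> carrier N"
    let ?n = "max (m (r \<odot>\<^bsub>N\<^esub> x)) (m x)"
    show "t (r \<odot>\<^bsub>N\<^esub> x) = r \<odot>\<^bsub>F\<^esub> t x"
      using mod_hom_smult[OF sh[of ?n] rx] rx t[of "r \<odot>\<^bsub>N\<^esub> x" ?n] t[of x ?n] N.smult_closed[OF rx] by simp
  qed
qed

text \<open>Coordinates on a finite set \<open>U\<close> by forms on \<open>N\<close> are a section over \<open>U\<close> of the canonical map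
  from the free module with basis \<open>N\<close>.\<close>

lemma coordinates_imp_projective:
  fixes R :: "'r ring" and N :: "('r, 'n) module"
  assumes N: "right_module R N" and S: "countable S" "S \<subseteq> carrier N" "lspan R N S = carrier N"
    and coords: "\<And>U. \<lbrakk>finite U; U \<subseteq> carrier N\<rbrakk> \<Longrightarrow>
      \<exists>ps. (\<forall>y \<psi>. (y, \<psi>) \<in> set ps \<longrightarrow> y \<in> carrier N \<and> linear_form R N (carrier N) \<psi>) \<and>
        (\<forall>u\<in>U. coord_sum N ps u = u)"
  shows "projective_module R N"
proof -
  interpret right_mod R N using N by (rule right_mod.intro)
  let ?F = "free_module R (carrier N)" and ?b = "basis_vector R (carrier N)"
  note RF = right_module_free_module[OF R.ring_axioms, of "carrier N"]
  interpret F: right_mod R ?F using RF by (rule right_mod.intro)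
  obtain \<pi> where \<pi>: "\<pi> \<in> mod_hom R ?F N" "\<And>x. x \<in> carrier N \<Longrightarrow> \<pi> (?b x) = x"
    using free_module_universal[OF N, of "carrier N" "\<lambda>x. x"] by auto
  have zero: "\<zero>\<^bsub>N\<^esub> \<in> carrier N" by simp
  obtain e :: "nat \<Rightarrow> 'n" where e: "range e = insert \<zero>\<^bsub>N\<^esub> S"
    using uncountable_def[of "insert \<zero>\<^bsub>N\<^esub> S"] S(1) by auto
  have "lspan R N (range e) = carrier N"
    using lspan_mono[of S "range e"] lspan_closed[of "range e"] e S(2,3) by auto
  moreover have "range e \<subseteq> carrier N" using e S(2) by auto
  moreover have "\<exists>\<sigma>\<in>mod_hom R N ?F. \<forall>u\<in>U. \<pi> (\<sigma> u) = u" if U: "finite U" "U \<subseteq> carrier N" for U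
  proof -
    from coords[OF U] obtain ps where
      ps: "\<And>y \<psi>. (y, \<psi>) \<in> set ps \<Longrightarrow> y \<in> carrier N \<and> linear_form R N (carrier N) \<psi>"
      "\<And>u. u \<in> U \<Longrightarrow> coord_sum N ps u = u" by blast
    define \<sigma> where "\<sigma> x = lincomb ?F (map (\<lambda>(y, \<psi>). (\<psi> x, ?b y)) ps)" for x
    have hom: "(\<lambda>x. lincomb ?F (map (\<lambda>(y, \<psi>). (\<psi> x, ?b y)) qs)) \<in> mod_hom R N ?F"
      if "\<And>y \<psi>. (y, \<psi>) \<in> set qs \<Longrightarrow> linear_form R N (carrier N) \<psi>" for qs
      using that
    proof (induction qs)
      case Nil
      show ?case by (rule mod_homI) (auto simp: F.smult_r_zero simp del: free_module_simps)
    next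
      case (Cons q qs)
      obtain y \<psi> where q: "q = (y, \<psi>)" by (cases q)
      have \<psi>: "linear_form R N (carrier N) \<psi>" using Cons.prems q by auto
      have "(\<lambda>x. \<psi> x \<odot>\<^bsub>?F\<^esub> ?b y) \<in> mod_hom R N ?F"
        using basis_vector_in_free_module[OF R.ring_axioms, of "carrier N" y]
        by (intro mod_homI) (auto simp: linear_form_closed[OF \<psi>] linear_form_add[OF \<psi>]
            linear_form_smult[OF \<psi>] F.smult_closed F.smult_l_distr F.smult_assoc simp del: free_module_simps)
      moreover have "(\<lambda>x. lincomb ?F (map (\<lambda>(y, \<psi>). (\<psi> x, ?b y)) qs)) \<in> mod_hom R N ?F"
        by (rule Cons.IH) (use Cons.prems in auto)
      ultimately show ?case
        using mod_hom_plus[OF F.sided_module_axioms] q by (simp del: free_module_simps)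
    qed
    have "\<sigma> \<in> mod_hom R N ?F" unfolding \<sigma>_def using ps(1) by (intro hom) auto
    moreover have "\<pi> (\<sigma> u) = u" if u: "u \<in> U" for u
    proof -
      have "\<pi> (\<sigma> u) = lincomb N (map (\<lambda>(r, x). (r, \<pi> x)) (map (\<lambda>(y, \<psi>). (\<psi> u, ?b y)) ps))"
        unfolding \<sigma>_def using ps(1) U u basis_vector_in_free_module[OF R.ring_axioms]
        by (intro mod_hom_lincomb[OF F.sided_module_axioms sided_module_axioms \<pi>(1)])
          (auto dest: linear_form_closed)
      also have "map (\<lambda>(r, x). (r, \<pi> x)) (map (\<lambda>(y, \<psi>). (\<psi> u, ?b y)) ps) = map (\<lambda>(y, \<psi>). (\<psi> u, y)) ps"
        using ps(1) \<pi>(2) by auto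
      also have "lincomb N \<dots> = u" using ps(2)[OF u] by (simp add: coord_sum_def)
      finally show ?thesis .
    qed
    ultimately show ?thesis by blast
  qed
  ultimately obtain s where "s \<in> mod_hom R N ?F" "\<And>x. x \<in> carrier N \<Longrightarrow> \<pi> (s x) = x"
    using countably_generated_splitting[OF sided_module_axioms F.sided_module_axioms \<pi>(1)] by metis
  then show ?thesis using retract_of_free_imp_projective[OF N _ \<pi>(1)] by blast
qed

section \<open>Stable rows\<close>

text \<open>Only the values of a row on \<open>X\<close> matter.\<close>

definition stable_rows :: "'r ring \<Rightarrow> ('r, 'm) module \<Rightarrow> 'm set \<Rightarrow> ('m \<Rightarrow> 'r) set"
  where "stable_rows R M X =
    {c. \<forall>Z. finite Z \<and> X \<subseteq> Z \<and> Z \<subseteq> carrier M \<longrightarrow>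
      (\<exists>\<psi>. linear_form R M (lspan R M Z) \<psi> \<and> (\<forall>x\<in>X. \<psi> x = c x))}"

text \<open>The coordinate vectors are taken from \<open>N\<close>, whereas stability of the rows refers to the whole
  module \<open>M\<close>.  The case \<open>N = M\<close> is the property to which the theorem is reduced; smaller \<open>N\<close> are
  the candidates for a dense system.\<close>

definition stably_coordinatized :: "'r ring \<Rightarrow> ('r, 'm) module \<Rightarrow> 'm set \<Rightarrow> bool"
  where "stably_coordinatized R M N \<longleftrightarrow>
    (\<forall>X. finite X \<and> X \<subseteq> N \<longrightarrow>
      (\<exists>ps. (\<forall>y c. (y, c) \<in> set ps \<longrightarrow> y \<in> N \<and> c \<in> stable_rows R M X) \<and>
        (\<forall>x\<in>X. coord_sum M ps x = x)))"

lemma stably_coordinatizedE: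
  assumes "stably_coordinatized R M N" "finite X" "X \<subseteq> N"
  obtains ps where "\<And>y c. (y, c) \<in> set ps \<Longrightarrow> y \<in> N \<and> c \<in> stable_rows R M X"
    "\<And>x. x \<in> X \<Longrightarrow> coord_sum M ps x = x"
proof -
  from assms have "\<exists>ps. (\<forall>y c. (y, c) \<in> set ps \<longrightarrow> y \<in> N \<and> c \<in> stable_rows R M X) \<and>
      (\<forall>x\<in>X. coord_sum M ps x = x)"
    unfolding stably_coordinatized_def by simp
  then show thesis using that by auto
qed

lemma coord_sum_replace_rows:
  "(\<And>y c. (y, c) \<in> set ps \<Longrightarrow> f c x = c x) \<Longrightarrow>
    coord_sum M (map (\<lambda>(y, c). (y, f c)) ps) x = coord_sum M ps x"
proof (induction ps)
  case (Cons p ps)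
  obtain y c where "p = (y, c)" by (cases p)
  moreover have "coord_sum M (map (\<lambda>(y, c). (y, f c)) ps) x = coord_sum M ps x"
    by (rule Cons.IH) (use Cons.prems in auto)
  moreover have "f c x = c x" using Cons.prems calculation(1) by auto
  ultimately show ?case by simp
qed simp

lemma finite_subset_of_directed_Union:
  assumes "finite X" "X \<subseteq> (\<Union>i\<in>I. B i)" "I \<noteq> {}"
    and "\<And>i j. \<lbrakk>i \<in> I; j \<in> I\<rbrakk> \<Longrightarrow> \<exists>k\<in>I. B i \<union> B j \<subseteq> B k"
  obtains i where "i \<in> I" "X \<subseteq> B i"
proof -
  have "\<exists>i\<in>I. X \<subseteq> B i" using assms(1,2)
  proof (induction X rule: finite_induct)
    case empty
    then show ?case using assms(3) by blast
  next
    case (insert x X)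
    then obtain i j where "i \<in> I" "X \<subseteq> B i" "j \<in> I" "x \<in> B j" by blast
    then show ?case using assms(4)[of i j] by blast
  qed
  then show ?thesis using that by blast
qed

context right_mod
begin

lemma stable_rowsD:
  assumes "c \<in> stable_rows R M X" "finite Z" "X \<subseteq> Z" "Z \<subseteq> carrier M"
  obtains \<psi> where "linear_form R M (lspan R M Z) \<psi>" "\<And>x. x \<in> X \<Longrightarrow> \<psi> x = c x"
proof -
  from assms have "\<exists>\<psi>. linear_form R M (lspan R M Z) \<psi> \<and> (\<forall>x\<in>X. \<psi> x = c x)"
    unfolding stable_rows_def by simp
  then show thesis using that by auto
qed

lemma stable_rows_closed:
  assumes "c \<in> stable_rows R M X" "finite X" "X \<subseteq> carrier M" "x \<in> X"
  shows "c x \<in> carrier R"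
proof -
  obtain \<psi> where "linear_form R M (lspan R M X) \<psi>" "\<And>x. x \<in> X \<Longrightarrow> \<psi> x = c x"
    using stable_rowsD[OF assms(1,2) subset_refl assms(3)] by blast
  then show ?thesis using linear_form_closed lspan_incl[OF assms(3)] assms(4) by (metis subsetD)
qed

lemma stable_rows_restrict:
  assumes c: "c \<in> stable_rows R M Y" and Y: "X \<subseteq> Y" "finite Y" "Y \<subseteq> carrier M"
  shows "c \<in> stable_rows R M X"
  unfolding stable_rows_def
proof (intro CollectI allI impI)
  fix Z assume Z: "finite Z \<and> X \<subseteq> Z \<and> Z \<subseteq> carrier M"
  obtain \<psi> where \<psi>: "linear_form R M (lspan R M (Z \<union> Y)) \<psi>" "\<And>y. y \<in> Y \<Longrightarrow> \<psi> y = c y"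
    using stable_rowsD[OF c, of "Z \<union> Y"] Z Y by blast
  have "linear_form R M (lspan R M Z) \<psi>"
    by (rule linear_form_mono[OF \<psi>(1) lspan_mono]) blast
  then show "\<exists>\<psi>. linear_form R M (lspan R M Z) \<psi> \<and> (\<forall>x\<in>X. \<psi> x = c x)"
    using \<psi>(2) Y(1) by blast
qed

lemma stable_rows_cong:
  "\<lbrakk>c \<in> stable_rows R M X; \<And>x. x \<in> X \<Longrightarrow> c x = d x\<rbrakk> \<Longrightarrow> d \<in> stable_rows R M X"
  unfolding stable_rows_def by simp

lemma stable_rows_row_comb:
  assumes "\<And>a c. (a, c) \<in> set qs \<Longrightarrow> a \<in> carrier R \<and> c \<in> stable_rows R M X"
  shows "row_comb R qs \<in> stable_rows R M X"
proof (rule row_comb_closed_under[of "\<lambda>c. c \<in> stable_rows R M X", OF _ _ _ assms])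
  show "(\<lambda>x. \<zero>\<^bsub>R\<^esub>) \<in> stable_rows R M X"
    unfolding stable_rows_def using linear_form_zero_fun by blast
next
  fix c d assume cd: "c \<in> stable_rows R M X" "d \<in> stable_rows R M X"
  show "(\<lambda>x. c x \<oplus>\<^bsub>R\<^esub> d x) \<in> stable_rows R M X"
    unfolding stable_rows_def
  proof (intro CollectI allI impI)
    fix Z assume Z: "finite Z \<and> X \<subseteq> Z \<and> Z \<subseteq> carrier M"
    obtain \<psi> \<chi> where "linear_form R M (lspan R M Z) \<psi>" "\<And>x. x \<in> X \<Longrightarrow> \<psi> x = c x"
      "linear_form R M (lspan R M Z) \<chi>" "\<And>x. x \<in> X \<Longrightarrow> \<chi> x = d x"
      using stable_rowsD[OF cd(1)] stable_rowsD[OF cd(2)] Z by metis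
    then show "\<exists>\<psi>. linear_form R M (lspan R M Z) \<psi> \<and> (\<forall>x\<in>X. \<psi> x = c x \<oplus>\<^bsub>R\<^esub> d x)"
      by (intro exI[of _ "\<lambda>x. \<psi> x \<oplus>\<^bsub>R\<^esub> \<chi> x"]) (simp add: linear_form_plus)
  qed
next
  fix a c assume a: "a \<in> carrier R" and c: "c \<in> stable_rows R M X"
  show "(\<lambda>x. a \<otimes>\<^bsub>R\<^esub> c x) \<in> stable_rows R M X"
    unfolding stable_rows_def
  proof (intro CollectI allI impI)
    fix Z assume Z: "finite Z \<and> X \<subseteq> Z \<and> Z \<subseteq> carrier M"
    obtain \<psi> where "linear_form R M (lspan R M Z) \<psi>" "\<And>x. x \<in> X \<Longrightarrow> \<psi> x = c x"
      using stable_rowsD[OF c] Z by metis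
    then show "\<exists>\<psi>. linear_form R M (lspan R M Z) \<psi> \<and> (\<forall>x\<in>X. \<psi> x = a \<otimes>\<^bsub>R\<^esub> c x)"
      using a by (intro exI[of _ "\<lambda>x. a \<otimes>\<^bsub>R\<^esub> \<psi> x"]) (simp add: linear_form_lmult)
  qed
qed

text \<open>Stable coordinates on \<open>Y\<close> have the form \<open>x = \<Sum> y\<^sub>b d\<^sub>b(x)\<close>.  Extend the given row to a form
  \<open>\<psi>\<close> on the span of \<open>Y\<close> and all \<open>y\<^sub>b\<close>.  Then \<open>\<psi>\<close> agrees on \<open>Y\<close> with \<open>\<Sum> \<psi>(y\<^sub>b) d\<^sub>b\<close>, a left combination
  of stable rows.\<close>

lemma stable_rows_extend:
  assumes M: "stably_coordinatized R M (carrier M)"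
    and c: "c \<in> stable_rows R M X" and Y: "X \<subseteq> Y" "finite Y" "Y \<subseteq> carrier M"
  obtains d where "d \<in> stable_rows R M Y" "\<And>x. x \<in> X \<Longrightarrow> d x = c x"
proof -
  obtain ps where ps: "\<And>y c. (y, c) \<in> set ps \<Longrightarrow> y \<in> carrier M \<and> c \<in> stable_rows R M Y"
    "\<And>x. x \<in> Y \<Longrightarrow> coord_sum M ps x = x"
    using stably_coordinatizedE[OF M Y(2,3)] by metis
  let ?Z = "Y \<union> fst ` set ps"
  have Z: "finite ?Z" "X \<subseteq> ?Z" "?Z \<subseteq> carrier M" using Y ps(1) by force+
  obtain \<psi> where \<psi>: "linear_form R M (lspan R M ?Z) \<psi>" "\<And>x. x \<in> X \<Longrightarrow> \<psi> x = c x"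
    using stable_rowsD[OF c Z] by blast
  note sub = lspan_submodule[OF Z(3)] and inc = lspan_incl[OF Z(3)]
  have "\<psi> x = row_comb R (map (\<lambda>(y, c). (\<psi> y, c)) ps) x" if x: "x \<in> Y" for x
  proof -
    have "\<psi> x = \<psi> (coord_sum M ps x)" using ps(2)[OF x] by simp
    also have "\<dots> = row_comb R (map (\<lambda>(y, c). (\<psi> y, c)) ps) x"
    proof (rule linear_form_coord_sum[OF sub \<psi>(1)])
      fix y c assume "(y, c) \<in> set ps"
      then show "y \<in> lspan R M ?Z \<and> c x \<in> carrier R"
        using inc ps(1)[of y c] stable_rows_closed[OF _ Y(2,3) x] by force
    qed
    finally show ?thesis .
  qed
  moreover have "row_comb R (map (\<lambda>(y, c). (\<psi> y, c)) ps) \<in> stable_rows R M Y"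
  proof (rule stable_rows_row_comb)
    fix a c assume "(a, c) \<in> set (map (\<lambda>(y, c). (\<psi> y, c)) ps)"
    then obtain y where y: "(y, c) \<in> set ps" "a = \<psi> y" by auto
    then have "y \<in> lspan R M ?Z" using inc by force
    then show "a \<in> carrier R \<and> c \<in> stable_rows R M Y"
      using linear_form_closed[OF \<psi>(1)] ps(1) y by blast
  qed
  moreover have "\<psi> x = row_comb R (map (\<lambda>(y, c). (\<psi> y, c)) ps) x" if "x \<in> X" for x
    using that Y(1) calculation(1) by blast
  ultimately show ?thesis using \<psi>(2) by (intro that) auto
qed

text \<open>Extend the row successively to one more generator.  The resulting forms on the finitely generated
  submodules are compatible, because forms that agree on generators are equal.\<close>

lemma stable_rows_extend_to_form:
  assumes M: "stably_coordinatized R M (carrier M)"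
    and e: "range (e :: nat \<Rightarrow> 'm) \<subseteq> carrier M"
    and X: "finite X" "X \<subseteq> lspan R M (range e)" and c: "c \<in> stable_rows R M X"
  obtains \<psi> where "linear_form R M (lspan R M (range e)) \<psi>" "\<And>x. x \<in> X \<Longrightarrow> \<psi> x = c x"
proof -
  define Y where "Y n = X \<union> e ` {..<n}" for n :: nat
  note N = lspan_submodule[OF e]
  have Y: "finite (Y n)" "Y n \<subseteq> carrier M" "Y n \<subseteq> Y (Suc n)" for n
    using X e submodule_subset[OF N] by (auto simp: Y_def)
  have Ymono: "Y n \<subseteq> Y m" if "n \<le> m" for n m using that by (auto simp: Y_def)
  have YN: "lspan R M (Y n) \<subseteq> lspan R M (range e)" for n
    by (rule lspan_minimal[OF N]) (use X lspan_incl[OF e] in \<open>auto simp: Y_def\<close>)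
  have "\<exists>d. \<forall>n. (d n \<in> stable_rows R M (Y n) \<and> (\<forall>x\<in>X. d n x = c x)) \<and> (\<forall>x\<in>Y n. d (Suc n) x = d n x)"
  proof (rule dependent_nat_choice)
    show "\<exists>d. d \<in> stable_rows R M (Y 0) \<and> (\<forall>x\<in>X. d x = c x)" using c by (auto simp: Y_def)
    fix d n assume d: "d \<in> stable_rows R M (Y n) \<and> (\<forall>x\<in>X. d x = c x)"
    obtain d' where "d' \<in> stable_rows R M (Y (Suc n))" "\<And>x. x \<in> Y n \<Longrightarrow> d' x = d x"
      using stable_rows_extend[OF M _ Y(3,1,2)] d by blast
    moreover have "X \<subseteq> Y n" by (simp add: Y_def)
    ultimately show "\<exists>d'. (d' \<in> stable_rows R M (Y (Suc n)) \<and> (\<forall>x\<in>X. d' x = c x)) \<and> (\<forall>x\<in>Y n. d' x = d x)"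
      using d by (metis subsetD)
  qed
  then obtain d where d: "\<And>n. d n \<in> stable_rows R M (Y n)" "\<And>n x. x \<in> X \<Longrightarrow> d n x = c x"
    and step: "\<And>n x. x \<in> Y n \<Longrightarrow> d (Suc n) x = d n x" by blast
  have dmono: "d m x = d n x" if "n \<le> m" "x \<in> Y n" for n m x
    using that(1)
  proof (induction m rule: dec_induct)
    case (step m)
    then show ?case using \<open>\<And>n x. x \<in> Y n \<Longrightarrow> d (Suc n) x = d n x\<close>[of x m] Ymono[of n m] that(2) by auto
  qed simp
  have "\<exists>\<psi>. linear_form R M (lspan R M (Y n)) \<psi> \<and> (\<forall>x\<in>Y n. \<psi> x = d n x)" for n
    by (rule stable_rowsD[OF d(1)[of n] Y(1) subset_refl Y(2)]) blast
  then obtain \<psi> where \<psi>: "\<And>n. linear_form R M (lspan R M (Y n)) (\<psi> n)" "\<And>n x. x \<in> Y n \<Longrightarrow> \<psi> n x = d n x"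
    by metis
  have agree: "\<psi> m x = \<psi> n x" if "n \<le> m" "x \<in> lspan R M (Y n)" for n m x
    by (rule linear_form_eq_on_lspan[OF \<psi>(1) \<psi>(1) lspan_submodule[OF Y(2)] lspan_submodule[OF Y(2)] _ _ _ that(2)])
      (use lspan_incl[OF Y(2)] Ymono[OF that(1)] dmono[OF that(1)] \<psi>(2) in auto)
  have "\<exists>n. x \<in> lspan R M (Y n)" if x: "x \<in> lspan R M (range e)" for x
  proof -
    obtain W where W: "finite W" "W \<subseteq> range e" "x \<in> lspan R M W"
      using lspan_finite_support[of "{x}" "range e"] x by auto
    then obtain J where J: "finite J" "W = e ` J" by (meson finite_subset_image)
    have "j < Suc (Max (insert 0 J))" if "j \<in> J" for j
      using Max_ge[of "insert 0 J" j] that J(1) by (intro le_imp_less_Suc) auto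
    then have "W \<subseteq> Y (Suc (Max (insert 0 J)))" unfolding J Y_def by blast
    then show ?thesis using W(3) lspan_mono by blast
  qed
  then obtain m where m: "\<And>x. x \<in> lspan R M (range e) \<Longrightarrow> x \<in> lspan R M (Y (m x))" by metis
  define \<chi> where "\<chi> x = \<psi> (m x) x" for x
  have \<chi>: "\<chi> x = \<psi> n x" if "x \<in> lspan R M (range e)" "n \<ge> m x" for n x
    unfolding \<chi>_def using agree[OF that(2) m[OF that(1)]] by simp
  have big: "x \<in> lspan R M (Y n)" if "x \<in> lspan R M (range e)" "n \<ge> m x" for n x
    using m[OF that(1)] lspan_mono[OF Ymono[OF that(2)]] by blast
  have "linear_form R M (lspan R M (range e)) \<chi>"
    unfolding linear_form_def
  proof (intro conjI ballI)
    fix x assume x: "x \<in> lspan R M (range e)"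
    show "\<chi> x \<in> carrier R" unfolding \<chi>_def by (rule linear_form_closed[OF \<psi>(1) m[OF x]])
    fix y assume y: "y \<in> lspan R M (range e)"
    let ?n = "max (m (x \<oplus>\<^bsub>M\<^esub> y)) (max (m x) (m y))"
    show "\<chi> (x \<oplus>\<^bsub>M\<^esub> y) = \<chi> x \<oplus>\<^bsub>R\<^esub> \<chi> y"
      using linear_form_add[OF \<psi>(1)[of ?n] big[OF x] big[OF y]] submodule_add[OF N x y]
        \<chi>[of "x \<oplus>\<^bsub>M\<^esub> y" ?n] \<chi>[OF x, of ?n] \<chi>[OF y, of ?n] by simp
  next
    fix r x assume r: "r \<in> carrier R" and x: "x \<in> lspan R M (range e)"
    let ?n = "max (m (r \<odot>\<^bsub>M\<^esub> x)) (m x)"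
    show "\<chi> (r \<odot>\<^bsub>M\<^esub> x) = \<chi> x \<otimes>\<^bsub>R\<^esub> r"
      using linear_form_smult[OF \<psi>(1)[of ?n] r big[OF x]] submodule_smult[OF N r x]
        \<chi>[of "r \<odot>\<^bsub>M\<^esub> x" ?n] \<chi>[OF x, of ?n] by simp
  qed
  moreover have "\<chi> x = c x" if x: "x \<in> X" for x
  proof -
    have "x \<in> Y (m x)" using x by (simp add: Y_def)
    then show ?thesis using \<psi>(2) d(2)[OF x] by (simp add: \<chi>_def)
  qed
  ultimately show ?thesis by (rule that)
qed

lemma stably_coordinatized_projective:
  assumes M: "stably_coordinatized R M (carrier M)"
    and S: "countable S" "S \<subseteq> carrier M" and closed: "stably_coordinatized R M (lspan R M S)"
  shows "projective_module R (M\<lparr>carrier := lspan R M S\<rparr>)"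
proof -
  let ?N = "lspan R M S"
  note N = lspan_submodule[OF S(2)]
  have NM: "right_module R M" by unfold_locales
  obtain e :: "nat \<Rightarrow> 'm" where e: "range e = insert \<zero>\<^bsub>M\<^esub> S"
    using uncountable_def[of "insert \<zero>\<^bsub>M\<^esub> S"] S(1) by auto
  have ec: "range e \<subseteq> carrier M" using e S(2) by auto
  have eN: "lspan R M (range e) = ?N"
    using lspan_minimal[OF N, of "range e"] lspan_mono[of S "range e"] e lspan_incl[OF S(2)] submodule_zero[OF N] by auto
  show ?thesis
  proof (rule coordinates_imp_projective[OF submodule_as_right_module[OF NM N] S(1)])
    show "S \<subseteq> carrier (M\<lparr>carrier := ?N\<rparr>)" using lspan_incl[OF S(2)] by simp
    show "lspan R (M\<lparr>carrier := ?N\<rparr>) S = carrier (M\<lparr>carrier := ?N\<rparr>)" by simp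
    fix U assume "finite U" "U \<subseteq> carrier (M\<lparr>carrier := ?N\<rparr>)"
    then have U: "finite U" "U \<subseteq> ?N" by simp_all
    obtain ps where ps: "\<And>y c. (y, c) \<in> set ps \<Longrightarrow> y \<in> ?N \<and> c \<in> stable_rows R M U"
      "\<And>u. u \<in> U \<Longrightarrow> coord_sum M ps u = u"
      using stably_coordinatizedE[OF closed U] by metis
    have "\<exists>\<psi>. c \<in> stable_rows R M U \<longrightarrow> linear_form R M ?N \<psi> \<and> (\<forall>u\<in>U. \<psi> u = c u)" for c
      using stable_rows_extend_to_form[OF M ec U(1), of c] U(2) eN by metis
    then obtain \<psi> where \<psi>: "\<And>c. c \<in> stable_rows R M U \<Longrightarrow> linear_form R M ?N (\<psi> c)"
      "\<And>c u. \<lbrakk>c \<in> stable_rows R M U; u \<in> U\<rbrakk> \<Longrightarrow> \<psi> c u = c u" by metis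
    let ?qs = "map (\<lambda>(y, c). (y, \<psi> c)) ps"
    have "coord_sum M ?qs u = u" if u: "u \<in> U" for u
      using coord_sum_replace_rows[of ps \<psi> u M] \<psi>(2)[OF _ u] ps(1) ps(2)[OF u] by auto
    then show "\<exists>qs. (\<forall>y \<chi>. (y, \<chi>) \<in> set qs \<longrightarrow> y \<in> carrier (M\<lparr>carrier := ?N\<rparr>) \<and>
          linear_form R (M\<lparr>carrier := ?N\<rparr>) (carrier (M\<lparr>carrier := ?N\<rparr>)) \<chi>) \<and>
        (\<forall>u\<in>U. coord_sum (M\<lparr>carrier := ?N\<rparr>) qs u = u)"
      using ps(1) \<psi>(1) by (intro exI[of _ ?qs]) auto
  qed
qed

text \<open>Coordinates on a finite \<open>X \<subseteq> S\<close> serve all finite \<open>U\<close> in the span of \<open>X\<close>: extend their rows to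
  stable rows on \<open>X \<union> U\<close> and then to forms on the span, which reproduce \<open>U\<close> since they reproduce
  \<open>X\<close>.\<close>

lemma stably_coordinatized_lspan:
  assumes M: "stably_coordinatized R M (carrier M)" and S: "S \<subseteq> carrier M"
    and gen: "stably_coordinatized R M S"
  shows "stably_coordinatized R M (lspan R M S)"
  unfolding stably_coordinatized_def
proof (intro allI impI)
  fix U assume U: "finite U \<and> U \<subseteq> lspan R M S"
  obtain X where X: "finite X" "X \<subseteq> S" "U \<subseteq> lspan R M X"
    using lspan_finite_support[of U S] U by blast
  obtain ps where ps: "\<And>y c. (y, c) \<in> set ps \<Longrightarrow> y \<in> S \<and> c \<in> stable_rows R M X"
    "\<And>x. x \<in> X \<Longrightarrow> coord_sum M ps x = x"
    using stably_coordinatizedE[OF gen X(1,2)] by metis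
  let ?Y = "X \<union> U"
  have Y: "X \<subseteq> ?Y" "finite ?Y" "?Y \<subseteq> carrier M" using X U S lspan_closed[OF S] by auto
  have "\<exists>\<psi>. c \<in> stable_rows R M X \<longrightarrow> linear_form R M (lspan R M ?Y) \<psi> \<and>
      \<psi> \<in> stable_rows R M U \<and> (\<forall>x\<in>X. \<psi> x = c x)" for c
  proof (cases "c \<in> stable_rows R M X")
    case True
    obtain d where d: "d \<in> stable_rows R M ?Y" "\<And>x. x \<in> X \<Longrightarrow> d x = c x"
      using stable_rows_extend[OF M True Y] by blast
    obtain \<psi> where \<psi>: "linear_form R M (lspan R M ?Y) \<psi>" "\<And>x. x \<in> ?Y \<Longrightarrow> \<psi> x = d x"
      using stable_rowsD[OF d(1) Y(2) subset_refl Y(3)] by blast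
    have "\<psi> \<in> stable_rows R M ?Y" using stable_rows_cong[OF d(1)] \<psi>(2) by simp
    then have "\<psi> \<in> stable_rows R M U" by (rule stable_rows_restrict) (use Y in auto)
    then show ?thesis using \<psi> d(2) by auto
  qed blast
  then obtain \<psi> where \<psi>: "\<And>c. c \<in> stable_rows R M X \<Longrightarrow> linear_form R M (lspan R M ?Y) (\<psi> c)"
    "\<And>c. c \<in> stable_rows R M X \<Longrightarrow> \<psi> c \<in> stable_rows R M U"
    "\<And>c x. \<lbrakk>c \<in> stable_rows R M X; x \<in> X\<rbrakk> \<Longrightarrow> \<psi> c x = c x" by metis
  let ?qs = "map (\<lambda>(y, c). (y, \<psi> c)) ps"
  have onX: "coord_sum M ?qs x = x" if x: "x \<in> X" for x
    using coord_sum_replace_rows[of ps \<psi> x M] \<psi>(3)[OF _ x] ps(1) ps(2)[OF x] by auto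
  have "coord_sum M ?qs u = u" if u: "u \<in> U" for u
  proof (rule coord_sum_reproduces_lspan[OF lspan_submodule[OF Y(3)] _ _ onX])
    show "y \<in> carrier M \<and> linear_form R M (lspan R M ?Y) c" if "(y, c) \<in> set ?qs" for y c
      using that ps(1) \<psi>(1) S by auto
    show "X \<subseteq> lspan R M ?Y" using lspan_incl[OF Y(3)] by blast
    show "u \<in> lspan R M X" using X u by blast
  qed
  then show "\<exists>qs. (\<forall>y c. (y, c) \<in> set qs \<longrightarrow> y \<in> lspan R M S \<and> c \<in> stable_rows R M U) \<and>
      (\<forall>u\<in>U. coord_sum M qs u = u)"
    using ps(1) \<psi>(2) lspan_incl[OF S] by (intro exI[of _ ?qs]) auto
qed

text \<open>Close the given set under chosen coordinate vectors for its finite subsets; a countable set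
  has only countably many of these.\<close>

lemma countable_stably_coordinatized_closure:
  assumes M: "stably_coordinatized R M (carrier M)" and A: "countable A" "A \<subseteq> carrier M"
  obtains S where "countable S" "A \<subseteq> S" "S \<subseteq> carrier M" "stably_coordinatized R M (lspan R M S)"
proof -
  have "\<exists>ps. finite X \<and> X \<subseteq> carrier M \<longrightarrow>
      (\<forall>y c. (y, c) \<in> set ps \<longrightarrow> y \<in> carrier M \<and> c \<in> stable_rows R M X) \<and> (\<forall>x\<in>X. coord_sum M ps x = x)" for X
    using M unfolding stably_coordinatized_def by metis
  then obtain ps where ps:
    "\<And>X y c. \<lbrakk>finite X; X \<subseteq> carrier M; (y, c) \<in> set (ps X)\<rbrakk> \<Longrightarrow> y \<in> carrier M \<and> c \<in> stable_rows R M X"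
    "\<And>X x. \<lbrakk>finite X; X \<subseteq> carrier M; x \<in> X\<rbrakk> \<Longrightarrow> coord_sum M (ps X) x = x" by metis
  define T where "T S = S \<union> (\<Union>X\<in>{X. finite X \<and> X \<subseteq> S}. fst ` set (ps X))" for S
  define B where "B n = (T ^^ n) A" for n
  have B0: "B 0 = A" and BS: "B (Suc n) = T (B n)" for n by (simp_all add: B_def)
  have inc: "B n \<subseteq> B (Suc n)" for n by (simp add: BS T_def)
  have mono: "B n \<subseteq> B m" if "n \<le> m" for n m using lift_Suc_mono_le[of B, OF inc that] .
  have cnt: "countable (B n)" for n
  proof (induction n)
    case (Suc n)
    then show ?case unfolding BS T_def
      by (intro countable_Un countable_UN countable_Collect_finite_subset) (auto intro: countable_finite)
  qed (simp add: B0 A)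
  have sub: "B n \<subseteq> carrier M" for n
  proof (induction n)
    case (Suc n)
    have "fst ` set (ps X) \<subseteq> carrier M" if "finite X" "X \<subseteq> B n" for X
      using ps(1)[of X] that Suc.IH by fastforce
    then show ?case using Suc.IH unfolding BS T_def by auto
  qed (simp add: B0 A)
  let ?S = "\<Union>n. B n"
  have "stably_coordinatized R M ?S"
    unfolding stably_coordinatized_def
  proof (intro allI impI)
    fix X assume X: "finite X \<and> X \<subseteq> ?S"
    then obtain n where n: "X \<subseteq> B n"
      using finite_subset_of_directed_Union[of X B UNIV] mono by (metis Un_least UNIV_I empty_iff linear)
    have "X \<subseteq> carrier M" using n sub by blast
    moreover have "fst ` set (ps X) \<subseteq> B (Suc n)" using n X unfolding BS T_def by blast
    ultimately show "\<exists>ps. (\<forall>y c. (y, c) \<in> set ps \<longrightarrow> y \<in> ?S \<and> c \<in> stable_rows R M X) \<and>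
        (\<forall>x\<in>X. coord_sum M ps x = x)"
      using X ps by (intro exI[of _ "ps X"]) force
  qed
  moreover have "?S \<subseteq> carrier M" using sub by blast
  moreover have "countable ?S" using cnt by blast
  moreover have "A \<subseteq> ?S" using B0 by blast
  ultimately show ?thesis using that stably_coordinatized_lspan[OF M] by blast
qed

end

section \<open>Stable coordinates and dense systems\<close>

lemma countable_iff_less_aleph1: "countable A \<longleftrightarrow> |A| <o aleph1"
  by (simp add: countable_card_le_natLeq cardSuc_ordLeq_ordLess natLeq_Card_order)

lemma Well_order_Field_total: "\<lbrakk>Well_order \<rho>; i \<in> Field \<rho>; j \<in> Field \<rho>\<rbrakk> \<Longrightarrow> (i, j) \<in> \<rho> \<or> (j, i) \<in> \<rho>"
  unfolding well_order_on_def linear_order_on_def partial_order_on_def preorder_on_def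
    total_on_def refl_on_def by metis

text \<open>Chains of a dense system are indexed by well-orders on the type of \<open>\<kappa>\<close>, so the order type of the
  natural numbers is copied there.\<close>

lemma increasing_sequence_as_chain:
  fixes \<kappa> :: "'k rel" and N :: "nat \<Rightarrow> 'a set"
  assumes \<kappa>: "natLeq <o \<kappa>" and N: "\<And>n. N n \<subseteq> N (Suc n)"
  obtains \<rho> :: "'k rel" and N' where "Well_order \<rho>" "\<rho> <o \<kappa>" "Field \<rho> \<noteq> {}" "relChain \<rho> N'"
    "N' ` Field \<rho> = range N"
proof -
  have "|UNIV :: nat set| \<le>o |Field \<kappa>|"
    using card_of_mono2[OF ordLess_imp_ordLeq[OF \<kappa>]] by (simp add: Field_natLeq)
  then obtain f :: "nat \<Rightarrow> 'k" where f: "inj f" "range f \<subseteq> Field \<kappa>"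
    unfolding card_of_ordLeq[symmetric] by blast
  let ?\<rho> = "dir_image natLeq f"
  have mono: "N n \<subseteq> N m" if "n \<le> m" for n m using lift_Suc_mono_le[of N, OF N that] .
  show ?thesis
  proof (rule that[of ?\<rho> "\<lambda>\<alpha>. N (inv_into UNIV f \<alpha>)"])
    show "Well_order ?\<rho>" using f(1) by (intro Well_order_dir_image natLeq_Well_order) (simp add: Field_natLeq)
    have "natLeq =o ?\<rho>" using f(1) by (intro dir_image_ordIso natLeq_Well_order) (simp add: Field_natLeq)
    then show "?\<rho> <o \<kappa>" using \<kappa> ordIso_symmetric ordIso_ordLess_trans by blast
    have F: "Field ?\<rho> = range f" by (simp add: dir_image_Field Field_natLeq)
    show "Field ?\<rho> \<noteq> {}" using F by simp
    show "relChain ?\<rho> (\<lambda>\<alpha>. N (inv_into UNIV f \<alpha>))"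
      using f(1) by (auto simp: relChain_def dir_image_def natLeq_def inv_f_f dest: subsetD[OF mono])
    show "(\<lambda>\<alpha>. N (inv_into UNIV f \<alpha>)) ` Field ?\<rho> = range N"
      unfolding F using f(1) by (auto simp: image_image inv_f_f)
  qed
qed

lemma finite_less_uncountable: "\<lbrakk>natLeq <o \<kappa>; finite A\<rbrakk> \<Longrightarrow> |A| <o \<kappa>"
  using finite_iff_ordLess_natLeq ordLess_transitive by blast

context right_mod
begin

text \<open>The countably generated submodules that contain stable coordinates of their finite subsets form
  the dense system.  The union of a nonempty countable chain has the property again, since each of its
  finite subsets lies in one member of the chain.\<close>

lemma stably_coordinatized_imp_aleph1_projective:
  assumes M: "stably_coordinatized R M (carrier M)"
  shows "kappa_projective aleph1 R M"
proof -
  define \<C> where "\<C> = {lspan R M S | S. countable S \<and> S \<subseteq> carrier M \<and> stably_coordinatized R M (lspan R M S)}"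
  have cover: "\<exists>N\<in>\<C>. S \<subseteq> N" if S: "countable S" "S \<subseteq> carrier M" for S
  proof -
    obtain T where T: "countable T" "S \<subseteq> T" "T \<subseteq> carrier M" "stably_coordinatized R M (lspan R M T)"
      using countable_stably_coordinatized_closure[OF M S] by blast
    then have "lspan R M T \<in> \<C>" "S \<subseteq> lspan R M T"
      using lspan_incl[OF T(3)] unfolding \<C>_def by auto
    then show ?thesis by blast
  qed
  have dense: "dense_system aleph1 R M \<C>"
    unfolding dense_system_def
  proof (intro conjI ballI allI impI)
    show "submodule N R M" if "N \<in> \<C>" for N
      using that lspan_submodule unfolding \<C>_def by auto
    show "\<C> \<noteq> {}" using cover[of "{}"] by auto
    show "\<exists>N''\<in>\<C>. N \<union> N' \<subseteq> N''" if NN: "N \<in> \<C>" "N' \<in> \<C>" for N N'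
    proof -
      obtain S S' where S: "N = lspan R M S" "N' = lspan R M S'" "countable (S \<union> S')" "S \<union> S' \<subseteq> carrier M"
        using NN unfolding \<C>_def by auto
      obtain N'' where N'': "N'' \<in> \<C>" "S \<union> S' \<subseteq> N''" using cover[OF S(3,4)] by blast
      have sub: "submodule N'' R M" using N'' lspan_submodule unfolding \<C>_def by auto
      have "N \<union> N' \<subseteq> N''"
        unfolding S(1,2) using lspan_minimal[OF sub, of S] lspan_minimal[OF sub, of S'] N''(2) by auto
      then show ?thesis using N''(1) by blast
    qed
    show "\<exists>N\<in>\<C>. S \<subseteq> N" if "S \<subseteq> carrier M" "|S| <o aleph1" for S
      using cover that countable_iff_less_aleph1 by blast
    fix \<rho> :: "nat set rel" and N
    assume "Well_order \<rho> \<and> \<rho> <o aleph1 \<and> Field \<rho> \<noteq> {} \<and> relChain \<rho> N \<and> (\<forall>\<alpha>\<in>Field \<rho>. N \<alpha> \<in> \<C>)"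
    then have \<rho>: "Well_order \<rho>" "\<rho> <o aleph1" "Field \<rho> \<noteq> {}" "relChain \<rho> N"
      and N: "\<And>\<alpha>. \<alpha> \<in> Field \<rho> \<Longrightarrow> N \<alpha> \<in> \<C>" by auto
    have dir: "\<exists>\<gamma>\<in>Field \<rho>. N \<alpha> \<union> N \<beta> \<subseteq> N \<gamma>" if "\<alpha> \<in> Field \<rho>" "\<beta> \<in> Field \<rho>" for \<alpha> \<beta>
      using Well_order_Field_total[OF \<rho>(1) that] \<rho>(4) that unfolding relChain_def by blast
    have "\<exists>S. countable S \<and> S \<subseteq> carrier M \<and> N \<alpha> = lspan R M S \<and> stably_coordinatized R M (N \<alpha>)"
      if "\<alpha> \<in> Field \<rho>" for \<alpha> using N[OF that] unfolding \<C>_def by auto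
    then obtain S where S: "\<And>\<alpha>. \<alpha> \<in> Field \<rho> \<Longrightarrow> countable (S \<alpha>)" "\<And>\<alpha>. \<alpha> \<in> Field \<rho> \<Longrightarrow> S \<alpha> \<subseteq> carrier M"
      "\<And>\<alpha>. \<alpha> \<in> Field \<rho> \<Longrightarrow> N \<alpha> = lspan R M (S \<alpha>)" "\<And>\<alpha>. \<alpha> \<in> Field \<rho> \<Longrightarrow> stably_coordinatized R M (N \<alpha>)"
      by metis
    let ?U = "\<Union>\<alpha>\<in>Field \<rho>. N \<alpha>" and ?S = "\<Union>\<alpha>\<in>Field \<rho>. S \<alpha>"
    have "|Field \<rho>| \<le>o \<rho>" using \<rho>(1) by (rule card_of_least)
    then have "countable (Field \<rho>)" using \<rho>(2) countable_iff_less_aleph1 ordLeq_ordLess_trans by blast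
    then have cnt: "countable ?S" using S(1) by (intro countable_UN)
    have sub: "?S \<subseteq> carrier M" using S(2) by blast
    have subN: "submodule (N \<alpha>) R M" if "\<alpha> \<in> Field \<rho>" for \<alpha>
      using S(2,3)[OF that] lspan_submodule by simp
    have "submodule ?U R M"
      using \<rho>(3) subN dir by (intro submodule_Union_directed) auto
    moreover have "?S \<subseteq> ?U"
      by (rule UN_mono[OF subset_refl]) (simp add: S(3) lspan_incl[OF S(2)])
    ultimately have "lspan R M ?S \<subseteq> ?U" by (rule lspan_minimal)
    moreover have "?U \<subseteq> lspan R M ?S"
    proof (rule UN_least)
      fix \<alpha> assume "\<alpha> \<in> Field \<rho>"
      then show "N \<alpha> \<subseteq> lspan R M ?S" using S(3) lspan_mono[of "S \<alpha>" ?S] by auto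
    qed
    ultimately have U: "?U = lspan R M ?S" by (rule equalityI[rotated])
    have "stably_coordinatized R M ?U"
      unfolding stably_coordinatized_def
    proof (intro allI impI)
      fix X assume X: "finite X \<and> X \<subseteq> ?U"
      then obtain \<alpha> where \<alpha>: "\<alpha> \<in> Field \<rho>" "X \<subseteq> N \<alpha>"
        using finite_subset_of_directed_Union[of X N "Field \<rho>"] \<rho>(3) dir by metis
      obtain ps where "\<And>y c. (y, c) \<in> set ps \<Longrightarrow> y \<in> N \<alpha> \<and> c \<in> stable_rows R M X"
        "\<And>x. x \<in> X \<Longrightarrow> coord_sum M ps x = x"
        using stably_coordinatizedE[OF S(4)[OF \<alpha>(1)] _ \<alpha>(2)] X by metis
      then show "\<exists>ps. (\<forall>y c. (y, c) \<in> set ps \<longrightarrow> y \<in> ?U \<and> c \<in> stable_rows R M X) \<and>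
          (\<forall>x\<in>X. coord_sum M ps x = x)"
        using \<alpha>(1) by (intro exI[of _ ps]) auto
    qed
    then show "?U \<in> \<C>" unfolding \<C>_def U using cnt sub by auto
  qed
  have "less_generated aleph1 R (M\<lparr>carrier := N\<rparr>) \<and> projective_module R (M\<lparr>carrier := N\<rparr>)"
    if NC: "N \<in> \<C>" for N
  proof -
    obtain S where S: "countable S" "S \<subseteq> carrier M" "stably_coordinatized R M N" and N: "N = lspan R M S"
      using NC unfolding \<C>_def by auto
    have NM: "right_module R M" by unfold_locales
    interpret N: sided_module R "M\<lparr>carrier := N\<rparr>"
      unfolding N by (intro right_module_sided submodule_as_right_module NM lspan_submodule S(2))
    have "S \<subseteq> N" unfolding N by (rule lspan_incl[OF S(2)])
    then have "less_generated aleph1 R (M\<lparr>carrier := N\<rparr>)"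
      unfolding less_generated_def using N.lspan_eq_hull[of S] S(1) N countable_iff_less_aleph1
      by (intro exI[of _ S]) auto
    then show ?thesis using stably_coordinatized_projective[OF M S(1,2)] S(3) N by simp
  qed
  with dense show ?thesis unfolding kappa_projective_def by blast
qed

text \<open>Some member \<open>N\<close> of the dense system has the property that all its forms survive, up to their
  values on \<open>X\<close>, in every larger member; otherwise the union of an increasing sequence of bad
  members would be a member without coordinates for \<open>X\<close>.  Since every finite set lies in a
  member that contains \<open>N\<close>, the coordinates of \<open>X\<close> by forms on \<open>N\<close> have stable rows.\<close>

lemma kappa_projective_imp_stably_coordinatized:
  fixes \<kappa> :: "'k rel"
  assumes \<kappa>: "natLeq <o \<kappa>" and M: "kappa_projective \<kappa> R M"
  shows "stably_coordinatized R M (carrier M)"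
  unfolding stably_coordinatized_def
proof (intro allI impI)
  fix X assume X: "finite X \<and> X \<subseteq> carrier M"
  have NM: "right_module R M" by unfold_locales
  obtain \<C> where dense: "dense_system \<kappa> R M \<C>"
    and proj: "\<And>N. N \<in> \<C> \<Longrightarrow> projective_module R (M\<lparr>carrier := N\<rparr>)"
    using M unfolding kappa_projective_def by blast
  have sub: "submodule N R M" if "N \<in> \<C>" for N using dense that unfolding dense_system_def by blast
  have dir: "\<exists>N''\<in>\<C>. N \<union> N' \<subseteq> N''" if "N \<in> \<C>" "N' \<in> \<C>" for N N'
    using dense that unfolding dense_system_def by blast
  have cover: "\<exists>N\<in>\<C>. S \<subseteq> N" if "finite S" "S \<subseteq> carrier M" for S
    using dense[unfolded dense_system_def] that finite_less_uncountable[OF \<kappa> that(1)] by simp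
  have union: "(\<Union>n. N n) \<in> \<C>" if N: "\<And>n::nat. N n \<in> \<C>" "\<And>n. N n \<subseteq> N (Suc n)" for N
  proof -
    obtain \<rho> :: "'k rel" and N' where \<rho>: "Well_order \<rho>" "\<rho> <o \<kappa>" "Field \<rho> \<noteq> {}" "relChain \<rho> N'"
      and N': "N' ` Field \<rho> = range N"
      using increasing_sequence_as_chain[OF \<kappa>, of N] N(2) by blast
    have "N' ` Field \<rho> \<subseteq> \<C>" unfolding N' using N(1) by auto
    then have "\<forall>\<alpha>\<in>Field \<rho>. N' \<alpha> \<in> \<C>" by auto
    moreover have "\<forall>(\<rho> :: 'k rel) N. Well_order \<rho> \<and> \<rho> <o \<kappa> \<and> Field \<rho> \<noteq> {} \<and> relChain \<rho> N \<and>
        (\<forall>\<alpha>\<in>Field \<rho>. N \<alpha> \<in> \<C>) \<longrightarrow> (\<Union>\<alpha>\<in>Field \<rho>. N \<alpha>) \<in> \<C>"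
      using dense unfolding dense_system_def by (elim conjE)
    ultimately have "(\<Union>\<alpha>\<in>Field \<rho>. N' \<alpha>) \<in> \<C>" using \<rho> by simp
    then show ?thesis using N' by simp
  qed
  have coords: "\<exists>ps. (\<forall>y \<psi>. (y, \<psi>) \<in> set ps \<longrightarrow> y \<in> N \<and> linear_form R M N \<psi>) \<and>
      (\<forall>x\<in>X. coord_sum M ps x = x)" if N: "N \<in> \<C>" "X \<subseteq> N" for N
  proof -
    obtain ps where "\<And>y \<psi>. (y, \<psi>) \<in> set ps \<Longrightarrow> y \<in> carrier (M\<lparr>carrier := N\<rparr>) \<and>
        linear_form R (M\<lparr>carrier := N\<rparr>) (carrier (M\<lparr>carrier := N\<rparr>)) \<psi>"
      "\<And>x. x \<in> X \<Longrightarrow> coord_sum (M\<lparr>carrier := N\<rparr>) ps x = x"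
      using projective_imp_coordinates[OF submodule_as_right_module[OF NM sub[OF N(1)]] proj[OF N(1)], of X]
        X N(2) by auto
    then show ?thesis by (intro exI[of _ ps]) simp
  qed
  \<comment> \<open>\<open>restr N N'\<close>: as far as \<open>X\<close> can see, every form on \<open>N\<close> still exists on \<open>N'\<close>.\<close>
  define restr where "restr N N' \<longleftrightarrow> (\<forall>\<chi>. linear_form R M N \<chi> \<longrightarrow>
      (\<exists>\<chi>'. linear_form R M N' \<chi>' \<and> (\<forall>x\<in>X. \<chi>' x = \<chi> x)))" for N N'
  \<comment> \<open>The rows on \<open>X\<close> that extend to forms on \<open>N\<close> become stationary.\<close>
  have "\<exists>N\<in>\<C>. X \<subseteq> N \<and> (\<forall>N'\<in>\<C>. N \<subseteq> N' \<longrightarrow> restr N N')"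
  proof (rule ccontr)
    assume no: "\<not> ?thesis"
    have "\<exists>N. \<forall>n::nat. (N n \<in> \<C> \<and> X \<subseteq> N n) \<and> (N n \<subseteq> N (Suc n) \<and> \<not> restr (N n) (N (Suc n)))"
    proof (rule dependent_nat_choice)
      show "\<exists>N. N \<in> \<C> \<and> X \<subseteq> N" using cover X by blast
      show "\<exists>N'. (N' \<in> \<C> \<and> X \<subseteq> N') \<and> N \<subseteq> N' \<and> \<not> restr N N'" if "N \<in> \<C> \<and> X \<subseteq> N" for N
        using no that by (meson order_trans)
    qed
    then obtain N where N: "\<And>n::nat. N n \<in> \<C>" "\<And>n. X \<subseteq> N n" "\<And>n. N n \<subseteq> N (Suc n)"
      and bad: "\<And>n. \<not> restr (N n) (N (Suc n))" by blast
    have mono: "N n \<subseteq> N m" if "n \<le> m" for n m using lift_Suc_mono_le[of N, OF N(3) that] .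
    let ?U = "\<Union>n. N n"
    have U: "?U \<in> \<C>" using union[of N] N(1,3) by simp
    obtain ps where ps: "\<And>y \<psi>. (y, \<psi>) \<in> set ps \<Longrightarrow> y \<in> ?U \<and> linear_form R M ?U \<psi>"
      "\<And>x. x \<in> X \<Longrightarrow> coord_sum M ps x = x"
      using coords[OF U] N(2) by blast
    have "fst ` set ps \<subseteq> ?U" using ps(1) by auto
    then obtain n where n: "fst ` set ps \<subseteq> N n"
      using finite_subset_of_directed_Union[of "fst ` set ps" N UNIV] mono
      by (metis List.finite_set UNIV_I Un_least empty_iff finite_imageI linear)
    have "restr (N n) (N (Suc n))"
      unfolding restr_def
    proof (intro allI impI)
      fix \<chi> assume \<chi>: "linear_form R M (N n) \<chi>"
      let ?\<chi> = "row_comb R (map (\<lambda>(y, \<psi>). (\<chi> y, \<psi>)) ps)"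
      have yN: "y \<in> N n" if "(y, \<psi>) \<in> set ps" for y \<psi> using n that by force
      have "linear_form R M ?U ?\<chi>"
        by (rule linear_form_row_comb) (use ps(1) yN linear_form_closed[OF \<chi>] in auto)
      then have "linear_form R M (N (Suc n)) ?\<chi>" by (rule linear_form_mono) blast
      moreover have "?\<chi> x = \<chi> x" if x: "x \<in> X" for x
      proof -
        have "\<chi> x = \<chi> (coord_sum M ps x)" using ps(2)[OF x] by simp
        also have "\<dots> = ?\<chi> x"
          using yN ps(1) x N(2)[of n]
          by (intro linear_form_coord_sum[OF sub[OF N(1)] \<chi>]) (meson UN_I UNIV_I linear_form_closed subsetD)
        finally show ?thesis by simp
      qed
      ultimately show "\<exists>\<chi>'. linear_form R M (N (Suc n)) \<chi>' \<and> (\<forall>x\<in>X. \<chi>' x = \<chi> x)" by blast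
    qed
    then show False using bad by blast
  qed
  then obtain N where N: "N \<in> \<C>" "X \<subseteq> N" and stable: "\<And>N'. \<lbrakk>N' \<in> \<C>; N \<subseteq> N'\<rbrakk> \<Longrightarrow> restr N N'" by blast
  obtain ps where ps: "\<And>y \<psi>. (y, \<psi>) \<in> set ps \<Longrightarrow> y \<in> N \<and> linear_form R M N \<psi>"
    "\<And>x. x \<in> X \<Longrightarrow> coord_sum M ps x = x"
    using coords[OF N] by blast
  have "\<psi> \<in> stable_rows R M X" if \<psi>: "linear_form R M N \<psi>" for \<psi>
    unfolding stable_rows_def
  proof (intro CollectI allI impI)
    fix Z assume Z: "finite Z \<and> X \<subseteq> Z \<and> Z \<subseteq> carrier M"
    obtain N1 where N1: "N1 \<in> \<C>" "Z \<subseteq> N1" using cover Z by blast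
    obtain N' where N': "N' \<in> \<C>" "N \<union> N1 \<subseteq> N'" using dir[OF N(1) N1(1)] by blast
    obtain \<chi> where \<chi>: "linear_form R M N' \<chi>" "\<forall>x\<in>X. \<chi> x = \<psi> x"
      using stable[OF N'(1)] N'(2) \<psi> unfolding restr_def by blast
    have "lspan R M Z \<subseteq> N'" using lspan_minimal[OF sub[OF N'(1)]] N1(2) N'(2) by blast
    then show "\<exists>\<psi>'. linear_form R M (lspan R M Z) \<psi>' \<and> (\<forall>x\<in>X. \<psi>' x = \<psi> x)"
      using linear_form_mono[OF \<chi>(1)] \<chi>(2) by blast
  qed
  then show "\<exists>ps. (\<forall>y c. (y, c) \<in> set ps \<longrightarrow> y \<in> carrier M \<and> c \<in> stable_rows R M X) \<and>
      (\<forall>x\<in>X. coord_sum M ps x = x)"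
    using ps submodule_subset[OF sub[OF N(1)]] by (intro exI[of _ ps]) auto
qed

end

section \<open>Vanishing tensors and pairings with rows\<close>

text \<open>On representatives: the map that \<open>tensor_map\<close> induces on cosets.\<close>

definition induced :: "('a \<Rightarrow> 'b) \<Rightarrow> ('m \<times> 'a \<Rightarrow>\<^sub>0 int) \<Rightarrow> ('m \<times> 'b \<Rightarrow>\<^sub>0 int)"
  where "induced f = frag_extend (\<lambda>(x, a). frag_of (x, f a))"

lemma induced_simps [simp]:
  "induced f 0 = 0" "induced f (s - t) = induced f s - induced f t"
  "induced f (frag_of (x, a)) = frag_of (x, f a)"
  by (simp_all add: induced_def frag_extend_diff)

lemma keys_induced: "Poly_Mapping.keys (induced f t) \<subseteq> (\<lambda>(x, a). (x, f a)) ` Poly_Mapping.keys t"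
  using keys_frag_extend[of "\<lambda>(x, a). frag_of (x, f a)" t]
  unfolding induced_def by (fastforce simp: case_prod_unfold)

context
  fixes R :: "'r ring" and M :: "('r, 'm) module" and Q :: "('r, 'q) module"
  assumes M: "right_module R M" and Q: "left_module R Q"
begin

interpretation M: right_module R M by (rule M)
interpretation Q: left_module R Q by (rule Q)
interpretation sM: sided_module R M by (rule right_module_sided[OF M])
interpretation sQ: sided_module R Q by (rule left_module_sided[OF Q])
interpretation K: normal "tensor_kernel R M Q" "free_Abelian_group (carrier M \<times> carrier Q)"
  by (intro tensor_kernel_normal M.M.abelian_group_axioms Q.M.abelian_group_axioms
      M.smult_closed Q.smult_closed)

lemma tensor_kernel_keys: "t \<in> tensor_kernel R M Q \<Longrightarrow> Poly_Mapping.keys t \<subseteq> carrier M \<times> carrier Q"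
  using subsetD[OF K.subset, of t] by simp

lemma tensor_kernel_zero: "0 \<in> tensor_kernel R M Q"
  using subgroup.one_closed[OF K.subgroup_axioms] by simp

lemma tensor_kernel_add:
  "\<lbrakk>s \<in> tensor_kernel R M Q; t \<in> tensor_kernel R M Q\<rbrakk> \<Longrightarrow> s + t \<in> tensor_kernel R M Q"
  using subgroup.m_closed[OF K.subgroup_axioms, of s t] by simp

lemma tensor_kernel_uminus: "t \<in> tensor_kernel R M Q \<Longrightarrow> - t \<in> tensor_kernel R M Q"
  using subgroup.m_inv_closed[OF K.subgroup_axioms, of t] tensor_kernel_keys[of t] by simp

lemma tensor_kernel_diff:
  "\<lbrakk>s \<in> tensor_kernel R M Q; t \<in> tensor_kernel R M Q\<rbrakk> \<Longrightarrow> s - t \<in> tensor_kernel R M Q"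
  using tensor_kernel_add[of s "- t"] tensor_kernel_uminus[of t] by simp

lemma
  shows tensor_kernel_add_left: "\<lbrakk>x \<in> carrier M; y \<in> carrier M; q \<in> carrier Q\<rbrakk> \<Longrightarrow>
      frag_of (x \<oplus>\<^bsub>M\<^esub> y, q) - frag_of (x, q) - frag_of (y, q) \<in> tensor_kernel R M Q"
    and tensor_kernel_add_right: "\<lbrakk>x \<in> carrier M; p \<in> carrier Q; q \<in> carrier Q\<rbrakk> \<Longrightarrow>
      frag_of (x, p \<oplus>\<^bsub>Q\<^esub> q) - frag_of (x, p) - frag_of (x, q) \<in> tensor_kernel R M Q"
    and tensor_kernel_smult: "\<lbrakk>r \<in> carrier R; x \<in> carrier M; q \<in> carrier Q\<rbrakk> \<Longrightarrow>
      frag_of (r \<odot>\<^bsub>M\<^esub> x, q) - frag_of (x, r \<odot>\<^bsub>Q\<^esub> q) \<in> tensor_kernel R M Q"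
  unfolding tensor_kernel_def
  by (rule generate.incl, (unfold tensor_relations_def)[1], blast)+

lemma tensor_kernel_induct [consumes 1, case_names zero diff add_left add_right smult]:
  assumes t: "t \<in> tensor_kernel R M Q"
    and zero: "P 0"
    and diff: "\<And>s t. \<lbrakk>s \<in> tensor_kernel R M Q; t \<in> tensor_kernel R M Q; P s; P t\<rbrakk> \<Longrightarrow> P (s - t)"
    and "\<And>x y q. \<lbrakk>x \<in> carrier M; y \<in> carrier M; q \<in> carrier Q\<rbrakk> \<Longrightarrow>
      P (frag_of (x \<oplus>\<^bsub>M\<^esub> y, q) - frag_of (x, q) - frag_of (y, q))"
    and "\<And>x p q. \<lbrakk>x \<in> carrier M; p \<in> carrier Q; q \<in> carrier Q\<rbrakk> \<Longrightarrow>
      P (frag_of (x, p \<oplus>\<^bsub>Q\<^esub> q) - frag_of (x, p) - frag_of (x, q))"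
    and "\<And>r x q. \<lbrakk>r \<in> carrier R; x \<in> carrier M; q \<in> carrier Q\<rbrakk> \<Longrightarrow>
      P (frag_of (r \<odot>\<^bsub>M\<^esub> x, q) - frag_of (x, r \<odot>\<^bsub>Q\<^esub> q))"
  shows "P t"
proof -
  let ?F = "free_Abelian_group (carrier M \<times> carrier Q)"
  have rel: "P h" if "h \<in> tensor_relations R M Q" for h
    using that unfolding tensor_relations_def
    by (elim UnE CollectE exE conjE; hypsubst; intro assms(4-6)) assumption+
  have gen: "h \<in> tensor_kernel R M Q" if "h \<in> tensor_relations R M Q" for h
    unfolding tensor_kernel_def using that by (rule generate.incl)
  have "t \<in> tensor_kernel R M Q \<and> P t"
    using t unfolding tensor_kernel_def
  proof (induction rule: generate.induct)
    case one
    then show ?case using zero tensor_kernel_zero unfolding tensor_kernel_def by simp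
  next
    case (incl h)
    then show ?case using rel gen unfolding tensor_kernel_def by simp
  next
    case (inv h)
    have "inv\<^bsub>?F\<^esub> h = 0 - h" using tensor_kernel_keys[OF gen[OF inv]] by simp
    then show ?case
      using diff[OF tensor_kernel_zero gen[OF inv] zero rel[OF inv]]
        tensor_kernel_diff[OF tensor_kernel_zero gen[OF inv]] unfolding tensor_kernel_def by simp
  next
    case (eng a b)
    then have ab: "a \<in> tensor_kernel R M Q" "b \<in> tensor_kernel R M Q" "P a" "P b"
      unfolding tensor_kernel_def by auto
    have "P (a - (0 - b))"
      by (intro diff ab tensor_kernel_zero tensor_kernel_diff zero)
    then show ?case using tensor_kernel_add[OF ab(1,2)] unfolding tensor_kernel_def by simp
  qed
  then show ?thesis ..
qed

lemma tensor_kernel_zero_left: "q \<in> carrier Q \<Longrightarrow> frag_of (\<zero>\<^bsub>M\<^esub>, q) \<in> tensor_kernel R M Q"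
  using tensor_kernel_uminus[OF tensor_kernel_add_left[of "\<zero>\<^bsub>M\<^esub>" "\<zero>\<^bsub>M\<^esub>" q]] by simp

lemma tensor_kernel_zero_right: "x \<in> carrier M \<Longrightarrow> frag_of (x, \<zero>\<^bsub>Q\<^esub>) \<in> tensor_kernel R M Q"
  using tensor_kernel_uminus[OF tensor_kernel_add_right[of x "\<zero>\<^bsub>Q\<^esub>" "\<zero>\<^bsub>Q\<^esub>"]] by simp

lemma tensor_kernel_minus_right:
  assumes "x \<in> carrier M" "p \<in> carrier Q" "q \<in> carrier Q"
  shows "frag_of (x, p \<ominus>\<^bsub>Q\<^esub> q) - (frag_of (x, p) - frag_of (x, q)) \<in> tensor_kernel R M Q"
proof -
  have "p \<ominus>\<^bsub>Q\<^esub> q \<oplus>\<^bsub>Q\<^esub> q = p" using assms by (simp add: Q.M.minus_eq Q.M.a_assoc Q.M.l_neg)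
  then have "frag_of (x, p) - frag_of (x, p \<ominus>\<^bsub>Q\<^esub> q) - frag_of (x, q) \<in> tensor_kernel R M Q"
    using tensor_kernel_add_right[of x "p \<ominus>\<^bsub>Q\<^esub> q" q] assms by simp
  then have "- (frag_of (x, p) - frag_of (x, p \<ominus>\<^bsub>Q\<^esub> q) - frag_of (x, q)) \<in> tensor_kernel R M Q"
    by (rule tensor_kernel_uminus)
  then show ?thesis by (simp add: algebra_simps)
qed

end

text \<open>A relation in a tensor product has a finite certificate, and the certificate involves finitely
  many elements of both factors.\<close>

lemma tensor_kernel_finitary:
  fixes R :: "'r ring" and M :: "('r, 'm) module" and Q :: "('r, 'q) module"
  assumes M: "right_module R M" and Q: "left_module R Q" and t: "t \<in> tensor_kernel R M Q"
  obtains X Y where "finite X" "X \<subseteq> carrier M" "finite Y" "Y \<subseteq> carrier Q"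
    "\<And>N P. \<lbrakk>submodule N R M; submodule P R Q; X \<subseteq> N; Y \<subseteq> P\<rbrakk> \<Longrightarrow>
      t \<in> tensor_kernel R (M\<lparr>carrier := N\<rparr>) (Q\<lparr>carrier := P\<rparr>)"
proof -
  let ?K = "\<lambda>N P. tensor_kernel R (M\<lparr>carrier := N\<rparr>) (Q\<lparr>carrier := P\<rparr>)"
  note rel = submodule_as_right_module[OF M] submodule_as_left_module[OF Q]
  have "\<exists>X Y. finite X \<and> X \<subseteq> carrier M \<and> finite Y \<and> Y \<subseteq> carrier Q \<and>
    (\<forall>N P. submodule N R M \<longrightarrow> submodule P R Q \<longrightarrow> X \<subseteq> N \<longrightarrow> Y \<subseteq> P \<longrightarrow> t \<in> ?K N P)"
    using t
  proof (induction rule: tensor_kernel_induct[OF M Q,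
    consumes 1, case_names zero diff add_left add_right smult])
    case zero
    show ?case
      by (intro exI[of _ "{}"]) (simp add: tensor_kernel_zero[OF rel])
  next
    case (diff s t)
    then obtain X Y X' Y' where XY: "finite X" "X \<subseteq> carrier M" "finite Y" "Y \<subseteq> carrier Q"
      "finite X'" "X' \<subseteq> carrier M" "finite Y'" "Y' \<subseteq> carrier Q"
      "\<And>N P. \<lbrakk>submodule N R M; submodule P R Q; X \<subseteq> N; Y \<subseteq> P\<rbrakk> \<Longrightarrow> s \<in> ?K N P"
      "\<And>N P. \<lbrakk>submodule N R M; submodule P R Q; X' \<subseteq> N; Y' \<subseteq> P\<rbrakk> \<Longrightarrow> t \<in> ?K N P"
      by metis
    show ?case
      by (rule exI[of _ "X \<union> X'"], rule exI[of _ "Y \<union> Y'"])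
        (use XY in \<open>simp add: tensor_kernel_diff[OF rel]\<close>)
  next
    case (add_left x y q)
    then show ?case
      using tensor_kernel_add_left[OF rel]
      by (intro exI[of _ "{x, y}"] exI[of _ "{q}"]) simp
  next
    case (add_right x p q)
    then show ?case
      using tensor_kernel_add_right[OF rel]
      by (intro exI[of _ "{x}"] exI[of _ "{p, q}"]) simp
  next
    case (smult r x q)
    then show ?case
      using tensor_kernel_smult[OF rel]
      by (intro exI[of _ "{x}"] exI[of _ "{q}"]) simp
  qed
  then show ?thesis using that by auto
qed

definition additive_on :: "('r, 'q) module \<Rightarrow> 'x set \<Rightarrow> (('x \<Rightarrow>\<^sub>0 int) \<Rightarrow> 'q) \<Rightarrow> bool"
  where "additive_on A S h \<longleftrightarrow>
    (\<forall>t. Poly_Mapping.keys t \<subseteq> S \<longrightarrow> h t \<in> carrier A) \<and>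
    (\<forall>s t. Poly_Mapping.keys s \<subseteq> S \<longrightarrow> Poly_Mapping.keys t \<subseteq> S \<longrightarrow> h (s - t) = h s \<ominus>\<^bsub>A\<^esub> h t)"

lemma
  assumes "additive_on A S h"
  shows additive_on_closed: "Poly_Mapping.keys t \<subseteq> S \<Longrightarrow> h t \<in> carrier A"
    and additive_on_diff: "\<lbrakk>Poly_Mapping.keys s \<subseteq> S; Poly_Mapping.keys t \<subseteq> S\<rbrakk> \<Longrightarrow>
      h (s - t) = h s \<ominus>\<^bsub>A\<^esub> h t"
  using assms unfolding additive_on_def by simp_all

lemma additive_on_zero:
  assumes "abelian_group A" "additive_on A S h"
  shows "h 0 = \<zero>\<^bsub>A\<^esub>"
proof -
  interpret A: abelian_group A by fact
  show ?thesis
    using additive_on_diff[OF assms(2), of 0 0] additive_on_closed[OF assms(2), of 0]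
    by (simp add: A.minus_eq A.r_neg)
qed

lemma additive_on_plus:
  assumes A: "abelian_group A" and h: "additive_on A S h"
    and st: "Poly_Mapping.keys s \<subseteq> S" "Poly_Mapping.keys t \<subseteq> S"
  shows "h (s + t) = h s \<oplus>\<^bsub>A\<^esub> h t"
proof -
  interpret A: abelian_group A by (rule A)
  have k: "Poly_Mapping.keys (0 - t) \<subseteq> S" using st(2) by simp
  have "h (0 - t) = \<ominus>\<^bsub>A\<^esub> h t"
    using additive_on_diff[OF h _ st(2), of 0] additive_on_closed[OF h st(2)] additive_on_zero[OF A h]
    by (simp add: A.minus_eq)
  then show ?thesis
    using additive_on_diff[OF h st(1) k] additive_on_closed[OF h st(1)] additive_on_closed[OF h st(2)]
    by (simp add: A.minus_eq)
qed

lemma additive_on_diff3: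
  assumes "additive_on A S h" "a \<in> S" "b \<in> S" "c \<in> S"
  shows "h (frag_of a - frag_of b - frag_of c) = h (frag_of a) \<ominus>\<^bsub>A\<^esub> h (frag_of b) \<ominus>\<^bsub>A\<^esub> h (frag_of c)"
proof -
  have "Poly_Mapping.keys (frag_of a - frag_of b) \<subseteq> S"
    using keys_diff[of "frag_of a" "frag_of b"] assms by auto
  then show ?thesis using additive_on_diff[OF assms(1)] assms by simp
qed

lemma additive_extension:
  fixes A :: "('r, 'q) module"
  assumes A: "abelian_group A" and f: "f ` S \<subseteq> carrier A"
  obtains h where "additive_on A S h" "\<And>x. x \<in> S \<Longrightarrow> h (frag_of x) = f x"
proof -
  interpret A: abelian_group A by (rule A)
  obtain h where h: "h \<in> hom (free_Abelian_group S) (add_monoid A)" "\<And>x. x \<in> S \<Longrightarrow> h (frag_of x) = f x"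
    using comm_group.free_Abelian_group_universal[OF A.a_comm_group, of f S] f by auto
  have cl: "h t \<in> carrier A" if "Poly_Mapping.keys t \<subseteq> S" for t
    using h(1) that by (auto simp: hom_def)
  have add: "h (s + t) = h s \<oplus>\<^bsub>A\<^esub> h t" if "Poly_Mapping.keys s \<subseteq> S" "Poly_Mapping.keys t \<subseteq> S" for s t
    using h(1) that by (auto simp: hom_def)
  have "h (s - t) = h s \<ominus>\<^bsub>A\<^esub> h t" if st: "Poly_Mapping.keys s \<subseteq> S" "Poly_Mapping.keys t \<subseteq> S" for s t
  proof -
    have k: "Poly_Mapping.keys (s - t) \<subseteq> S" using keys_diff[of s t] st by blast
    have "h s = h (s - t) \<oplus>\<^bsub>A\<^esub> h t" using add[OF k st(2)] by simp
    then show ?thesis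
      using cl[OF k] cl[OF st(2)] by (simp add: A.minus_eq A.a_assoc A.r_neg)
  qed
  with cl have "additive_on A S h" unfolding additive_on_def by blast
  then show ?thesis using h(2) by (rule that)
qed

text \<open>A function \<open>c\<close> on \<open>X\<close> pairs \<open>x \<otimes> q\<close> to \<open>c(x) q\<close>.  This is a map on the free abelian group on
  \<open>X \<times> Q\<close>; it descends to the tensor product if \<open>c\<close> is a linear form on a submodule \<open>X\<close>.  For a mere row \<open>c\<close>
  the set \<open>X\<close> is just a finite set.\<close>

definition is_pairing ::
  "('r, 'q) module \<Rightarrow> 'm set \<Rightarrow> ('m \<Rightarrow> 'r) \<Rightarrow> (('m \<times> 'q \<Rightarrow>\<^sub>0 int) \<Rightarrow> 'q) \<Rightarrow> bool"
  where "is_pairing Q X c h \<longleftrightarrow> additive_on Q (X \<times> carrier Q) h \<and>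
    (\<forall>x\<in>X. \<forall>q\<in>carrier Q. h (frag_of (x, q)) = c x \<odot>\<^bsub>Q\<^esub> q)"

lemma
  assumes "is_pairing Q X c h"
  shows is_pairing_additive: "additive_on Q (X \<times> carrier Q) h"
    and is_pairing_closed: "Poly_Mapping.keys t \<subseteq> X \<times> carrier Q \<Longrightarrow> h t \<in> carrier Q"
    and is_pairing_zero: "abelian_group Q \<Longrightarrow> h 0 = \<zero>\<^bsub>Q\<^esub>"
    and is_pairing_diff: "\<lbrakk>Poly_Mapping.keys s \<subseteq> X \<times> carrier Q; Poly_Mapping.keys t \<subseteq> X \<times> carrier Q\<rbrakk> \<Longrightarrow>
      h (s - t) = h s \<ominus>\<^bsub>Q\<^esub> h t"
    and is_pairing_gen: "\<lbrakk>x \<in> X; q \<in> carrier Q\<rbrakk> \<Longrightarrow> h (frag_of (x, q)) = c x \<odot>\<^bsub>Q\<^esub> q"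
proof -
  show "additive_on Q (X \<times> carrier Q) h" using assms unfolding is_pairing_def by simp
  note * = additive_on_closed[OF this] additive_on_zero[OF _ this] additive_on_diff[OF this]
  show "Poly_Mapping.keys t \<subseteq> X \<times> carrier Q \<Longrightarrow> h t \<in> carrier Q"
    and "abelian_group Q \<Longrightarrow> h 0 = \<zero>\<^bsub>Q\<^esub>"
    and "\<lbrakk>Poly_Mapping.keys s \<subseteq> X \<times> carrier Q; Poly_Mapping.keys t \<subseteq> X \<times> carrier Q\<rbrakk> \<Longrightarrow>
      h (s - t) = h s \<ominus>\<^bsub>Q\<^esub> h t" by (fact *)+
  show "\<lbrakk>x \<in> X; q \<in> carrier Q\<rbrakk> \<Longrightarrow> h (frag_of (x, q)) = c x \<odot>\<^bsub>Q\<^esub> q"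
    using assms unfolding is_pairing_def by simp
qed

lemma pairing_exists:
  fixes R :: "'r ring" and Q :: "('r, 'q) module"
  assumes Q: "left_module R Q" and c: "\<And>x. x \<in> X \<Longrightarrow> c x \<in> carrier R"
  obtains h where "is_pairing Q X c h"
proof -
  interpret Q: left_module R Q by (rule Q)
  have "(\<lambda>(x, q). c x \<odot>\<^bsub>Q\<^esub> q) ` (X \<times> carrier Q) \<subseteq> carrier Q" using c Q.smult_closed by auto
  then have "\<exists>h. is_pairing Q X c h"
  proof (rule additive_extension[OF Q.M.abelian_group_axioms])
    fix h
    assume "additive_on Q (X \<times> carrier Q) h"
      "\<And>a. a \<in> X \<times> carrier Q \<Longrightarrow> h (frag_of a) = (case a of (x, q) \<Rightarrow> c x \<odot>\<^bsub>Q\<^esub> q)"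
    then show ?thesis unfolding is_pairing_def by (intro exI[of _ h]) simp
  qed
  then show ?thesis using that by blast
qed

lemma pairing_natural:
  fixes R :: "'r ring" and A :: "('r, 'a) module" and B :: "('r, 'b) module"
  assumes A: "left_module R A" and B: "left_module R B" and f: "f \<in> mod_hom R A B"
    and h: "is_pairing A X c h" and k: "is_pairing B Y d k"
    and c: "\<And>x. x \<in> X \<Longrightarrow> c x \<in> carrier R" "X \<subseteq> Y" "\<And>x. x \<in> X \<Longrightarrow> d x = c x"
    and t: "Poly_Mapping.keys t \<subseteq> X \<times> carrier A"
  shows "k (induced f t) = f (h t)"
proof -
  interpret A: sided_module R A by (rule left_module_sided[OF A])
  interpret B: sided_module R B by (rule left_module_sided[OF B])
  have keys: "Poly_Mapping.keys (induced f t) \<subseteq> Y \<times> carrier B" if "Poly_Mapping.keys t \<subseteq> X \<times> carrier A" for t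
  proof -
    have "(\<lambda>(x, a). (x, f a)) ` (X \<times> carrier A) \<subseteq> Y \<times> carrier B" using c(2) mod_hom_closed[OF f] by auto
    then show ?thesis using keys_induced[of f t] that by (meson image_mono order_trans)
  qed
  have fminus: "f (a \<ominus>\<^bsub>A\<^esub> b) = f a \<ominus>\<^bsub>B\<^esub> f b" if "a \<in> carrier A" "b \<in> carrier A" for a b
    using that mod_hom_smult[OF f, of "\<ominus>\<^bsub>R\<^esub> \<one>\<^bsub>R\<^esub>" b] A.smult_minus_one[OF that(2)]
      B.smult_minus_one[OF mod_hom_closed[OF f that(2)]] mod_hom_add[OF f, of a "\<ominus>\<^bsub>A\<^esub> b"]
    by (simp add: A.M.minus_eq B.M.minus_eq)
  from t show ?thesis
  proof (induction t rule: free_Abelian_group_induct[consumes 1, case_names zero diff gen])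
    case zero
    show ?case
      using is_pairing_zero[OF h A.M.abelian_group_axioms] is_pairing_zero[OF k B.M.abelian_group_axioms]
        mod_hom_zero[OF A.sided_module_axioms B.sided_module_axioms f] by simp
  next
    case (diff s t)
    then show ?case
      using is_pairing_diff[OF h diff(1,2)] is_pairing_diff[OF k keys[OF diff(1)] keys[OF diff(2)]]
        fminus[OF is_pairing_closed[OF h diff(1)] is_pairing_closed[OF h diff(2)]] by simp
  next
    case (gen a)
    then obtain x q where "a = (x, q)" "x \<in> X" "q \<in> carrier A" by auto
    then show ?case
      using is_pairing_gen[OF h] is_pairing_gen[OF k] c mod_hom_smult[OF f] mod_hom_closed[OF f] by auto
  qed
qed

lemma pairing_kills_tensor_kernel:
  fixes R :: "'r ring" and M :: "('r, 'm) module" and Q :: "('r, 'q) module"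
  assumes M: "right_module R M" and Q: "left_module R Q"
    and N: "submodule N R M" and \<psi>: "linear_form R M N \<psi>" and h: "is_pairing Q N \<psi> h"
    and t: "t \<in> tensor_kernel R (M\<lparr>carrier := N\<rparr>) Q"
  shows "h t = \<zero>\<^bsub>Q\<^esub>"
proof -
  interpret right_mod R M using M by (rule right_mod.intro)
  interpret Q: left_module R Q by (rule Q)
  note MN = submodule_as_right_module[OF M N]
  note diff3 = additive_on_diff3[OF is_pairing_additive[OF h]]
  have diff1: "h (frag_of a - frag_of b) = h (frag_of a) \<ominus>\<^bsub>Q\<^esub> h (frag_of b)"
    if "a \<in> N \<times> carrier Q" "b \<in> N \<times> carrier Q" for a b
    using is_pairing_diff[OF h] that by simp
  interpret sQ: sided_module R Q by (rule left_module_sided[OF Q])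
  note Nadd = submodule_add[OF N] and Nsm = submodule_smult[OF N]
  note \<psi>s = linear_form_closed[OF \<psi>] linear_form_add[OF \<psi>] linear_form_smult[OF \<psi>]
  from t show ?thesis
  proof (induction rule: tensor_kernel_induct[OF MN Q,
        consumes 1, case_names zero diff add_left add_right smult])
    case zero
    show ?case by (rule is_pairing_zero[OF h Q.M.abelian_group_axioms])
  next
    case (diff s t)
    then show ?case
      using is_pairing_diff[OF h, of s t] tensor_kernel_keys[OF MN Q diff(1)] tensor_kernel_keys[OF MN Q diff(2)]
      by (simp add: Q.M.minus_eq)
  next
    case (add_left x y q)
    then have "x \<in> N" "y \<in> N" "q \<in> carrier Q" by simp_all
    then show ?case
      by (simp add: diff3 Nadd is_pairing_gen[OF h] \<psi>s Q.smult_l_distr Q.smult_closed sQ.add_minus_both)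
  next
    case (add_right x p q)
    then have "x \<in> N" "p \<in> carrier Q" "q \<in> carrier Q" by simp_all
    then show ?case
      by (simp add: diff3 is_pairing_gen[OF h] \<psi>s Q.smult_r_distr Q.smult_closed sQ.add_minus_both)
  next
    case (smult r x q)
    then have "r \<in> carrier R" "x \<in> N" "q \<in> carrier Q" by simp_all
    then show ?case
      by (simp add: diff1 Nsm is_pairing_gen[OF h] \<psi>s Q.smult_assoc Q.smult_closed Q.M.minus_eq Q.M.r_neg)
  qed
qed

lemma pairing_unique:
  fixes R :: "'r ring" and Q :: "('r, 'q) module"
  assumes Q: "left_module R Q" and h: "is_pairing Q X c h" and k: "is_pairing Q Y d k"
    and c: "\<And>x. x \<in> X \<Longrightarrow> c x \<in> carrier R" "X \<subseteq> Y" "\<And>x. x \<in> X \<Longrightarrow> d x = c x"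
    and t: "Poly_Mapping.keys t \<subseteq> X \<times> carrier Q"
  shows "k t = h t"
proof -
  have "induced (\<lambda>q. q) t = t"
    unfolding induced_def using frag_expansion[of t] by (simp add: case_prod_unfold)
  then show ?thesis
    using pairing_natural[OF Q Q mod_hom_id h k c t] by simp
qed

context right_mod
begin

lemma is_right_module: "right_module R M" by unfold_locales

text \<open>The tensor vanishes over the span of some finite set \<open>Z\<close>, and a stable row is the restriction
  of a form on that span.\<close>

lemma stable_row_kills_tensor_kernel:
  fixes Q :: "('r, 'q) module"
  assumes Q: "left_module R Q" and X: "finite X" "X \<subseteq> carrier M"
    and c: "c \<in> stable_rows R M X" and h: "is_pairing Q X c h"
    and t: "Poly_Mapping.keys t \<subseteq> X \<times> carrier Q" "t \<in> tensor_kernel R M Q"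
  shows "h t = \<zero>\<^bsub>Q\<^esub>"
proof -
  interpret Q: sided_module R Q by (rule left_module_sided[OF Q])
  obtain F Y where F: "finite F" "F \<subseteq> carrier M" "Y \<subseteq> carrier Q"
    and fin: "\<And>N P. \<lbrakk>submodule N R M; submodule P R Q; F \<subseteq> N; Y \<subseteq> P\<rbrakk> \<Longrightarrow>
      t \<in> tensor_kernel R (M\<lparr>carrier := N\<rparr>) (Q\<lparr>carrier := P\<rparr>)"
    using tensor_kernel_finitary[OF is_right_module Q t(2)] by metis
  let ?Z = "X \<union> F"
  have Z: "finite ?Z" "X \<subseteq> ?Z" "?Z \<subseteq> carrier M" using X F by auto
  obtain \<psi> where \<psi>: "linear_form R M (lspan R M ?Z) \<psi>" "\<And>x. x \<in> X \<Longrightarrow> \<psi> x = c x"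
    using stable_rowsD[OF c Z] by metis
  note N = lspan_submodule[OF Z(3)]
  obtain k where k: "is_pairing Q (lspan R M ?Z) \<psi> k"
    using pairing_exists[OF Q, of "lspan R M ?Z" \<psi>] linear_form_closed[OF \<psi>(1)] by metis
  have "t \<in> tensor_kernel R (M\<lparr>carrier := lspan R M ?Z\<rparr>) (Q\<lparr>carrier := carrier Q\<rparr>)"
    by (rule fin[OF N Q.submodule_carrier]) (use lspan_incl[OF Z(3)] F(3) in auto)
  then have "k t = \<zero>\<^bsub>Q\<^esub>"
    using pairing_kills_tensor_kernel[OF is_right_module Q N \<psi>(1) k] by simp
  moreover have "k t = h t"
    by (rule pairing_unique[OF Q h k _ _ \<psi>(2) t(1)])
      (use stable_rows_closed[OF c X] lspan_incl[OF Z(3)] in auto)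
  ultimately show ?thesis by simp
qed

text \<open>Moving the coordinates of \<open>x\<close> to the other side gives
  \<open>x \<otimes> q = \<Sum> y\<^sub>b c\<^sub>b(x) \<otimes> q = \<Sum> y\<^sub>b \<otimes> c\<^sub>b(x) q\<close>, so a tensor is determined by its pairings with the
  coordinate rows.\<close>

lemma tensor_expansion:
  fixes Q :: "('r, 'q) module"
  assumes Q: "left_module R Q" and X: "X \<subseteq> carrier M"
    and ps: "\<And>y c. (y, c) \<in> set ps \<Longrightarrow> y \<in> carrier M \<and> (\<forall>x\<in>X. c x \<in> carrier R) \<and> is_pairing Q X c (h c)"
    and id: "\<And>x. x \<in> X \<Longrightarrow> coord_sum M ps x = x"
    and t: "Poly_Mapping.keys t \<subseteq> X \<times> carrier Q"
  shows "t - (\<Sum>(y, c)\<leftarrow>ps. frag_of (y, h c t)) \<in> tensor_kernel R M Q"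
proof -
  interpret Q: left_module R Q by (rule Q)
  note K = tensor_kernel_zero[OF is_right_module Q] tensor_kernel_add[OF is_right_module Q] tensor_kernel_diff[OF is_right_module Q]
    tensor_kernel_uminus[OF is_right_module Q]
  from t show ?thesis
  proof (induction t rule: free_Abelian_group_induct[consumes 1, case_names zero diff gen])
    case zero
    have "(\<Sum>(y, c)\<leftarrow>qs. frag_of (y, h c 0)) \<in> tensor_kernel R M Q" if "set qs \<subseteq> set ps" for qs
      using that
    proof (induction qs)
      case (Cons q qs)
      obtain y c where q: "q = (y, c)" by (cases q)
      then have "y \<in> carrier M" "h c 0 = \<zero>\<^bsub>Q\<^esub>" using ps[of y c] Cons.prems is_pairing_zero[OF _ Q.M.abelian_group_axioms] by auto
      then have "frag_of (y, h c 0) \<in> tensor_kernel R M Q"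
        using tensor_kernel_zero_right[OF is_right_module Q] by simp
      then show ?case using Cons q K(2) by simp
    qed (simp add: K)
    then show ?case using K(4) by force
  next
    case (diff s t)
    have "(\<Sum>(y, c)\<leftarrow>qs. frag_of (y, h c (s - t))) -
        ((\<Sum>(y, c)\<leftarrow>qs. frag_of (y, h c s)) - (\<Sum>(y, c)\<leftarrow>qs. frag_of (y, h c t))) \<in> tensor_kernel R M Q"
      (is "?D qs \<in> _") if "set qs \<subseteq> set ps" for qs
      using that
    proof (induction qs)
      case (Cons q qs)
      obtain y c where q: "q = (y, c)" by (cases q)
      then have y: "y \<in> carrier M" and h: "is_pairing Q X c (h c)" using ps[of y c] Cons.prems by auto
      have "frag_of (y, h c (s - t)) - (frag_of (y, h c s) - frag_of (y, h c t)) \<in> tensor_kernel R M Q"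
        unfolding is_pairing_diff[OF h diff(1,2)]
        by (rule tensor_kernel_minus_right[OF is_right_module Q y is_pairing_closed[OF h diff(1)] is_pairing_closed[OF h diff(2)]])
      moreover have "?D qs \<in> tensor_kernel R M Q" using Cons by simp
      ultimately have "frag_of (y, h c (s - t)) - (frag_of (y, h c s) - frag_of (y, h c t)) + ?D qs \<in> tensor_kernel R M Q"
        by (rule K(2))
      then show ?case by (simp add: q algebra_simps)
    qed (simp add: K)
    from K(3)[OF K(3)[OF diff(3,4)] this[OF subset_refl]] show ?case by (simp add: algebra_simps)
  next
    case (gen a)
    then obtain x q where a: "a = (x, q)" and x: "x \<in> X" and q: "q \<in> carrier Q" by auto
    have "frag_of (coord_sum M qs x, q) - (\<Sum>(y, c)\<leftarrow>qs. frag_of (y, h c (frag_of a))) \<in> tensor_kernel R M Q"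
      (is "?D qs \<in> _") if "set qs \<subseteq> set ps" for qs
      using that
    proof (induction qs)
      case Nil
      then show ?case using tensor_kernel_zero_left[OF is_right_module Q q] by simp
    next
      case (Cons p qs)
      obtain y c where p: "p = (y, c)" by (cases p)
      then have y: "y \<in> carrier M" and c: "c x \<in> carrier R" and h: "is_pairing Q X c (h c)"
        using ps[of y c] Cons.prems x by auto
      have cs: "coord_sum M qs x \<in> carrier M"
        by (rule coord_sum_closed) (use ps Cons.prems x in auto)
      have "frag_of (c x \<odot>\<^bsub>M\<^esub> y \<oplus>\<^bsub>M\<^esub> coord_sum M qs x, q) - frag_of (c x \<odot>\<^bsub>M\<^esub> y, q) - frag_of (coord_sum M qs x, q)
          \<in> tensor_kernel R M Q"
        by (rule tensor_kernel_add_left[OF is_right_module Q smult_closed[OF c y] cs q])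
      moreover have "frag_of (c x \<odot>\<^bsub>M\<^esub> y, q) - frag_of (y, h c (frag_of a)) \<in> tensor_kernel R M Q"
        using tensor_kernel_smult[OF is_right_module Q c y q] is_pairing_gen[OF h x q] a by simp
      moreover have "?D qs \<in> tensor_kernel R M Q" using Cons by simp
      ultimately have "(frag_of (c x \<odot>\<^bsub>M\<^esub> y \<oplus>\<^bsub>M\<^esub> coord_sum M qs x, q) - frag_of (c x \<odot>\<^bsub>M\<^esub> y, q) - frag_of (coord_sum M qs x, q))
          + (frag_of (c x \<odot>\<^bsub>M\<^esub> y, q) - frag_of (y, h c (frag_of a))) + ?D qs \<in> tensor_kernel R M Q"
        by (intro K(2))
      then show ?case by (simp add: p algebra_simps)
    qed
    from this[OF subset_refl] show ?case using id[OF x] a by simp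
  qed
qed

lemma tensor_zero_if_pairings_zero:
  fixes Q :: "('r, 'q) module"
  assumes Q: "left_module R Q" and X: "X \<subseteq> carrier M"
    and ps: "\<And>y c. (y, c) \<in> set ps \<Longrightarrow> y \<in> carrier M \<and> (\<forall>x\<in>X. c x \<in> carrier R)"
    and id: "\<And>x. x \<in> X \<Longrightarrow> coord_sum M ps x = x"
    and t: "Poly_Mapping.keys t \<subseteq> X \<times> carrier Q"
    and zero: "\<And>y c h. \<lbrakk>(y, c) \<in> set ps; is_pairing Q X c h\<rbrakk> \<Longrightarrow> h t = \<zero>\<^bsub>Q\<^esub>"
  shows "t \<in> tensor_kernel R M Q"
proof -
  have "\<exists>h. (\<forall>x\<in>X. c x \<in> carrier R) \<longrightarrow> is_pairing Q X c h" for c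
    using pairing_exists[OF Q, of X c] by metis
  then obtain h where h: "\<And>c. (\<forall>x\<in>X. c x \<in> carrier R) \<Longrightarrow> is_pairing Q X c (h c)" by metis
  have K: "t - (\<Sum>(y, c)\<leftarrow>ps. frag_of (y, h c t)) \<in> tensor_kernel R M Q"
    by (rule tensor_expansion[OF Q X _ id t]) (use ps h in auto)
  have "(\<Sum>(y, c)\<leftarrow>qs. frag_of (y, h c t)) \<in> tensor_kernel R M Q" if "set qs \<subseteq> set ps" for qs
    using that
  proof (induction qs)
    case (Cons q qs)
    obtain y c where q: "q = (y, c)" by (cases q)
    have yc: "(y, c) \<in> set ps" using q Cons.prems by auto
    have "y \<in> carrier M" "h c t = \<zero>\<^bsub>Q\<^esub>" using ps[OF yc] zero[OF yc h] by auto
    then have "frag_of (y, h c t) \<in> tensor_kernel R M Q"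
      using tensor_kernel_zero_right[OF is_right_module Q] by simp
    then show ?case using Cons q tensor_kernel_add[OF is_right_module Q] by simp
  qed (simp add: tensor_kernel_zero[OF is_right_module Q])
  from tensor_kernel_add[OF is_right_module Q K this[OF subset_refl]] show ?thesis by simp
qed

text \<open>Expand \<open>t\<close> along stable coordinates of the finitely many elements of \<open>M\<close> that occur in it.
  Together with \<open>stable_row_kills_tensor_kernel\<close>, a tensor vanishes if and only if all stable rows
  pair it to zero.\<close>

lemma tensor_zero_criterion:
  fixes Q :: "('r, 'q) module"
  assumes M: "stably_coordinatized R M (carrier M)" and Q: "left_module R Q"
    and t: "Poly_Mapping.keys t \<subseteq> carrier M \<times> carrier Q"
    and zero: "\<And>X c h. \<lbrakk>finite X; X \<subseteq> carrier M; Poly_Mapping.keys t \<subseteq> X \<times> carrier Q;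
      c \<in> stable_rows R M X; is_pairing Q X c h\<rbrakk> \<Longrightarrow> h t = \<zero>\<^bsub>Q\<^esub>"
  shows "t \<in> tensor_kernel R M Q"
proof -
  let ?X = "fst ` Poly_Mapping.keys t"
  have X: "finite ?X" "?X \<subseteq> carrier M" "Poly_Mapping.keys t \<subseteq> ?X \<times> carrier Q" using t by force+
  obtain ps where ps: "\<And>y c. (y, c) \<in> set ps \<Longrightarrow> y \<in> carrier M \<and> c \<in> stable_rows R M ?X"
    "\<And>x. x \<in> ?X \<Longrightarrow> coord_sum M ps x = x"
    using stably_coordinatizedE[OF M X(1,2)] by metis
  show ?thesis
  proof (rule tensor_zero_if_pairings_zero[OF Q X(2) _ ps(2) X(3)])
    show "y \<in> carrier M \<and> (\<forall>x\<in>?X. c x \<in> carrier R)" if "(y, c) \<in> set ps" for y c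
      using ps(1)[OF that] stable_rows_closed[OF _ X(1,2)] by auto
    show "h t = \<zero>\<^bsub>Q\<^esub>" if "(y, c) \<in> set ps" "is_pairing Q ?X c h" for y c h
      using ps(1)[OF that(1)] zero[OF X _ that(2)] by blast
  qed
qed

end

section \<open>Stable coordinates imply flat and Mittag-Leffler\<close>

lemma prod_module_simps [simp]:
  "carrier (prod_module I Q) = (\<Pi>\<^sub>E i\<in>I. carrier (Q i))"
  "\<zero>\<^bsub>prod_module I Q\<^esub> = (\<lambda>i\<in>I. \<zero>\<^bsub>Q i\<^esub>)"
  "x \<oplus>\<^bsub>prod_module I Q\<^esub> y = (\<lambda>i\<in>I. x i \<oplus>\<^bsub>Q i\<^esub> y i)"
  "r \<odot>\<^bsub>prod_module I Q\<^esub> x = (\<lambda>i\<in>I. r \<odot>\<^bsub>Q i\<^esub> x i)"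
  by (simp_all add: prod_module_def)

lemma left_module_prod_module:
  fixes R :: "'r ring" and Q :: "'i \<Rightarrow> ('r, 'q) module"
  assumes R: "ring R" and Q: "\<And>i. i \<in> I \<Longrightarrow> left_module R (Q i)"
  shows "left_module R (prod_module I Q)"
proof -
  have grp: "abelian_group (Q i)" if "i \<in> I" for i
    using Q[OF that] by (simp add: left_module_def)
  have sm: "r \<odot>\<^bsub>Q i\<^esub> x \<in> carrier (Q i)" if "i \<in> I" "r \<in> carrier R" "x \<in> carrier (Q i)" for i r x
    using left_module.smult_closed[OF Q[OF that(1)]] that by blast
  have ext: "(\<lambda>i\<in>I. x i) = x" if "x \<in> (\<Pi>\<^sub>E i\<in>I. carrier (Q i))" for x
    using that by (auto simp: PiE_iff extensional_restrict)
  have mem: "x i \<in> carrier (Q i)" if "x \<in> (\<Pi>\<^sub>E i\<in>I. carrier (Q i))" "i \<in> I" for x i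
    using that by auto
  have "abelian_group (prod_module I Q)"
  proof (rule abelian_groupI)
    fix x assume x: "x \<in> carrier (prod_module I Q)"
    then have xc: "x i \<in> carrier (Q i)" if "i \<in> I" for i using that by auto
    have "(\<lambda>i\<in>I. \<ominus>\<^bsub>Q i\<^esub> x i) \<in> carrier (prod_module I Q)"
      using abelian_group.a_inv_closed[OF grp] xc by auto
    moreover have "(\<lambda>i\<in>I. \<ominus>\<^bsub>Q i\<^esub> x i) \<oplus>\<^bsub>prod_module I Q\<^esub> x = \<zero>\<^bsub>prod_module I Q\<^esub>"
      using abelian_group.l_neg[OF grp] xc by (auto intro!: restrict_ext)
    ultimately show "\<exists>y\<in>carrier (prod_module I Q). y \<oplus>\<^bsub>prod_module I Q\<^esub> x = \<zero>\<^bsub>prod_module I Q\<^esub>" by blast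
    have "\<zero>\<^bsub>prod_module I Q\<^esub> \<oplus>\<^bsub>prod_module I Q\<^esub> x = (\<lambda>i\<in>I. x i)"
      using abelian_monoid.l_zero[OF abelian_group.axioms(1)[OF grp]] xc by (auto intro!: restrict_ext)
    then show "\<zero>\<^bsub>prod_module I Q\<^esub> \<oplus>\<^bsub>prod_module I Q\<^esub> x = x" using ext x by simp
  next
    show "\<zero>\<^bsub>prod_module I Q\<^esub> \<in> carrier (prod_module I Q)"
      using abelian_monoid.zero_closed[OF abelian_group.axioms(1)[OF grp]] by auto
  next
    fix x y assume xy: "x \<in> carrier (prod_module I Q)" "y \<in> carrier (prod_module I Q)"
    then have xc: "x i \<in> carrier (Q i)" and yc: "y i \<in> carrier (Q i)" if "i \<in> I" for i using that by auto
    show "x \<oplus>\<^bsub>prod_module I Q\<^esub> y \<in> carrier (prod_module I Q)"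
      using abelian_monoid.a_closed[OF abelian_group.axioms(1)[OF grp]] xc yc by auto
    show "x \<oplus>\<^bsub>prod_module I Q\<^esub> y = y \<oplus>\<^bsub>prod_module I Q\<^esub> x"
      using abelian_monoid.a_comm[OF abelian_group.axioms(1)[OF grp]] xc yc by (auto intro!: restrict_ext)
    fix z assume "z \<in> carrier (prod_module I Q)"
    then have zc: "z i \<in> carrier (Q i)" if "i \<in> I" for i using that by auto
    show "x \<oplus>\<^bsub>prod_module I Q\<^esub> y \<oplus>\<^bsub>prod_module I Q\<^esub> z = x \<oplus>\<^bsub>prod_module I Q\<^esub> (y \<oplus>\<^bsub>prod_module I Q\<^esub> z)"
      using abelian_monoid.a_assoc[OF abelian_group.axioms(1)[OF grp]] xc yc zc by (auto intro!: restrict_ext)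
  qed
  moreover have "\<one>\<^bsub>R\<^esub> \<odot>\<^bsub>prod_module I Q\<^esub> x = x" if x: "x \<in> carrier (prod_module I Q)" for x
  proof -
    have "\<one>\<^bsub>R\<^esub> \<odot>\<^bsub>prod_module I Q\<^esub> x = (\<lambda>i\<in>I. x i)"
      unfolding prod_module_simps
      by (rule restrict_ext) (use x left_module.smult_one[OF Q] in auto)
    then show ?thesis using ext x by simp
  qed
  ultimately show ?thesis
    using R
    by (intro left_module.intro left_module_axioms.intro)
      (auto simp: sm left_module.smult_l_distr[OF Q] left_module.smult_r_distr[OF Q]
        left_module.smult_assoc[OF Q] mem intro!: restrict_ext)
qed

lemma projection_mod_hom: "i \<in> I \<Longrightarrow> (\<lambda>q. q i) \<in> mod_hom R (prod_module I Q) (Q i)"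
  by (rule mod_homI) auto

lemma rcos_eq_iff:
  assumes "K \<lhd> free_Abelian_group S" "Poly_Mapping.keys s \<subseteq> S" "Poly_Mapping.keys t \<subseteq> S"
  shows "K #>\<^bsub>free_Abelian_group S\<^esub> s = K #>\<^bsub>free_Abelian_group S\<^esub> t \<longleftrightarrow> s - t \<in> K"
proof -
  interpret K: normal K "free_Abelian_group S" by fact
  have "s \<in> K #>\<^bsub>free_Abelian_group S\<^esub> t \<longleftrightarrow> s - t \<in> K"
    by (auto simp: r_coset_def diff_eq_eq) (metis diff_add_cancel)
  moreover have "K #>\<^bsub>free_Abelian_group S\<^esub> s = K #>\<^bsub>free_Abelian_group S\<^esub> t \<longleftrightarrow> s \<in> K #>\<^bsub>free_Abelian_group S\<^esub> t"
  proof
    assume "K #>\<^bsub>free_Abelian_group S\<^esub> s = K #>\<^bsub>free_Abelian_group S\<^esub> t"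
    then show "s \<in> K #>\<^bsub>free_Abelian_group S\<^esub> t"
      using K.rcos_self[OF _ K.subgroup_axioms, of s] assms(2) by simp
  next
    assume "s \<in> K #>\<^bsub>free_Abelian_group S\<^esub> t"
    then show "K #>\<^bsub>free_Abelian_group S\<^esub> s = K #>\<^bsub>free_Abelian_group S\<^esub> t"
      using K.repr_independence[OF _ _ K.subgroup_axioms, of s t] assms(3) by simp
  qed
  ultimately show ?thesis by simp
qed

text \<open>Both canonical maps in the definitions of flat and Mittag-Leffler modules are defined on cosets;
  this reduces their injectivity to a statement about representatives.\<close>

lemma inj_on_cosets_iff:
  assumes K: "K \<lhd> free_Abelian_group S"
    and eq: "\<And>s t. \<lbrakk>Poly_Mapping.keys s \<subseteq> S; Poly_Mapping.keys t \<subseteq> S\<rbrakk> \<Longrightarrow>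
      \<phi> (K #>\<^bsub>free_Abelian_group S\<^esub> s) = \<phi> (K #>\<^bsub>free_Abelian_group S\<^esub> t) \<longleftrightarrow> P (s - t)"
  shows "inj_on \<phi> (carrier (free_Abelian_group S Mod K)) \<longleftrightarrow>
    (\<forall>t. Poly_Mapping.keys t \<subseteq> S \<and> P t \<longrightarrow> t \<in> K)"
proof -
  let ?c = "\<lambda>t. K #>\<^bsub>free_Abelian_group S\<^esub> t"
  have carr: "carrier (free_Abelian_group S Mod K) = {?c t | t. Poly_Mapping.keys t \<subseteq> S}"
    by (auto simp: carrier_FactGroup)
  show ?thesis
  proof (intro iffI allI impI)
    fix t assume inj: "inj_on \<phi> (carrier (free_Abelian_group S Mod K))"
      and t: "Poly_Mapping.keys t \<subseteq> S \<and> P t"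
    have "?c t = ?c 0"
      by (rule inj_onD[OF inj]) (use eq[of t 0] t carr in auto)
    then show "t \<in> K" using rcos_eq_iff[OF K, of t 0] t by simp
  next
    assume ker: "\<forall>t. Poly_Mapping.keys t \<subseteq> S \<and> P t \<longrightarrow> t \<in> K"
    show "inj_on \<phi> (carrier (free_Abelian_group S Mod K))"
    proof (rule inj_onI)
      fix U V assume "U \<in> carrier (free_Abelian_group S Mod K)" "V \<in> carrier (free_Abelian_group S Mod K)"
        and UV: "\<phi> U = \<phi> V"
      then obtain s t where s: "U = ?c s" "Poly_Mapping.keys s \<subseteq> S" and t: "V = ?c t" "Poly_Mapping.keys t \<subseteq> S"
        unfolding carr by blast
      have "P (s - t)" using eq[OF s(2) t(2)] UV s(1) t(1) by simp
      moreover have "Poly_Mapping.keys (s - t) \<subseteq> S" using keys_diff[of s t] s(2) t(2) by blast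
      ultimately show "U = V"
        unfolding s(1) t(1) using rcos_eq_iff[OF K s(2) t(2)] ker by blast
    qed
  qed
qed

context right_mod
begin

lemma tensor_kernel_normal': "left_module R Q \<Longrightarrow>
    tensor_kernel R M Q \<lhd> free_Abelian_group (carrier M \<times> carrier Q)" for Q :: "('r, 'q) module"
  by (rule tensor_kernel_normal)
    (auto simp: left_module_def left_module_axioms_def smult_closed M.abelian_group_axioms)

lemma tensor_map_coset_induced:
  fixes A :: "('r, 'a) module" and B :: "('r, 'b) module"
  assumes "left_module R A" "left_module R B" "f \<in> mod_hom R A B"
    and "Poly_Mapping.keys t \<subseteq> carrier M \<times> carrier A"
  shows "Poly_Mapping.keys (induced f t) \<subseteq> carrier M \<times> carrier B"
    and "tensor_map R M A B f (tensor_kernel R M A #>\<^bsub>free_Abelian_group (carrier M \<times> carrier A)\<^esub> t) =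
      tensor_kernel R M B #>\<^bsub>free_Abelian_group (carrier M \<times> carrier B)\<^esub> induced f t"
  using tensor_map_coset[OF is_right_module assms(1-3), of t] assms(4) by (simp_all add: induced_def)

lemma inj_tensor_map_iff:
  fixes A :: "('r, 'a) module" and B :: "('r, 'b) module"
  assumes A: "left_module R A" and B: "left_module R B" and f: "f \<in> mod_hom R A B"
  shows "inj_on (tensor_map R M A B f) (carrier (tensor R M A)) \<longleftrightarrow>
    (\<forall>t. Poly_Mapping.keys t \<subseteq> carrier M \<times> carrier A \<and> induced f t \<in> tensor_kernel R M B \<longrightarrow>
      t \<in> tensor_kernel R M A)"
  unfolding tensor_def
proof (rule inj_on_cosets_iff[OF tensor_kernel_normal'[OF A]])
  fix s t :: "'m \<times> 'a \<Rightarrow>\<^sub>0 int"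
  assume st: "Poly_Mapping.keys s \<subseteq> carrier M \<times> carrier A" "Poly_Mapping.keys t \<subseteq> carrier M \<times> carrier A"
  note ind = tensor_map_coset_induced[OF A B f]
  show "tensor_map R M A B f (tensor_kernel R M A #>\<^bsub>free_Abelian_group (carrier M \<times> carrier A)\<^esub> s) =
      tensor_map R M A B f (tensor_kernel R M A #>\<^bsub>free_Abelian_group (carrier M \<times> carrier A)\<^esub> t) \<longleftrightarrow>
      induced f (s - t) \<in> tensor_kernel R M B"
    unfolding ind(2)[OF st(1)] ind(2)[OF st(2)] induced_simps
    by (rule rcos_eq_iff[OF tensor_kernel_normal'[OF B] ind(1)[OF st(1)] ind(1)[OF st(2)]])
qed

lemma inj_tensor_prod_map_iff:
  fixes Q :: "'i \<Rightarrow> ('r, 'q) module"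
  assumes Q: "\<And>i. i \<in> I \<Longrightarrow> left_module R (Q i)"
  shows "inj_on (tensor_prod_map R M I Q) (carrier (tensor R M (prod_module I Q))) \<longleftrightarrow>
    (\<forall>t. Poly_Mapping.keys t \<subseteq> carrier M \<times> carrier (prod_module I Q) \<and>
      (\<forall>i\<in>I. induced (\<lambda>q. q i) t \<in> tensor_kernel R M (Q i)) \<longrightarrow> t \<in> tensor_kernel R M (prod_module I Q))"
proof -
  let ?P = "prod_module I Q"
  let ?F = "free_Abelian_group (carrier M \<times> carrier ?P)"
  have P: "left_module R ?P" by (rule left_module_prod_module[OF R.ring_axioms Q])
  have eq: "tensor_prod_map R M I Q (tensor_kernel R M ?P #>\<^bsub>?F\<^esub> s) =
      tensor_prod_map R M I Q (tensor_kernel R M ?P #>\<^bsub>?F\<^esub> t) \<longleftrightarrow>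
      (\<forall>i\<in>I. induced (\<lambda>q. q i) (s - t) \<in> tensor_kernel R M (Q i))"
    if st: "Poly_Mapping.keys s \<subseteq> carrier M \<times> carrier ?P" "Poly_Mapping.keys t \<subseteq> carrier M \<times> carrier ?P" for s t
  proof -
    have "tensor_map R M ?P (Q i) (\<lambda>q. q i) (tensor_kernel R M ?P #>\<^bsub>?F\<^esub> s) =
      tensor_map R M ?P (Q i) (\<lambda>q. q i) (tensor_kernel R M ?P #>\<^bsub>?F\<^esub> t) \<longleftrightarrow>
      induced (\<lambda>q. q i) (s - t) \<in> tensor_kernel R M (Q i)" if i: "i \<in> I" for i
    proof -
      have pr: "(\<lambda>q. q i) \<in> mod_hom R ?P (Q i)" by (rule projection_mod_hom[OF i])
      note ind = tensor_map_coset_induced[OF P Q[OF i] pr]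
      have "tensor_map R M ?P (Q i) (\<lambda>q. q i) (tensor_kernel R M ?P #>\<^bsub>?F\<^esub> u) =
          tensor_kernel R M (Q i) #>\<^bsub>free_Abelian_group (carrier M \<times> carrier (Q i))\<^esub> induced (\<lambda>q. q i) u"
        if "Poly_Mapping.keys u \<subseteq> carrier M \<times> carrier ?P" for u
        by (rule ind(2)) (use that in auto)
      then show ?thesis
        using rcos_eq_iff[OF tensor_kernel_normal'[OF Q[OF i]] ind(1) ind(1), of s t] st by simp
    qed
    then show ?thesis unfolding tensor_prod_map_def by (auto simp: fun_eq_iff restrict_def)
  qed
  show ?thesis
    unfolding tensor_def by (rule inj_on_cosets_iff[OF tensor_kernel_normal'[OF P]]) (rule eq)
qed

text \<open>The pairing of a row with \<open>f(t)\<close> is \<open>f\<close> of its pairing with \<open>t\<close>, and \<open>f\<close> is injective.\<close>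

lemma stably_coordinatized_imp_flat:
  assumes M: "stably_coordinatized R M (carrier M)"
  shows "flat_module TYPE('q) R M"
  unfolding flat_module_def
proof (intro allI impI)
  fix A B :: "('r, 'q) module" and f
  assume "left_module R A \<and> left_module R B \<and> f \<in> mod_hom R A B \<and> inj_on f (carrier A)"
  then have A: "left_module R A" and B: "left_module R B" and f: "f \<in> mod_hom R A B"
    and inj: "inj_on f (carrier A)" by auto
  interpret A: sided_module R A by (rule left_module_sided[OF A])
  interpret B: sided_module R B by (rule left_module_sided[OF B])
  show "inj_on (tensor_map R M A B f) (carrier (tensor R M A))"
    unfolding inj_tensor_map_iff[OF A B f]
  proof (intro allI impI)
    fix t assume t: "Poly_Mapping.keys t \<subseteq> carrier M \<times> carrier A \<and> induced f t \<in> tensor_kernel R M B"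
    show "t \<in> tensor_kernel R M A"
    proof (rule tensor_zero_criterion[OF M A])
      show "Poly_Mapping.keys t \<subseteq> carrier M \<times> carrier A" using t by simp
      fix X c h assume X: "finite X" "X \<subseteq> carrier M" "Poly_Mapping.keys t \<subseteq> X \<times> carrier A"
        and c: "c \<in> stable_rows R M X" and h: "is_pairing A X c h"
      obtain k where k: "is_pairing B X c k"
        using pairing_exists[OF B, of X c] stable_rows_closed[OF c X(1,2)] by metis
      have "(\<lambda>(x, a). (x, f a)) ` (X \<times> carrier A) \<subseteq> X \<times> carrier B" using mod_hom_closed[OF f] by auto
      then have keys: "Poly_Mapping.keys (induced f t) \<subseteq> X \<times> carrier B"
        using keys_induced[of f t] X(3) by (meson image_mono order_trans)
      have "f (h t) = k (induced f t)"
        using pairing_natural[OF A B f h k _ _ _ X(3)] stable_rows_closed[OF c X(1,2)] by simp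
      also have "\<dots> = \<zero>\<^bsub>B\<^esub>"
        by (rule stable_row_kills_tensor_kernel[OF B X(1,2) c k keys]) (use t in simp)
      also have "\<dots> = f \<zero>\<^bsub>A\<^esub>" using mod_hom_zero[OF A.sided_module_axioms B.sided_module_axioms f] by simp
      finally show "h t = \<zero>\<^bsub>A\<^esub>"
        using inj_onD[OF inj] is_pairing_closed[OF h X(3)] by simp
    qed
  qed
qed

text \<open>The pairing of a row with \<open>t\<close> is an element of the product whose components are the pairings with
  the components of \<open>t\<close>.\<close>

lemma stably_coordinatized_imp_mittag_leffler:
  assumes M: "stably_coordinatized R M (carrier M)"
  shows "mittag_leffler TYPE('i) TYPE('q) R M"
  unfolding mittag_leffler_def
proof (intro allI impI)
  fix I :: "'i set" and Q :: "'i \<Rightarrow> ('r, 'q) module"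
  assume "\<forall>i\<in>I. left_module R (Q i)"
  then have Q: "left_module R (Q i)" if "i \<in> I" for i using that by simp
  have P: "left_module R (prod_module I Q)" by (rule left_module_prod_module[OF R.ring_axioms Q])
  show "inj_on (tensor_prod_map R M I Q) (carrier (tensor R M (prod_module I Q)))"
  proof (rule iffD2[OF inj_tensor_prod_map_iff], erule Q, intro allI impI)
    fix t assume t: "Poly_Mapping.keys t \<subseteq> carrier M \<times> carrier (prod_module I Q) \<and>
      (\<forall>i\<in>I. induced (\<lambda>q. q i) t \<in> tensor_kernel R M (Q i))"
    show "t \<in> tensor_kernel R M (prod_module I Q)"
    proof (rule tensor_zero_criterion[OF M P])
      show "Poly_Mapping.keys t \<subseteq> carrier M \<times> carrier (prod_module I Q)" using t by simp
      fix X c h assume X: "finite X" "X \<subseteq> carrier M" "Poly_Mapping.keys t \<subseteq> X \<times> carrier (prod_module I Q)"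
        and c: "c \<in> stable_rows R M X" and h: "is_pairing (prod_module I Q) X c h"
      have "h t i = \<zero>\<^bsub>Q i\<^esub>" if i: "i \<in> I" for i
      proof -
        obtain k where k: "is_pairing (Q i) X c k"
          using pairing_exists[OF Q[OF i], of X c] stable_rows_closed[OF c X(1,2)] by metis
        have "(\<lambda>(x, a). (x, a i)) ` (X \<times> carrier (prod_module I Q)) \<subseteq> X \<times> carrier (Q i)" using i by auto
        then have keys: "Poly_Mapping.keys (induced (\<lambda>q. q i) t) \<subseteq> X \<times> carrier (Q i)"
          using keys_induced[of "\<lambda>q. q i" t] X(3) by (meson image_mono order_trans)
        have pr: "(\<lambda>q. q i) \<in> mod_hom R (prod_module I Q) (Q i)" by (rule projection_mod_hom[OF i])
        have "h t i = k (induced (\<lambda>q. q i) t)"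
          using pairing_natural[OF P Q[OF i] pr h k _ _ _ X(3)]
            stable_rows_closed[OF c X(1,2)] by simp
        also have "\<dots> = \<zero>\<^bsub>Q i\<^esub>"
          by (rule stable_row_kills_tensor_kernel[OF Q[OF i] X(1,2) c k keys]) (use t i in simp)
        finally show ?thesis .
      qed
      moreover have "h t \<in> (\<Pi>\<^sub>E i\<in>I. carrier (Q i))" using is_pairing_closed[OF h X(3)] by simp
      ultimately show "h t = \<zero>\<^bsub>prod_module I Q\<^esub>"
        by (auto simp: fun_eq_iff PiE_iff extensional_def)
    qed
  qed
qed

end

section \<open>Quotients on a given type\<close>

lemma card_of_lists_le:
  assumes inf: "infinite (UNIV :: 'u set)" and A: "|A| \<le>o |UNIV :: 'u set|"
  shows "|lists A| \<le>o |UNIV :: 'u set|"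
proof -
  have "|{l \<in> lists A. length l = n}| \<le>o |UNIV :: 'u set|" for n
  proof (induction n)
    case 0
    have "{l \<in> lists A. length l = 0} = {[]}" by auto
    then show ?case using card_of_ordLeq_infinite[of UNIV] inf
      by (metis card_of_singl_ordLeq UNIV_not_empty)
  next
    case (Suc n)
    have eq: "{l \<in> lists A. length l = Suc n} = (\<lambda>(a, l). a # l) ` (A \<times> {l \<in> lists A. length l = n})"
      by (auto simp: length_Suc_conv image_iff)
    have "|A \<times> {l \<in> lists A. length l = n}| \<le>o |UNIV :: 'u set|"
      by (rule card_of_Times_ordLeq_infinite[OF inf A Suc.IH])
    then show ?case unfolding eq using card_of_image ordLeq_transitive by blast
  qed
  moreover have "lists A = (\<Union>n. {l \<in> lists A. length l = n})" by auto
  moreover have "|UNIV :: nat set| \<le>o |UNIV :: 'u set|" using inf infinite_iff_card_of_nat by blast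
  ultimately show ?thesis
    using card_of_UNION_ordLeq_infinite[OF inf, of "UNIV :: nat set" "\<lambda>n. {l \<in> lists A. length l = n}"] by simp
qed

lemma card_of_PiE_finite_le:
  assumes inf: "infinite (UNIV :: 'u set)" and A: "|A| \<le>o |UNIV :: 'u set|" and X: "finite X"
  shows "|X \<rightarrow>\<^sub>E A| \<le>o |UNIV :: 'u set|"
proof -
  obtain xs where xs: "set xs = X" using finite_list[OF X] by blast
  have "inj_on (\<lambda>f. map f xs) (X \<rightarrow>\<^sub>E A)"
  proof (rule inj_onI)
    fix f g assume fg: "f \<in> X \<rightarrow>\<^sub>E A" "g \<in> X \<rightarrow>\<^sub>E A" "map f xs = map g xs"
    show "f = g" by (rule PiE_ext[OF fg(1,2)]) (use fg(3) xs in auto)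
  qed
  moreover have "(\<lambda>f. map f xs) ` (X \<rightarrow>\<^sub>E A) \<subseteq> lists A" using xs by (auto simp: lists_eq_set)
  ultimately have "|X \<rightarrow>\<^sub>E A| \<le>o |lists A|" unfolding card_of_ordLeq[symmetric] by blast
  then show ?thesis using card_of_lists_le[OF inf A] ordLeq_transitive by blast
qed

lemma card_of_finite_le:
  assumes "infinite (UNIV :: 'u set)" "finite A"
  shows "|A| \<le>o |UNIV :: 'u set|"
  using assms by (intro ordLess_imp_ordLeq finite_ordLess_infinite2)

lemma card_of_lspan_finite_le:
  assumes inf: "infinite (UNIV :: 'u set)" and R: "|carrier R| \<le>o |UNIV :: 'u set|" and X: "finite X"
  shows "|lspan R M X| \<le>o |UNIV :: 'u set|"
proof -
  have "lspan R M X = lincomb M ` lists (carrier R \<times> X)" by (auto simp: lspan_def lists_eq_set)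
  moreover have "|lists (carrier R \<times> X)| \<le>o |UNIV :: 'u set|"
    by (intro card_of_lists_le card_of_Times_ordLeq_infinite inf R card_of_finite_le X)
  ultimately show ?thesis using card_of_image ordLeq_transitive by metis
qed

text \<open>A copy of a quotient of \<open>F\<close>: if the fibres of \<open>g\<close> are the cosets of a submodule \<open>K\<close>, the
  image of \<open>g\<close> carries the structure of \<open>F/K\<close>.  In this way quotients are realized on a
  prescribed type, as the definitions of flat and Mittag-Leffler modules require.\<close>

definition image_module :: "('r, 'a) module \<Rightarrow> ('a \<Rightarrow> 'b) \<Rightarrow> ('r, 'b) module"
  where "image_module F g =
    \<lparr>carrier = g ` carrier F, monoid.mult = undefined, one = undefined, zero = g \<zero>\<^bsub>F\<^esub>,
     add = (\<lambda>u v. g (inv_into (carrier F) g u \<oplus>\<^bsub>F\<^esub> inv_into (carrier F) g v)),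
     smult = (\<lambda>r u. g (r \<odot>\<^bsub>F\<^esub> inv_into (carrier F) g u))\<rparr>"

lemma image_module:
  fixes R :: "'r ring" and F :: "('r, 'a) module"
  assumes F: "left_module R F" and K: "submodule K R F"
    and g: "\<And>a b. \<lbrakk>a \<in> carrier F; b \<in> carrier F\<rbrakk> \<Longrightarrow> g a = g b \<longleftrightarrow> a \<ominus>\<^bsub>F\<^esub> b \<in> K"
  shows left_module_image_module: "left_module R (image_module F g)"
    and image_module_hom: "g \<in> mod_hom R F (image_module F g)"
    and image_module_zero_iff: "a \<in> carrier F \<Longrightarrow> g a = \<zero>\<^bsub>image_module F g\<^esub> \<longleftrightarrow> a \<in> K"
proof -
  interpret F: left_module R F by (rule F)
  interpret sF: sided_module R F by (rule left_module_sided[OF F])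
  let ?Q = "image_module F g"
  let ?i = "inv_into (carrier F) g"
  have KF: "K \<subseteq> carrier F" by (rule sF.submodule_subset[OF K])
  have i: "?i (g a) \<in> carrier F" "g (?i (g a)) = g a" if "a \<in> carrier F" for a
    using that by (auto intro: inv_into_into f_inv_into_f)
  have iK: "?i (g a) \<ominus>\<^bsub>F\<^esub> a \<in> K" if "a \<in> carrier F" for a using g[OF i(1)[OF that] that] i(2)[OF that] by simp
  have add: "g a \<oplus>\<^bsub>?Q\<^esub> g b = g (a \<oplus>\<^bsub>F\<^esub> b)" if ab: "a \<in> carrier F" "b \<in> carrier F" for a b
  proof -
    have "?i (g a) \<oplus>\<^bsub>F\<^esub> ?i (g b) \<ominus>\<^bsub>F\<^esub> (a \<oplus>\<^bsub>F\<^esub> b) = (?i (g a) \<ominus>\<^bsub>F\<^esub> a) \<oplus>\<^bsub>F\<^esub> (?i (g b) \<ominus>\<^bsub>F\<^esub> b)"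
      using ab i by (simp add: F.M.minus_eq F.M.a_ac F.M.minus_add)
    also have "\<dots> \<in> K" by (rule sF.submodule_add[OF K iK[OF ab(1)] iK[OF ab(2)]])
    finally show ?thesis using ab i g by (simp add: image_module_def)
  qed
  have smult: "r \<odot>\<^bsub>?Q\<^esub> g a = g (r \<odot>\<^bsub>F\<^esub> a)" if r: "r \<in> carrier R" and a: "a \<in> carrier F" for r a
  proof -
    have "r \<odot>\<^bsub>F\<^esub> ?i (g a) \<ominus>\<^bsub>F\<^esub> r \<odot>\<^bsub>F\<^esub> a = r \<odot>\<^bsub>F\<^esub> (?i (g a) \<ominus>\<^bsub>F\<^esub> a)"
      using r a i by (simp add: F.M.minus_eq F.smult_r_distr sF.smult_r_minus)
    also have "\<dots> \<in> K" by (rule sF.submodule_smult[OF K r iK[OF a]])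
    finally show ?thesis using r a i g F.smult_closed by (simp add: image_module_def)
  qed
  have carr: "carrier ?Q = g ` carrier F" and zero: "\<zero>\<^bsub>?Q\<^esub> = g \<zero>\<^bsub>F\<^esub>" by (simp_all add: image_module_def)
  show "g a = \<zero>\<^bsub>?Q\<^esub> \<longleftrightarrow> a \<in> K" if "a \<in> carrier F"
    using g[OF that, of "\<zero>\<^bsub>F\<^esub>"] that by (simp add: zero F.M.minus_eq sF.minus_zero)
  show "g \<in> mod_hom R F ?Q" by (rule mod_homI) (simp_all add: carr add smult)
  have "abelian_group ?Q"
  proof (rule abelian_groupI)
    fix u assume "u \<in> carrier ?Q"
    then obtain a where a: "u = g a" "a \<in> carrier F" unfolding carr by blast
    show "\<exists>v\<in>carrier ?Q. v \<oplus>\<^bsub>?Q\<^esub> u = \<zero>\<^bsub>?Q\<^esub>"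
      by (rule bexI[of _ "g (\<ominus>\<^bsub>F\<^esub> a)"]) (use a add carr zero in \<open>simp_all add: F.M.l_neg\<close>)
    show "\<zero>\<^bsub>?Q\<^esub> \<oplus>\<^bsub>?Q\<^esub> u = u" using a add zero by simp
  next
    show "\<zero>\<^bsub>?Q\<^esub> \<in> carrier ?Q" by (simp add: carr zero)
  next
    fix u v assume "u \<in> carrier ?Q" "v \<in> carrier ?Q"
    then obtain a b where ab: "u = g a" "a \<in> carrier F" "v = g b" "b \<in> carrier F" unfolding carr by blast
    show "u \<oplus>\<^bsub>?Q\<^esub> v \<in> carrier ?Q" using ab by (simp add: add carr)
    show "u \<oplus>\<^bsub>?Q\<^esub> v = v \<oplus>\<^bsub>?Q\<^esub> u" using ab by (simp add: add F.M.a_comm)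
    fix w assume "w \<in> carrier ?Q"
    then obtain c where c: "w = g c" "c \<in> carrier F" unfolding carr by blast
    show "u \<oplus>\<^bsub>?Q\<^esub> v \<oplus>\<^bsub>?Q\<^esub> w = u \<oplus>\<^bsub>?Q\<^esub> (v \<oplus>\<^bsub>?Q\<^esub> w)" using ab c by (simp add: add F.M.a_assoc)
  qed
  then show "left_module R ?Q"
    by (intro left_module.intro left_module_axioms.intro F.R.ring_axioms)
      (auto simp: carr add smult F.smult_closed F.smult_l_distr F.smult_r_distr F.smult_assoc F.smult_one)
qed

lemma quotient_map_exists:
  fixes R :: "'r ring" and F :: "('r, 'a) module"
  assumes F: "left_module R F" and K: "submodule K R F" and card: "|carrier F| \<le>o |UNIV :: 'b set|"
  obtains g :: "'a \<Rightarrow> 'b"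
  where "\<And>a b. \<lbrakk>a \<in> carrier F; b \<in> carrier F\<rbrakk> \<Longrightarrow> g a = g b \<longleftrightarrow> a \<ominus>\<^bsub>F\<^esub> b \<in> K"
proof -
  interpret F: left_module R F by (rule F)
  interpret sF: sided_module R F by (rule left_module_sided[OF F])
  obtain \<iota> :: "'a \<Rightarrow> 'b" where \<iota>: "inj_on \<iota> (carrier F)" using card unfolding card_of_ordLeq[symmetric] by blast
  define rep where "rep a = (SOME b. b \<in> carrier F \<and> a \<ominus>\<^bsub>F\<^esub> b \<in> K)" for a
  have rep: "rep a \<in> carrier F" "a \<ominus>\<^bsub>F\<^esub> rep a \<in> K" if "a \<in> carrier F" for a
  proof -
    have "a \<in> carrier F \<and> a \<ominus>\<^bsub>F\<^esub> a \<in> K"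
      using that sF.submodule_zero[OF K] by (simp add: F.M.minus_eq F.M.r_neg)
    then have "rep a \<in> carrier F \<and> a \<ominus>\<^bsub>F\<^esub> rep a \<in> K" unfolding rep_def by (rule someI)
    then show "rep a \<in> carrier F" "a \<ominus>\<^bsub>F\<^esub> rep a \<in> K" by simp_all
  qed
  have sym: "b \<ominus>\<^bsub>F\<^esub> a \<in> K" if "a \<ominus>\<^bsub>F\<^esub> b \<in> K" "a \<in> carrier F" "b \<in> carrier F" for a b
    using sF.submodule_minus[OF K that(1)] that by (simp add: F.M.minus_eq F.M.minus_add F.M.a_comm)
  have trans: "a \<ominus>\<^bsub>F\<^esub> c \<in> K" if "a \<ominus>\<^bsub>F\<^esub> b \<in> K" "b \<ominus>\<^bsub>F\<^esub> c \<in> K" "a \<in> carrier F" "b \<in> carrier F" "c \<in> carrier F" for a b c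
  proof -
    have "(a \<ominus>\<^bsub>F\<^esub> b) \<oplus>\<^bsub>F\<^esub> (b \<ominus>\<^bsub>F\<^esub> c) = a \<ominus>\<^bsub>F\<^esub> c"
      using that(3-5) by (simp add: F.M.minus_eq F.M.a_assoc F.M.r_neg1)
    then show ?thesis using sF.submodule_add[OF K that(1,2)] by simp
  qed
  have "\<iota> (rep a) = \<iota> (rep b) \<longleftrightarrow> a \<ominus>\<^bsub>F\<^esub> b \<in> K" if ab: "a \<in> carrier F" "b \<in> carrier F" for a b
  proof
    assume "\<iota> (rep a) = \<iota> (rep b)"
    then have eq: "rep a = rep b" using inj_onD[OF \<iota>] rep(1) ab by blast
    show "a \<ominus>\<^bsub>F\<^esub> b \<in> K"
      using trans[OF rep(2)[OF ab(1)] sym[OF rep(2)[OF ab(2)], folded eq]] ab rep(1) eq by simp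
  next
    assume K: "a \<ominus>\<^bsub>F\<^esub> b \<in> K"
    have "c \<in> carrier F \<and> a \<ominus>\<^bsub>F\<^esub> c \<in> K \<longleftrightarrow> c \<in> carrier F \<and> b \<ominus>\<^bsub>F\<^esub> c \<in> K" for c
      using trans[OF K _ ab, of c] trans[OF sym[OF K ab] _ ab(2,1), of c] by blast
    then show "\<iota> (rep a) = \<iota> (rep b)" unfolding rep_def by simp
  qed
  then show ?thesis by (rule that)
qed

section \<open>Rows and relations in flat modules\<close>

text \<open>A row with value zero is a linear relation between the vectors \<open>q x\<close>.\<close>

definition row_eval :: "('r, 'q) module \<Rightarrow> ('x \<Rightarrow> 'q) \<Rightarrow> 'x list \<Rightarrow> ('x \<Rightarrow> 'r) \<Rightarrow> 'q"
  where "row_eval Q q xs c = lincomb Q (map (\<lambda>x. (c x, q x)) xs)"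

lemma row_eval_Nil [simp]: "row_eval Q q [] c = \<zero>\<^bsub>Q\<^esub>"
  and row_eval_Cons [simp]: "row_eval Q q (x # xs) c = c x \<odot>\<^bsub>Q\<^esub> q x \<oplus>\<^bsub>Q\<^esub> row_eval Q q xs c"
  and row_eval_carrier_update [simp]: "row_eval (Q\<lparr>carrier := H\<rparr>) q xs c = row_eval Q q xs c"
  by (simp_all add: row_eval_def)

lemma row_eval_cong: "(\<And>x. x \<in> set xs \<Longrightarrow> c x = d x) \<Longrightarrow> row_eval Q q xs c = row_eval Q q xs d"
  by (induction xs) auto

lemma coord_sum_map_Pair: "coord_sum M (map (\<lambda>x. (x, f x)) xs) x' = row_eval M (\<lambda>x. x) xs (\<lambda>x. f x x')"
  by (induction xs) auto

lemma coord_sum_append: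
  fixes M :: "('r, 'm) module"
  assumes "sided_module R M" "\<And>y c. (y, c) \<in> set (ps @ qs) \<Longrightarrow> y \<in> carrier M \<and> c x \<in> carrier R"
  shows "coord_sum M (ps @ qs) x = coord_sum M ps x \<oplus>\<^bsub>M\<^esub> coord_sum M qs x"
  unfolding coord_sum_def map_append
  by (rule sided_module.lincomb_append[OF assms(1)]) (use assms(2) in auto)

context sided_module
begin

lemma row_eval_closed:
  assumes "\<And>x. x \<in> set xs \<Longrightarrow> q x \<in> carrier M" "\<And>x. x \<in> set xs \<Longrightarrow> c x \<in> carrier R"
  shows "row_eval M q xs c \<in> carrier M"
  unfolding row_eval_def by (rule lincomb_closed) (use assms in auto)

lemma row_eval_add:
  assumes "\<And>x. x \<in> set xs \<Longrightarrow> q x \<in> carrier M" "\<And>x. x \<in> set xs \<Longrightarrow> c x \<in> carrier R"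
    and "\<And>x. x \<in> set xs \<Longrightarrow> d x \<in> carrier R"
  shows "row_eval M q xs (\<lambda>x. c x \<oplus>\<^bsub>R\<^esub> d x) = row_eval M q xs c \<oplus>\<^bsub>M\<^esub> row_eval M q xs d"
  using assms
proof (induction xs)
  case (Cons x xs)
  then show ?case
    using row_eval_closed[of xs q c] row_eval_closed[of xs q d]
    by (simp add: smult_l_distr smult_closed M.a_ac)
qed simp

lemma row_eval_minus:
  assumes "\<And>x. x \<in> set xs \<Longrightarrow> q x \<in> carrier M" "\<And>x. x \<in> set xs \<Longrightarrow> c x \<in> carrier R"
  shows "row_eval M q xs (\<lambda>x. \<ominus>\<^bsub>R\<^esub> c x) = \<ominus>\<^bsub>M\<^esub> row_eval M q xs c"
  using assms
proof (induction xs)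
  case Nil
  show ?case unfolding row_eval_Nil by (rule minus_zero[symmetric])
next
  case (Cons x xs)
  then show ?case
    using row_eval_closed[of xs q c]
    by (simp add: smult_l_minus smult_closed M.minus_add)
qed

lemma row_eval_diff:
  assumes "\<And>x. x \<in> set xs \<Longrightarrow> q x \<in> carrier M" "\<And>x. x \<in> set xs \<Longrightarrow> c x \<in> carrier R"
    and "\<And>x. x \<in> set xs \<Longrightarrow> d x \<in> carrier R"
  shows "row_eval M q xs (\<lambda>x. c x \<ominus>\<^bsub>R\<^esub> d x) = row_eval M q xs c \<ominus>\<^bsub>M\<^esub> row_eval M q xs d"
  using row_eval_add[of xs q c "\<lambda>x. \<ominus>\<^bsub>R\<^esub> d x"] row_eval_minus[of xs q d] assms
  by (simp add: M.minus_eq R.minus_eq)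

lemma row_eval_zero:
  assumes "\<And>x. x \<in> set xs \<Longrightarrow> q x \<in> carrier M" "\<And>x. x \<in> set xs \<Longrightarrow> c x = \<zero>\<^bsub>R\<^esub>"
  shows "row_eval M q xs c = \<zero>\<^bsub>M\<^esub>"
  using assms by (induction xs) (auto simp: smult_l_zero)

lemma row_eval_delta:
  assumes "distinct xs" "x \<in> set xs" "\<And>x. x \<in> set xs \<Longrightarrow> q x \<in> carrier M"
  shows "row_eval M q xs (\<lambda>y. if y = x then \<one>\<^bsub>R\<^esub> else \<zero>\<^bsub>R\<^esub>) = q x"
  using assms
proof (induction xs)
  case (Cons y ys)
  show ?case
  proof (cases "y = x")
    case True
    then have "row_eval M q ys (\<lambda>y. if y = x then \<one>\<^bsub>R\<^esub> else \<zero>\<^bsub>R\<^esub>) = \<zero>\<^bsub>M\<^esub>"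
      using Cons.prems by (intro row_eval_zero) auto
    then show ?thesis using True Cons.prems by (simp add: smult_one)
  next
    case False
    then show ?thesis using Cons by (simp add: smult_l_zero)
  qed
qed simp

text \<open>Spans are defined by lists of scalars and vectors in which a vector may occur repeatedly; here
  every generator receives exactly one coefficient.\<close>

lemma lspan_imp_row_eval:
  assumes "distinct xs" and q: "\<And>x. x \<in> set xs \<Longrightarrow> q x \<in> carrier M" and u: "u \<in> lspan R M (q ` set xs)"
  obtains c where "\<And>x. x \<in> set xs \<Longrightarrow> c x \<in> carrier R" "u = row_eval M q xs c"
proof -
  let ?H = "{row_eval M q xs c | c. \<forall>x\<in>set xs. c x \<in> carrier R}"
  have "submodule ?H R M"
  proof (rule submoduleI)
    show "?H \<subseteq> carrier M" by (auto intro!: row_eval_closed q)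
    have "row_eval M q xs (\<lambda>x. \<zero>\<^bsub>R\<^esub>) = \<zero>\<^bsub>M\<^esub>" by (rule row_eval_zero) (use q in auto)
    then show "\<zero>\<^bsub>M\<^esub> \<in> ?H" by (intro CollectI exI[of _ "\<lambda>x. \<zero>\<^bsub>R\<^esub>"]) simp
    fix u v assume "u \<in> ?H" "v \<in> ?H"
    then obtain c d where c: "u = row_eval M q xs c" "\<forall>x\<in>set xs. c x \<in> carrier R"
      and d: "v = row_eval M q xs d" "\<forall>x\<in>set xs. d x \<in> carrier R" by blast
    show "u \<oplus>\<^bsub>M\<^esub> v \<in> ?H"
      using row_eval_add[of xs q c d] c d q by (intro CollectI exI[of _ "\<lambda>x. c x \<oplus>\<^bsub>R\<^esub> d x"]) simp
  next
    fix r u assume r: "r \<in> carrier R" and "u \<in> ?H"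
    then obtain c where c: "u = row_eval M q xs c" "\<forall>x\<in>set xs. c x \<in> carrier R" by blast
    have "\<forall>x\<in>set xs. \<exists>t\<in>carrier R. \<forall>m\<in>carrier M. r \<odot>\<^bsub>M\<^esub> (c x \<odot>\<^bsub>M\<^esub> m) = t \<odot>\<^bsub>M\<^esub> m"
      using smult_smult[OF r] c(2) by blast
    then obtain t where t: "\<And>x. x \<in> set xs \<Longrightarrow> t x \<in> carrier R"
      "\<And>x m. \<lbrakk>x \<in> set xs; m \<in> carrier M\<rbrakk> \<Longrightarrow> r \<odot>\<^bsub>M\<^esub> (c x \<odot>\<^bsub>M\<^esub> m) = t x \<odot>\<^bsub>M\<^esub> m" by metis
    have "r \<odot>\<^bsub>M\<^esub> row_eval M q ys c = row_eval M q ys t" if "set ys \<subseteq> set xs" for ys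
      using that
    proof (induction ys)
      case (Cons y ys)
      then show ?case using t c(2) q r row_eval_closed[of ys q c]
        by (auto simp: smult_r_distr smult_closed subset_iff)
    qed (simp add: smult_r_zero r)
    from this[OF subset_refl] show "r \<odot>\<^bsub>M\<^esub> u \<in> ?H" using t(1) c(1) by auto
  qed
  moreover have "q ` set xs \<subseteq> ?H"
  proof
    fix u assume "u \<in> q ` set xs"
    then obtain x where x: "x \<in> set xs" "u = q x" by blast
    show "u \<in> ?H"
      using row_eval_delta[OF assms(1) x(1), of q] q x(2)
      by (intro CollectI exI[of _ "\<lambda>y. if y = x then \<one>\<^bsub>R\<^esub> else \<zero>\<^bsub>R\<^esub>"]) simp
  qed
  ultimately have "u \<in> ?H" using lspan_minimal u by blast
  then show ?thesis using that by blast
qed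

end

lemma row_eval_left_mult:
  fixes R :: "'r ring" and Q :: "('r, 'q) module"
  assumes Q: "left_module R Q" and r: "r \<in> carrier R"
    and "\<And>x. x \<in> set xs \<Longrightarrow> q x \<in> carrier Q" "\<And>x. x \<in> set xs \<Longrightarrow> c x \<in> carrier R"
  shows "row_eval Q q xs (\<lambda>x. r \<otimes>\<^bsub>R\<^esub> c x) = r \<odot>\<^bsub>Q\<^esub> row_eval Q q xs c"
proof -
  interpret Q: left_module R Q by (rule Q)
  interpret sQ: sided_module R Q by (rule left_module_sided[OF Q])
  show ?thesis using assms(3,4)
  proof (induction xs)
    case (Cons x xs)
    then show ?case using sQ.row_eval_closed[of xs q c] r
      by (simp add: Q.smult_assoc Q.smult_r_distr Q.smult_closed)
  qed (simp add: sQ.smult_r_zero r)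
qed

lemma (in right_mod) row_eval_right_mult:
  assumes r: "r \<in> carrier R"
    and "\<And>x. x \<in> set xs \<Longrightarrow> q x \<in> carrier M" "\<And>x. x \<in> set xs \<Longrightarrow> c x \<in> carrier R"
  shows "row_eval M q xs (\<lambda>x. c x \<otimes>\<^bsub>R\<^esub> r) = r \<odot>\<^bsub>M\<^esub> row_eval M q xs c"
  using assms(2,3)
proof (induction xs)
  case (Cons x xs)
  then show ?case using row_eval_closed[of xs q c] r
    by (simp add: smult_assoc smult_r_distr smult_closed)
qed (simp add: smult_r_zero r)

lemma mod_hom_row_eval:
  assumes "sided_module R A" "sided_module R B" "f \<in> mod_hom R A B"
    and "\<And>x. x \<in> set xs \<Longrightarrow> q x \<in> carrier A" "\<And>x. x \<in> set xs \<Longrightarrow> c x \<in> carrier R"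
  shows "f (row_eval A q xs c) = row_eval B (\<lambda>x. f (q x)) xs c"
  unfolding row_eval_def
  using mod_hom_lincomb[OF assms(1-3), of "map (\<lambda>x. (c x, q x)) xs"] assms(4,5)
  by (simp add: image_subset_iff comp_def)

lemma keys_sum_list_frag_of:
  "(\<And>x. x \<in> set xs \<Longrightarrow> f x \<in> S) \<Longrightarrow> Poly_Mapping.keys (\<Sum>x\<leftarrow>xs. frag_of (f x)) \<subseteq> S"
proof (induction xs)
  case (Cons x xs)
  have "Poly_Mapping.keys (frag_of (f x) + (\<Sum>x\<leftarrow>xs. frag_of (f x))) \<subseteq>
      Poly_Mapping.keys (frag_of (f x)) \<union> Poly_Mapping.keys (\<Sum>x\<leftarrow>xs. frag_of (f x))"
    by (rule keys_add)
  then show ?case using Cons by auto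
qed simp

lemma pairing_sum_list:
  fixes Q :: "('r, 'q) module"
  assumes Q: "abelian_group Q" and h: "is_pairing Q X c h"
    and "\<And>x. x \<in> set xs \<Longrightarrow> x \<in> X \<and> q x \<in> carrier Q"
  shows "h (\<Sum>x\<leftarrow>xs. frag_of (x, q x)) = row_eval Q q xs c"
  using assms(3)
proof (induction xs)
  case Nil
  then show ?case by (simp add: is_pairing_zero[OF h Q])
next
  case (Cons x xs)
  have k: "Poly_Mapping.keys (\<Sum>x\<leftarrow>xs. frag_of (x, q x)) \<subseteq> X \<times> carrier Q"
    by (rule keys_sum_list_frag_of) (use Cons.prems in auto)
  have "h (frag_of (x, q x) + (\<Sum>x\<leftarrow>xs. frag_of (x, q x))) =
      h (frag_of (x, q x)) \<oplus>\<^bsub>Q\<^esub> h (\<Sum>x\<leftarrow>xs. frag_of (x, q x))"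
    by (rule additive_on_plus[OF Q is_pairing_additive[OF h] _ k])
      (use Cons.prems in auto)
  then show ?case using Cons is_pairing_gen[OF h, of x "q x"] by simp
qed

lemma induced_sum_list: "induced f (\<Sum>x\<leftarrow>xs. frag_of (x, q x)) = (\<Sum>x\<leftarrow>xs. frag_of (x, f (q x)))"
  by (induction xs) (simp_all add: induced_def frag_extend_add)

lemma induced_tensor_kernel:
  fixes R :: "'r ring" and M :: "('r, 'm) module" and A :: "('r, 'a) module" and B :: "('r, 'b) module"
  assumes M: "right_module R M" and A: "left_module R A" and B: "left_module R B" and f: "f \<in> mod_hom R A B"
    and t: "t \<in> tensor_kernel R M A"
  shows "induced f t \<in> tensor_kernel R M B"
  using t
proof (induction rule: tensor_kernel_induct[OF M A,
      consumes 1, case_names zero diff add_left add_right smult])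
  case zero
  show ?case using tensor_kernel_zero[OF M B] by simp
next
  case (diff s t)
  then show ?case using tensor_kernel_diff[OF M B] by simp
next
  case (add_left x y q)
  then show ?case using tensor_kernel_add_left[OF M B] mod_hom_closed[OF f] by simp
next
  case (add_right x p q)
  then show ?case
    using tensor_kernel_add_right[OF M B, of x "f p" "f q"] mod_hom_closed[OF f] mod_hom_add[OF f] by simp
next
  case (smult r x q)
  then show ?case
    using tensor_kernel_smult[OF M B, of r x "f q"] mod_hom_closed[OF f] mod_hom_smult[OF f] by simp
qed

text \<open>For a left submodule \<open>D\<close> of \<open>R\<^sup>X\<close> this says that the inclusion of \<open>X\<close>, as an element of
  \<open>M\<^sup>X\<close>, lies in \<open>M \<cdot> D\<close>.\<close>

definition coordinatized_by :: "('r, 'm) module \<Rightarrow> 'm set \<Rightarrow> ('m \<Rightarrow> 'r) set \<Rightarrow> bool"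
  where "coordinatized_by M X D \<longleftrightarrow>
    (\<exists>ps. (\<forall>y c. (y, c) \<in> set ps \<longrightarrow> y \<in> carrier M \<and> c \<in> D) \<and> (\<forall>x\<in>X. coord_sum M ps x = x))"

definition row_module :: "'r ring \<Rightarrow> 'x set \<Rightarrow> ('r, 'x \<Rightarrow> 'r) module"
  where "row_module R X = prod_module X (\<lambda>_. left_regular R)"

lemma row_module_simps [simp]:
  "carrier (row_module R X) = X \<rightarrow>\<^sub>E carrier R"
  "\<zero>\<^bsub>row_module R X\<^esub> = (\<lambda>x\<in>X. \<zero>\<^bsub>R\<^esub>)"
  "c \<oplus>\<^bsub>row_module R X\<^esub> d = (\<lambda>x\<in>X. c x \<oplus>\<^bsub>R\<^esub> d x)"
  "r \<odot>\<^bsub>row_module R X\<^esub> c = (\<lambda>x\<in>X. r \<otimes>\<^bsub>R\<^esub> c x)"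
  by (simp_all add: row_module_def)

lemma left_module_row_module: "ring R \<Longrightarrow> left_module R (row_module R X)" for R :: "'r ring"
  unfolding row_module_def by (intro left_module_prod_module left_module_left_regular)

definition relation_rows :: "'r ring \<Rightarrow> ('r, 'q) module \<Rightarrow> ('x \<Rightarrow> 'q) \<Rightarrow> 'x list \<Rightarrow> ('x \<Rightarrow> 'r) set"
  where "relation_rows R Q q xs = {c \<in> set xs \<rightarrow>\<^sub>E carrier R. row_eval Q q xs c = \<zero>\<^bsub>Q\<^esub>}"

lemma coordinatized_by_mono: "\<lbrakk>coordinatized_by M X D; D \<subseteq> D'\<rbrakk> \<Longrightarrow> coordinatized_by M X D'"
  unfolding coordinatized_by_def by (meson subsetD)

lemma coordinatized_by_restrict:
  assumes "coordinatized_by M Y D" "X \<subseteq> Y"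
  shows "coordinatized_by M X ((\<lambda>c. restrict c X) ` D)"
proof -
  obtain ps where ps: "\<And>y c. (y, c) \<in> set ps \<Longrightarrow> y \<in> carrier M \<and> c \<in> D" "\<And>x. x \<in> Y \<Longrightarrow> coord_sum M ps x = x"
    using assms(1) unfolding coordinatized_by_def by auto
  have "coord_sum M (map (\<lambda>(y, c). (y, restrict c X)) ps) x = x" if x: "x \<in> X" for x
    using coord_sum_replace_rows[of ps "\<lambda>c. restrict c X" x M] ps(2) x assms(2) by auto
  then show ?thesis unfolding coordinatized_by_def
    by (intro exI[of _ "map (\<lambda>(y, c). (y, restrict c X)) ps"]) (use ps(1) in auto)
qed

context right_mod
begin

text \<open>Choose for each \<open>a\<close> in \<open>A\<close> a row \<open>s(a)\<close> that represents it by the generators \<open>q x\<close>, and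
  send \<open>m \<otimes> a\<close> to the tuple with components \<open>m s(a)(z)\<close>, \<open>z \<in> X\<close>.  This is not well-defined on the tensor
  product, but its values on the defining relations are multiples of relation rows.  So the image of
  the given vanishing tensor, the tuple with components \<open>\<Sum> x s(q x)(z)\<close>, is coordinatized by relation
  rows.  It differs from the tuple with components \<open>z\<close> by a combination of the rows \<open>e\<^sub>x - s(q x)\<close>,
  which are relation rows, too.\<close>

lemma vanishing_tensor_on_generators:
  fixes A :: "('r, 'q) module"
  assumes A: "left_module R A" and xs: "distinct xs" "set xs \<subseteq> carrier M"
    and q: "\<And>x. x \<in> set xs \<Longrightarrow> q x \<in> carrier A" and gen: "carrier A \<subseteq> lspan R A (q ` set xs)"
    and t: "(\<Sum>x\<leftarrow>xs. frag_of (x, q x)) \<in> tensor_kernel R M A"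
  shows "coordinatized_by M (set xs) (relation_rows R A q xs)"
proof -
  interpret A: left_module R A by (rule A)
  interpret sA: sided_module R A by (rule left_module_sided[OF A])
  let ?D = "{c. (\<forall>x\<in>set xs. c x \<in> carrier R) \<and> row_eval A q xs c = \<zero>\<^bsub>A\<^esub>}"
  let ?S = "carrier M \<times> carrier A"
  have "\<forall>a. \<exists>c. a \<in> carrier A \<longrightarrow> (\<forall>x\<in>set xs. c x \<in> carrier R) \<and> row_eval A q xs c = a"
  proof (intro allI)
    fix a
    show "\<exists>c. a \<in> carrier A \<longrightarrow> (\<forall>x\<in>set xs. c x \<in> carrier R) \<and> row_eval A q xs c = a"
    proof (cases "a \<in> carrier A")
      case True
      then have a: "a \<in> lspan R A (q ` set xs)" using gen by blast
      show ?thesis by (rule sA.lspan_imp_row_eval[OF xs(1) _ a]) (auto simp: q)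
    qed simp
  qed
  then obtain s where s: "\<And>a x. \<lbrakk>a \<in> carrier A; x \<in> set xs\<rbrakk> \<Longrightarrow> s a x \<in> carrier R"
    and ev: "\<And>a. a \<in> carrier A \<Longrightarrow> row_eval A q xs (s a) = a" by metis
  have "\<exists>h. x \<in> set xs \<longrightarrow> additive_on M ?S h \<and>
      (\<forall>m\<in>carrier M. \<forall>a\<in>carrier A. h (frag_of (m, a)) = s a x \<odot>\<^bsub>M\<^esub> m)" for x
  proof (cases "x \<in> set xs")
    case True
    have "(\<lambda>(m, a). s a x \<odot>\<^bsub>M\<^esub> m) ` ?S \<subseteq> carrier M" using s True by (auto intro!: smult_closed)
    then show ?thesis
    proof (rule additive_extension[OF M.abelian_group_axioms])
      fix h
      assume "additive_on M ?S h" "\<And>p. p \<in> ?S \<Longrightarrow> h (frag_of p) = (case p of (m, a) \<Rightarrow> s a x \<odot>\<^bsub>M\<^esub> m)"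
      then show ?thesis by (intro exI[of _ h]) simp
    qed
  qed simp
  then obtain h where h: "\<And>x. x \<in> set xs \<Longrightarrow> additive_on M ?S (h x)"
    and hg: "\<And>x m a. \<lbrakk>x \<in> set xs; m \<in> carrier M; a \<in> carrier A\<rbrakk> \<Longrightarrow> h x (frag_of (m, a)) = s a x \<odot>\<^bsub>M\<^esub> m"
    by metis
  note h0 = additive_on_zero[OF M.abelian_group_axioms h] and hd = additive_on_diff[OF h]
    and hd3 = additive_on_diff3[OF h]
  have smult_diff: "(a \<ominus>\<^bsub>R\<^esub> b) \<odot>\<^bsub>M\<^esub> m = a \<odot>\<^bsub>M\<^esub> m \<ominus>\<^bsub>M\<^esub> b \<odot>\<^bsub>M\<^esub> m"
    if "a \<in> carrier R" "b \<in> carrier R" "m \<in> carrier M" for a b m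
    using that by (simp add: R.minus_eq M.minus_eq smult_l_distr smult_l_minus)
  define represents where "represents ps t \<longleftrightarrow>
    (\<forall>y c. (y, c) \<in> set ps \<longrightarrow> y \<in> carrier M \<and> c \<in> ?D) \<and> (\<forall>x\<in>set xs. h x t = coord_sum M ps x)" for ps t
  have repI: "\<exists>ps. represents ps t"
    if "\<And>y c. (y, c) \<in> set ps \<Longrightarrow> y \<in> carrier M \<and> c \<in> ?D" "\<And>x. x \<in> set xs \<Longrightarrow> h x t = coord_sum M ps x" for ps t
    by (rule exI[of _ ps]) (simp add: represents_def that del: mem_Collect_eq)
  have repD: "(y, c) \<in> set ps \<Longrightarrow> y \<in> carrier M \<and> c \<in> ?D" "x \<in> set xs \<Longrightarrow> h x t = coord_sum M ps x"
    if "represents ps t" for ps t x y c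
    using that unfolding represents_def by (simp_all del: mem_Collect_eq)
  \<comment> \<open>The tuple of a vanishing tensor is a combination of relation rows.\<close>
  have "\<exists>ps. represents ps t" if "t \<in> tensor_kernel R M A" for t
    using that
  proof (induction rule: tensor_kernel_induct[OF is_right_module A,
        consumes 1, case_names zero diff add_left add_right smult])
    case zero
    show ?case by (rule repI[of "[]"]) (simp_all add: h0)
  next
    case (diff t u)
    then obtain ps qs where pq: "represents ps t" "represents qs u" by blast
    note ps = repD[OF pq(1)] and qs = repD[OF pq(2)]
    let ?qs = "map (\<lambda>(y, c). (\<ominus>\<^bsub>M\<^esub> y, c)) qs"
    have neg: "coord_sum M (map (\<lambda>(y, c). (\<ominus>\<^bsub>M\<^esub> y, c)) rs) x = \<ominus>\<^bsub>M\<^esub> coord_sum M rs x"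
      if x: "x \<in> set xs" and "set rs \<subseteq> set qs" for rs x
      using that(2)
    proof (induction rs)
      case Nil
      show ?case unfolding list.map coord_sum_Nil by (rule minus_zero[symmetric])
    next
      case (Cons r rs)
      obtain y c where r: "r = (y, c)" by (cases r)
      then have "y \<in> carrier M" "c x \<in> carrier R" using qs(1)[of y c] Cons.prems x by auto
      moreover have "coord_sum M rs x \<in> carrier M"
        by (rule coord_sum_closed) (use qs(1) Cons.prems x in auto)
      ultimately show ?case using Cons r by (simp add: smult_r_minus M.minus_add smult_closed)
    qed
    have "h x (t - u) = coord_sum M (ps @ ?qs) x" if x: "x \<in> set xs" for x
    proof -
      have "coord_sum M (ps @ ?qs) x = coord_sum M ps x \<oplus>\<^bsub>M\<^esub> coord_sum M ?qs x"
        by (rule coord_sum_append[OF sided_module_axioms]) (use ps(1) qs(1) x in auto)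
      then show ?thesis
        using neg[OF x subset_refl] ps(2)[OF x] qs(2)[OF x]
          hd[OF x tensor_kernel_keys[OF is_right_module A diff(1)] tensor_kernel_keys[OF is_right_module A diff(2)]]
        by (simp add: M.minus_eq)
    qed
    then show ?case by (rule repI[rotated]) (use ps(1) qs(1) in auto)
  next
    case (add_left x y a)
    have "h z (frag_of (x \<oplus>\<^bsub>M\<^esub> y, a) - frag_of (x, a) - frag_of (y, a)) = \<zero>\<^bsub>M\<^esub>" if "z \<in> set xs" for z
      using add_left that s by (simp add: hd3 hg smult_r_distr smult_closed add_minus_both)
    then show ?case by (intro repI[of "[]"]) simp_all
  next
    case (add_right x p q')
    let ?c = "\<lambda>z. s (p \<oplus>\<^bsub>A\<^esub> q') z \<ominus>\<^bsub>R\<^esub> s p z \<ominus>\<^bsub>R\<^esub> s q' z"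
    have pq: "p \<oplus>\<^bsub>A\<^esub> q' \<in> carrier A" using add_right by simp
    have "row_eval A q xs ?c = p \<oplus>\<^bsub>A\<^esub> q' \<ominus>\<^bsub>A\<^esub> p \<ominus>\<^bsub>A\<^esub> q'"
      using add_right pq s q by (simp add: sA.row_eval_diff ev)
    then have "?c \<in> ?D" using add_right pq s sA.add_minus_both by simp
    moreover have "h z (frag_of (x, p \<oplus>\<^bsub>A\<^esub> q') - frag_of (x, p) - frag_of (x, q')) = coord_sum M [(x, ?c)] z"
      if "z \<in> set xs" for z
      using add_right that s pq by (simp add: hd3 hg smult_diff smult_closed)
    ultimately show ?case using add_right by (intro repI[of "[(x, ?c)]"]) auto
  next
    case (smult r x a)
    let ?c = "\<lambda>z. r \<otimes>\<^bsub>R\<^esub> s a z \<ominus>\<^bsub>R\<^esub> s (r \<odot>\<^bsub>A\<^esub> a) z"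
    have ra: "r \<odot>\<^bsub>A\<^esub> a \<in> carrier A" using smult A.smult_closed by simp
    have "row_eval A q xs ?c = r \<odot>\<^bsub>A\<^esub> a \<ominus>\<^bsub>A\<^esub> r \<odot>\<^bsub>A\<^esub> a"
      using smult ra s q by (simp add: sA.row_eval_diff row_eval_left_mult[OF A] ev)
    then have "?c \<in> ?D" using smult ra s by (simp add: A.M.minus_eq A.M.r_neg)
    moreover have "h z (frag_of (r \<odot>\<^bsub>M\<^esub> x, a) - frag_of (x, r \<odot>\<^bsub>A\<^esub> a)) = coord_sum M [(x, ?c)] z"
      if "z \<in> set xs" for z
      using smult that s ra by (simp add: hd hg smult_diff smult_closed smult_assoc)
    ultimately show ?case using smult by (intro repI[of "[(x, ?c)]"]) auto
  qed
  from this[OF t] obtain ps where rep: "represents ps (\<Sum>x\<leftarrow>xs. frag_of (x, q x))" by blast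
  note ps = repD[OF rep]
  let ?d = "\<lambda>x y. (if y = x then \<one>\<^bsub>R\<^esub> else \<zero>\<^bsub>R\<^esub>)"
  let ?qs = "map (\<lambda>x. (x, \<lambda>y. ?d x y \<ominus>\<^bsub>R\<^esub> s (q x) y)) xs"
  have hsum: "h z (\<Sum>x\<leftarrow>ys. frag_of (x, q x)) = row_eval M (\<lambda>x. x) ys (\<lambda>x. s (q x) z)"
    if z: "z \<in> set xs" and "set ys \<subseteq> set xs" for z ys
    using that(2)
  proof (induction ys)
    case (Cons y ys)
    have k: "Poly_Mapping.keys (\<Sum>x\<leftarrow>ys. frag_of (x, q x)) \<subseteq> ?S"
      by (rule keys_sum_list_frag_of) (use Cons.prems xs(2) q in auto)
    have y: "(y, q y) \<in> ?S" using Cons.prems xs(2) q by auto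
    have "h z (frag_of (y, q y) + (\<Sum>x\<leftarrow>ys. frag_of (x, q x))) = h z (frag_of (y, q y)) \<oplus>\<^bsub>M\<^esub> h z (\<Sum>x\<leftarrow>ys. frag_of (x, q x))"
      by (rule additive_on_plus[OF M.abelian_group_axioms h[OF z] _ k]) (use y in auto)
    then show ?case using Cons y hg[OF z] by simp
  qed (simp add: h0[OF z])
  have "coord_sum M (?qs @ ps) z = z" if z: "z \<in> set xs" for z
  proof -
    have sq: "s (q x) z \<in> carrier R" "x \<in> carrier M" if "x \<in> set xs" for x using s q z that xs(2) by auto
    have "coord_sum M ?qs z = row_eval M (\<lambda>x. x) xs (\<lambda>x. ?d x z \<ominus>\<^bsub>R\<^esub> s (q x) z)"
      by (rule coord_sum_map_Pair)
    also have "\<dots> = row_eval M (\<lambda>x. x) xs (\<lambda>x. ?d x z) \<ominus>\<^bsub>M\<^esub> row_eval M (\<lambda>x. x) xs (\<lambda>x. s (q x) z)"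
      by (rule row_eval_diff) (use sq in auto)
    also have "row_eval M (\<lambda>x. x) xs (\<lambda>x. ?d x z) = row_eval M (\<lambda>x. x) xs (\<lambda>x. ?d z x)"
      by (rule row_eval_cong) auto
    also have "\<dots> = z" by (rule row_eval_delta[OF xs(1) z]) (use xs(2) in auto)
    also have "row_eval M (\<lambda>x. x) xs (\<lambda>x. s (q x) z) = coord_sum M ps z"
      using hsum[OF z subset_refl] ps(2)[OF z] by simp
    finally have 1: "coord_sum M ?qs z = z \<ominus>\<^bsub>M\<^esub> coord_sum M ps z" .
    have 2: "coord_sum M ps z \<in> carrier M" by (rule coord_sum_closed) (use ps(1) z in auto)
    have "coord_sum M (?qs @ ps) z = coord_sum M ?qs z \<oplus>\<^bsub>M\<^esub> coord_sum M ps z"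
      by (rule coord_sum_append[OF sided_module_axioms]) (use sq ps(1) z in auto)
    then show ?thesis using 1 2 xs(2) z by (auto simp: M.minus_eq M.a_assoc M.l_neg)
  qed
  moreover have "y \<in> carrier M \<and> c \<in> ?D" if yc: "(y, c) \<in> set (?qs @ ps)" for y c
  proof (cases "(y, c) \<in> set ps")
    case False
    then obtain x where x: "x \<in> set xs" "y = x" "c = (\<lambda>z. ?d x z \<ominus>\<^bsub>R\<^esub> s (q x) z)" using yc by auto
    have "row_eval A q xs c = q x \<ominus>\<^bsub>A\<^esub> q x"
      unfolding x(3) using sA.row_eval_diff[of xs q "?d x" "s (q x)"] sA.row_eval_delta[OF xs(1) x(1), of q]
        q s x(1) ev[OF q[OF x(1)]] by simp
    then show ?thesis using x xs(2) s q by (auto simp: A.M.minus_eq A.M.r_neg)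
  qed (use ps(1) in blast)
  ultimately have "coordinatized_by M (set xs) ?D" unfolding coordinatized_by_def by blast
  then have "coordinatized_by M (set xs) ((\<lambda>c. restrict c (set xs)) ` ?D)"
    by (rule coordinatized_by_restrict) simp
  moreover have "(\<lambda>c. restrict c (set xs)) ` ?D \<subseteq> relation_rows R A q xs"
  proof
    fix c assume "c \<in> (\<lambda>c. restrict c (set xs)) ` ?D"
    then obtain d where d: "d \<in> ?D" "c = restrict d (set xs)" by blast
    have "row_eval A q xs c = row_eval A q xs d" by (rule row_eval_cong) (simp add: d(2))
    then show "c \<in> relation_rows R A q xs" using d by (auto simp: relation_rows_def)
  qed
  ultimately show ?thesis by (rule coordinatized_by_mono)
qed

end

context right_mod
begin

text \<open>By flatness the tensor vanishes already over the submodule generated by the vectors \<open>q x\<close>, so that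
  the criterion for generators applies.  Flatness refers to modules on a fixed type: since finitely many
  elements of \<open>P\<close> witness the vanishing, \<open>P\<close> may be replaced by a finitely generated submodule,
  which has a copy on that type.\<close>

lemma flat_vanishing_tensor:
  fixes P :: "('r, 'p) module"
  assumes flat: "flat_module TYPE('q) R M"
    and inf: "infinite (UNIV :: 'q set)" and card: "|carrier R| \<le>o |UNIV :: 'q set|"
    and P: "left_module R P" and xs: "distinct xs" "set xs \<subseteq> carrier M"
    and q: "\<And>x. x \<in> set xs \<Longrightarrow> q x \<in> carrier P"
    and t: "(\<Sum>x\<leftarrow>xs. frag_of (x, q x)) \<in> tensor_kernel R M P"
  shows "coordinatized_by M (set xs) (relation_rows R P q xs)"
proof -
  interpret P: left_module R P by (rule P)
  interpret sP: sided_module R P by (rule left_module_sided[OF P])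
  obtain Y :: "'p set" where Y: "finite Y" "Y \<subseteq> carrier P"
    and fin: "\<And>P'. \<lbrakk>submodule P' R P; Y \<subseteq> P'\<rbrakk> \<Longrightarrow>
      (\<Sum>x\<leftarrow>xs. frag_of (x, q x)) \<in> tensor_kernel R M (P\<lparr>carrier := P'\<rparr>)"
  proof (rule tensor_kernel_finitary[OF is_right_module P t])
    fix F Y
    assume F: "F \<subseteq> carrier M" and Y: "finite Y" "Y \<subseteq> carrier P"
      and fin: "\<And>N P'. \<lbrakk>submodule N R M; submodule P' R P; F \<subseteq> N; Y \<subseteq> P'\<rbrakk> \<Longrightarrow>
        (\<Sum>x\<leftarrow>xs. frag_of (x, q x)) \<in> tensor_kernel R (M\<lparr>carrier := N\<rparr>) (P\<lparr>carrier := P'\<rparr>)"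
    show thesis
      by (rule that[OF Y]) (use fin[OF submodule_carrier _ F] in simp)
  qed
  let ?Z = "Y \<union> q ` set xs"
  have Z: "finite ?Z" "?Z \<subseteq> carrier P" using Y q by auto
  let ?P = "P\<lparr>carrier := lspan R P ?Z\<rparr>"
  have sub: "submodule (lspan R P ?Z) R P" by (rule sP.lspan_submodule[OF Z(2)])
  have P': "left_module R ?P" by (rule submodule_as_left_module[OF P sub])
  interpret P': left_module R ?P by (rule P')
  interpret sP': sided_module R ?P by (rule left_module_sided[OF P'])
  have qP: "q x \<in> carrier ?P" if "x \<in> set xs" for x
    using sP.lspan_incl[OF Z(2)] that by auto
  have tP: "(\<Sum>x\<leftarrow>xs. frag_of (x, q x)) \<in> tensor_kernel R M ?P"
    by (rule fin[OF sub]) (use sP.lspan_incl[OF Z(2)] in blast)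
  \<comment> \<open>A copy on the type of the test modules; the quotient map by zero is injective.\<close>
  have zero: "submodule {\<zero>\<^bsub>P\<^esub>} R ?P"
    by (rule sP'.submoduleI) (use sP.submodule_zero[OF sub] sP.smult_r_zero in auto)
  have "|carrier ?P| \<le>o |UNIV :: 'q set|" using card_of_lspan_finite_le[OF inf card Z(1)] by simp
  then obtain g :: "'p \<Rightarrow> 'q" where g: "\<And>a b. \<lbrakk>a \<in> carrier ?P; b \<in> carrier ?P\<rbrakk> \<Longrightarrow>
      g a = g b \<longleftrightarrow> a \<ominus>\<^bsub>?P\<^esub> b \<in> {\<zero>\<^bsub>P\<^esub>}"
    using quotient_map_exists[OF P' zero] by blast
  let ?B = "image_module ?P g"
  have B: "left_module R ?B" by (rule left_module_image_module[OF P' zero]) (rule g)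
  have gh: "g \<in> mod_hom R ?P ?B" by (rule image_module_hom[OF P' zero]) (rule g)
  have g0: "g a = \<zero>\<^bsub>?B\<^esub> \<longleftrightarrow> a \<in> {\<zero>\<^bsub>P\<^esub>}" if "a \<in> carrier ?P" for a
    by (rule image_module_zero_iff[OF P' zero _ that]) (rule g)
  interpret sB: sided_module R ?B by (rule left_module_sided[OF B])
  define q' where "q' x = g (q x)" for x
  have q'B: "q' x \<in> carrier ?B" if "x \<in> set xs" for x
    unfolding q'_def by (rule mod_hom_closed[OF gh qP[OF that]])
  then have q'B': "q' ` set xs \<subseteq> carrier ?B" by auto
  have tB: "(\<Sum>x\<leftarrow>xs. frag_of (x, q' x)) \<in> tensor_kernel R M ?B"
    using induced_tensor_kernel[OF is_right_module P' B gh tP] unfolding induced_sum_list q'_def .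
  let ?L = "lspan R ?B (q' ` set xs)"
  let ?A = "?B\<lparr>carrier := ?L\<rparr>"
  have L: "submodule ?L R ?B" by (rule sB.lspan_submodule[OF q'B'])
  have A: "left_module R ?A" by (rule submodule_as_left_module[OF B L])
  have id: "(\<lambda>a. a) \<in> mod_hom R ?A ?B"
    by (rule mod_homI) (use sB.submodule_subset[OF L] in auto)
  have q'A: "q' x \<in> carrier ?A" if "x \<in> set xs" for x
    using sB.lspan_incl[OF q'B'] that by auto
  have inj: "inj_on (\<lambda>a. a) (carrier ?A)" by (rule inj_on_id2)
  have "inj_on (tensor_map R M ?A ?B (\<lambda>a. a)) (carrier (tensor R M ?A))"
    by (rule flat[unfolded flat_module_def, rule_format, OF conjI[OF A conjI[OF B conjI[OF id inj]]]])
  then have ker: "t \<in> tensor_kernel R M ?A"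
    if "Poly_Mapping.keys t \<subseteq> carrier M \<times> carrier ?A" "induced (\<lambda>a. a) t \<in> tensor_kernel R M ?B" for t
    using inj_tensor_map_iff[OF A B id] that by blast
  have tA: "(\<Sum>x\<leftarrow>xs. frag_of (x, q' x)) \<in> tensor_kernel R M ?A"
  proof (rule ker)
    show "Poly_Mapping.keys (\<Sum>x\<leftarrow>xs. frag_of (x, q' x)) \<subseteq> carrier M \<times> carrier ?A"
      by (rule keys_sum_list_frag_of) (use xs(2) q'A in auto)
    show "induced (\<lambda>a. a) (\<Sum>x\<leftarrow>xs. frag_of (x, q' x)) \<in> tensor_kernel R M ?B"
      unfolding induced_sum_list by (rule tB)
  qed
  have "coordinatized_by M (set xs) (relation_rows R ?A q' xs)"
    by (rule vanishing_tensor_on_generators[OF A xs _ _ tA]) (use q'A in auto)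
  moreover have "relation_rows R ?A q' xs \<subseteq> relation_rows R P q xs"
  proof
    fix c assume "c \<in> relation_rows R ?A q' xs"
    then have c: "c \<in> set xs \<rightarrow>\<^sub>E carrier R" and z: "row_eval ?B q' xs c = \<zero>\<^bsub>?B\<^esub>"
      by (auto simp: relation_rows_def)
    have "g (row_eval ?P q xs c) = \<zero>\<^bsub>?B\<^esub>"
      using mod_hom_row_eval[OF sP'.sided_module_axioms sB.sided_module_axioms gh, of xs q c] qP c z
      unfolding q'_def by (auto simp: PiE_iff)
    moreover have "row_eval ?P q xs c \<in> carrier ?P"
      by (rule sP'.row_eval_closed) (use qP c in auto)
    ultimately have "row_eval P q xs c = \<zero>\<^bsub>P\<^esub>" using g0 by simp
    then show "c \<in> relation_rows R P q xs" using c by (simp add: relation_rows_def)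
  qed
  ultimately show ?thesis by (rule coordinatized_by_mono)
qed

text \<open>The converse of \<open>flat_vanishing_tensor\<close>: every relation row pairs the tensor to zero.\<close>

lemma coordinatized_by_imp_tensor_zero:
  fixes Q :: "('r, 'q) module"
  assumes D: "coordinatized_by M (set xs) D" "D \<subseteq> relation_rows R Q q xs"
    and Q: "left_module R Q" and xs: "set xs \<subseteq> carrier M" and q: "\<And>x. x \<in> set xs \<Longrightarrow> q x \<in> carrier Q"
  shows "(\<Sum>x\<leftarrow>xs. frag_of (x, q x)) \<in> tensor_kernel R M Q"
proof -
  interpret Q: left_module R Q by (rule Q)
  from D(1) obtain ps where ps: "\<forall>y c. (y, c) \<in> set ps \<longrightarrow> y \<in> carrier M \<and> c \<in> D"
    "\<forall>x\<in>set xs. coord_sum M ps x = x" unfolding coordinatized_by_def by (elim exE conjE)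
  show ?thesis
  proof (rule tensor_zero_if_pairings_zero[OF Q xs])
    show "y \<in> carrier M \<and> (\<forall>x\<in>set xs. c x \<in> carrier R)" if "(y, c) \<in> set ps" for y c
      using ps(1) that D(2) unfolding relation_rows_def by auto
    show "coord_sum M ps x = x" if "x \<in> set xs" for x using ps(2) that by blast
    show "Poly_Mapping.keys (\<Sum>x\<leftarrow>xs. frag_of (x, q x)) \<subseteq> set xs \<times> carrier Q"
      by (rule keys_sum_list_frag_of) (use q in auto)
    show "h (\<Sum>x\<leftarrow>xs. frag_of (x, q x)) = \<zero>\<^bsub>Q\<^esub>" if "(y, c) \<in> set ps" "is_pairing Q (set xs) c h" for y c h
    proof -
      have "row_eval Q q xs c = \<zero>\<^bsub>Q\<^esub>" using ps(1) that(1) D(2) unfolding relation_rows_def by auto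
      then show ?thesis
        using pairing_sum_list[OF Q.M.abelian_group_axioms that(2), of xs q] q by simp
    qed
  qed
qed

end

section \<open>Minimal rows\<close>

context right_mod
begin

text \<open>Intersecting with the set of all rows makes minimal rows extensional without first exhibiting a
  submodule that coordinatizes \<open>X\<close>.\<close>

definition minimal_rows :: "'m set \<Rightarrow> ('m \<Rightarrow> 'r) set"
  where "minimal_rows X = \<Inter>{D. submodule D R (row_module R X) \<and> coordinatized_by M X D} \<inter> (X \<rightarrow>\<^sub>E carrier R)"

lemma row_module_expansion:
  assumes "distinct xs" "c \<in> set xs \<rightarrow>\<^sub>E carrier R"
  shows "row_eval (row_module R (set xs)) (basis_vector R (set xs)) xs c = c"
proof -
  have cR: "c x \<in> carrier R" if "x \<in> set xs" for x using assms(2) that by auto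
  have "row_eval (row_module R (set xs)) (basis_vector R (set xs)) ys c =
      (\<lambda>x\<in>set xs. if x \<in> set ys then c x else \<zero>\<^bsub>R\<^esub>)" if "distinct ys" "set ys \<subseteq> set xs" for ys
    using that
  proof (induction ys)
    case (Cons y ys)
    then show ?case by (auto simp: basis_vector_def cR intro!: restrict_ext)
  qed simp
  from this[OF assms(1) subset_refl] show ?thesis
    using assms(2) by (auto simp: fun_eq_iff PiE_iff extensional_def)
qed

lemma coordinatized_by_finitely_many_rows:
  assumes "coordinatized_by M X D"
  obtains cs where "set cs \<subseteq> D" "coordinatized_by M X (set cs)"
proof -
  from assms obtain ps where ps: "\<forall>y c. (y, c) \<in> set ps \<longrightarrow> y \<in> carrier M \<and> c \<in> D"
    "\<forall>x\<in>X. coord_sum M ps x = x" unfolding coordinatized_by_def by (elim exE conjE)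
  show ?thesis
  proof (rule that)
    show "set (map snd ps) \<subseteq> D" using ps(1) by auto
    show "coordinatized_by M X (set (map snd ps))"
      unfolding coordinatized_by_def by (rule exI[of _ ps]) (use ps in \<open>force simp: image_iff\<close>)
  qed
qed

text \<open>The Mittag-Leffler property shows that the intersection of all left submodules that coordinatize \<open>X\<close>
  coordinatizes \<open>X\<close> itself.  It suffices to intersect the finitely generated ones, of which there are
  at most as many as there are lists of rows; these index the family \<open>Q\<close> of the quotients \<open>R\<^sup>X/D\<close>.
  In \<open>Q\<^sub>i\<close> the relations between the images of the unit rows are exactly the elements of \<open>D\<^sub>i\<close>, so the tensor
  \<open>\<Sum> x \<otimes> e\<^sub>x\<close> vanishes over each \<open>Q\<^sub>i\<close>, hence over their product, and
  \<open>flat_vanishing_tensor\<close> provides rows that lie in all \<open>D\<^sub>i\<close>.\<close>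

lemma coordinatized_by_minimal_rows:
  assumes flat: "flat_module TYPE('q) R M" and ml: "mittag_leffler TYPE('i) TYPE('q) R M"
    and infq: "infinite (UNIV :: 'q set)" and cardq: "|carrier R| \<le>o |UNIV :: 'q set|"
    and infi: "infinite (UNIV :: 'i set)" and cardi: "|carrier R| \<le>o |UNIV :: 'i set|"
    and X: "finite X" "X \<subseteq> carrier M"
  shows "coordinatized_by M X (minimal_rows X)"
proof -
  obtain xs where xs: "distinct xs" "set xs = X" using finite_distinct_list[OF X(1)] by blast
  let ?F = "row_module R X" and ?b = "basis_vector R X"
  have F: "left_module R ?F" by (rule left_module_row_module[OF R.ring_axioms])
  interpret F: left_module R ?F by (rule F)
  interpret sF: sided_module R ?F by (rule left_module_sided[OF F])
  have b: "?b x \<in> carrier ?F" for x by (auto simp: basis_vector_def)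
  have cardF: "|carrier ?F| \<le>o |UNIV :: 'q set|" using card_of_PiE_finite_le[OF infq cardq X(1)] by simp
  have "|lists (carrier ?F)| \<le>o |UNIV :: 'i set|"
    using card_of_lists_le[OF infi card_of_PiE_finite_le[OF infi cardi X(1)]] by simp
  moreover have "lists (carrier ?F) \<noteq> {}" by auto
  ultimately obtain rows :: "'i \<Rightarrow> ('m \<Rightarrow> 'r) list" where rows: "range rows = lists (carrier ?F)"
    using card_of_ordLeq2[of "lists (carrier ?F)" "UNIV :: 'i set"] by auto
  define D where "D i = lspan R ?F (set (rows i))" for i
  have rowsF: "set (rows i) \<subseteq> carrier ?F" for i using rows by (auto simp: lists_eq_set)
  have D: "submodule (D i) R ?F" for i unfolding D_def by (rule sF.lspan_submodule[OF rowsF])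
  have "\<exists>g :: ('m \<Rightarrow> 'r) \<Rightarrow> 'q. \<forall>a\<in>carrier ?F. \<forall>b\<in>carrier ?F. g a = g b \<longleftrightarrow> a \<ominus>\<^bsub>?F\<^esub> b \<in> D i" for i
    by (rule quotient_map_exists[OF F D cardF]) blast
  then obtain g :: "'i \<Rightarrow> ('m \<Rightarrow> 'r) \<Rightarrow> 'q" where
    g: "\<And>i a b. \<lbrakk>a \<in> carrier ?F; b \<in> carrier ?F\<rbrakk> \<Longrightarrow> g i a = g i b \<longleftrightarrow> a \<ominus>\<^bsub>?F\<^esub> b \<in> D i" by metis
  define Q where "Q i = image_module ?F (g i)" for i
  have Q: "left_module R (Q i)" for i
    unfolding Q_def by (rule left_module_image_module[OF F D]) (rule g)
  have gh: "g i \<in> mod_hom R ?F (Q i)" for i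
    unfolding Q_def by (rule image_module_hom[OF F D]) (rule g)
  have g0: "g i a = \<zero>\<^bsub>Q i\<^esub> \<longleftrightarrow> a \<in> D i" if "a \<in> carrier ?F" for i a
    unfolding Q_def by (rule image_module_zero_iff[OF F D _ that]) (rule g)
  define I where "I = {i. coordinatized_by M X (D i)}"
  let ?P = "prod_module I Q"
  have P: "left_module R ?P" by (rule left_module_prod_module[OF R.ring_axioms Q])
  define q where "q x = (\<lambda>i\<in>I. g i (?b x))" for x
  have gb: "g i (?b x) \<in> carrier (Q i)" for i x by (rule mod_hom_closed[OF gh b])
  have qP: "q x \<in> carrier ?P" for x using gb by (auto simp: q_def)
  have eval: "row_eval (Q i) (\<lambda>x. g i (?b x)) xs c = g i c" if c: "c \<in> carrier ?F" for i c
  proof -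
    have "g i (row_eval ?F ?b xs c) = row_eval (Q i) (\<lambda>x. g i (?b x)) xs c"
      by (rule mod_hom_row_eval[OF sF.sided_module_axioms left_module_sided[OF Q] gh])
        (use b c xs(2) in auto)
    then show ?thesis using row_module_expansion[OF xs(1), of c] c xs(2) by simp
  qed
  have rel: "relation_rows R (Q i) (\<lambda>x. g i (?b x)) xs = D i" for i
  proof -
    have "D i \<subseteq> carrier ?F" by (rule sF.submodule_subset[OF D])
    then show ?thesis
      unfolding relation_rows_def xs(2) using eval[of _ i] g0[of _ i] by auto
  qed
  have "(\<Sum>x\<leftarrow>xs. frag_of (x, q x)) \<in> tensor_kernel R M ?P"
  proof -
    have "inj_on (tensor_prod_map R M I Q) (carrier (tensor R M ?P))"
      using ml Q unfolding mittag_leffler_def by blast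
    moreover have "Poly_Mapping.keys (\<Sum>x\<leftarrow>xs. frag_of (x, q x)) \<subseteq> carrier M \<times> carrier ?P"
      by (rule keys_sum_list_frag_of) (use xs(2) X(2) qP in auto)
    moreover have "induced (\<lambda>p. p i) (\<Sum>x\<leftarrow>xs. frag_of (x, q x)) \<in> tensor_kernel R M (Q i)" if i: "i \<in> I" for i
    proof -
      have "(\<Sum>x\<leftarrow>xs. frag_of (x, g i (?b x))) \<in> tensor_kernel R M (Q i)"
        by (rule coordinatized_by_imp_tensor_zero[of xs "D i"])
          (use i xs(2) X(2) gb Q rel in \<open>auto simp: I_def\<close>)
      then show ?thesis unfolding induced_sum_list using i by (simp add: q_def)
    qed
    ultimately show ?thesis using inj_tensor_prod_map_iff[of I Q] Q by blast
  qed
  then have "coordinatized_by M (set xs) (relation_rows R ?P q xs)"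
    by (rule flat_vanishing_tensor[OF flat infq cardq P xs(1), rotated 2]) (use xs(2) X(2) qP in auto)
  moreover have "relation_rows R ?P q xs \<subseteq> minimal_rows X"
  proof
    fix c assume c: "c \<in> relation_rows R ?P q xs"
    then have cF: "c \<in> carrier ?F" and c0: "row_eval ?P q xs c = \<zero>\<^bsub>?P\<^esub>" by (auto simp: relation_rows_def xs(2))
    have cD: "c \<in> D i" if i: "i \<in> I" for i
    proof -
      have pr: "(\<lambda>p. p i) \<in> mod_hom R ?P (Q i)" by (rule projection_mod_hom[OF i])
      have "row_eval ?P q xs c i = row_eval (Q i) (\<lambda>x. q x i) xs c"
        by (rule mod_hom_row_eval[OF left_module_sided[OF P] left_module_sided[OF Q] pr])
          (use qP cF xs(2) in auto)
      then have "g i c = \<zero>\<^bsub>Q i\<^esub>" using eval[OF cF, of i] c0 i by (simp add: q_def)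
      then show ?thesis using g0[OF cF] by simp
    qed
    have "c \<in> D'" if D': "submodule D' R ?F" "coordinatized_by M X D'" for D'
    proof -
      obtain cs where cs: "set cs \<subseteq> D'" "coordinatized_by M X (set cs)"
        using coordinatized_by_finitely_many_rows[OF D'(2)] by metis
      have csF: "set cs \<subseteq> carrier ?F" using cs(1) sF.submodule_subset[OF D'(1)] by blast
      then have "cs \<in> lists (carrier ?F)" by (simp add: lists_eq_set)
      then obtain i where i: "rows i = cs" using rows by (metis rangeE)
      have "coordinatized_by M X (D i)"
        unfolding D_def i by (rule coordinatized_by_mono[OF cs(2) sF.lspan_incl[OF csF]])
      then have "c \<in> D i" using cD by (simp add: I_def)
      moreover have "D i \<subseteq> D'" unfolding D_def i by (rule sF.lspan_minimal[OF D'(1) cs(1)])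
      ultimately show ?thesis by blast
    qed
    then show "c \<in> minimal_rows X" using cF by (auto simp: minimal_rows_def)
  qed
  ultimately show ?thesis using coordinatized_by_mono xs(2) by metis
qed

end

context right_mod
begin

lemma minimal_rows_submodule: "submodule (minimal_rows X) R (row_module R X)"
proof -
  interpret F: sided_module R "row_module R X"
    by (rule left_module_sided[OF left_module_row_module[OF R.ring_axioms]])
  let ?F = "row_module R X"
  have in_D: "minimal_rows X \<subseteq> D" if "submodule D R ?F" "coordinatized_by M X D" for D
    using that unfolding minimal_rows_def by blast
  have memI: "c \<in> minimal_rows X"
    if "c \<in> carrier ?F" "\<And>D. \<lbrakk>submodule D R ?F; coordinatized_by M X D\<rbrakk> \<Longrightarrow> c \<in> D" for c
    using that unfolding minimal_rows_def by simp
  have carr: "minimal_rows X \<subseteq> carrier ?F" unfolding minimal_rows_def by simp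
  show ?thesis
  proof (rule F.submoduleI[OF carr])
    show "\<zero>\<^bsub>?F\<^esub> \<in> minimal_rows X" by (rule memI[OF F.M.zero_closed]) (rule F.submodule_zero)
    show "c \<oplus>\<^bsub>?F\<^esub> d \<in> minimal_rows X" if cd: "c \<in> minimal_rows X" "d \<in> minimal_rows X" for c d
    proof (rule memI)
      show "c \<oplus>\<^bsub>?F\<^esub> d \<in> carrier ?F" using cd carr by (intro F.M.add.m_closed) auto
      show "c \<oplus>\<^bsub>?F\<^esub> d \<in> D" if D: "submodule D R ?F" "coordinatized_by M X D" for D
        using F.submodule_add[OF D(1)] in_D[OF D] cd by blast
    qed
    show "r \<odot>\<^bsub>?F\<^esub> c \<in> minimal_rows X" if r: "r \<in> carrier R" and c: "c \<in> minimal_rows X" for r c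
    proof (rule memI)
      show "r \<odot>\<^bsub>?F\<^esub> c \<in> carrier ?F" using c carr r by (intro F.smult_closed) auto
      show "r \<odot>\<^bsub>?F\<^esub> c \<in> D" if D: "submodule D R ?F" "coordinatized_by M X D" for D
        using F.submodule_smult[OF D(1) r] in_D[OF D] c by blast
    qed
  qed
qed

text \<open>Coordinates on \<open>Z\<close> are coordinates on \<open>X\<close>.  So the restrictions of the minimal rows on \<open>Z\<close>
  coordinatize \<open>X\<close>, and by minimality they comprise all minimal rows on \<open>X\<close>.\<close>

lemma minimal_rows_extend:
  assumes Z: "coordinatized_by M Z (minimal_rows Z)" and X: "X \<subseteq> Z" and c: "c \<in> minimal_rows X"
  obtains d where "d \<in> minimal_rows Z" "restrict d X = c"
proof -
  interpret X: sided_module R "row_module R X"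
    by (rule left_module_sided[OF left_module_row_module[OF R.ring_axioms]])
  interpret Z: sided_module R "row_module R Z"
    by (rule left_module_sided[OF left_module_row_module[OF R.ring_axioms]])
  let ?D = "(\<lambda>d. restrict d X) ` minimal_rows Z"
  note sub = minimal_rows_submodule[of Z]
  have carr: "d \<in> Z \<rightarrow>\<^sub>E carrier R" if "d \<in> minimal_rows Z" for d
    using Z.submodule_subset[OF sub] that by auto
  have "submodule ?D R (row_module R X)"
  proof (rule X.submoduleI)
    show "?D \<subseteq> carrier (row_module R X)" using carr X by fastforce
    have "\<zero>\<^bsub>row_module R X\<^esub> = restrict \<zero>\<^bsub>row_module R Z\<^esub> X" using X by (auto simp: Int_absorb1 intro!: restrict_ext)
    then show "\<zero>\<^bsub>row_module R X\<^esub> \<in> ?D" using Z.submodule_zero[OF sub] by blast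
    show "c \<oplus>\<^bsub>row_module R X\<^esub> d \<in> ?D" if "c \<in> ?D" "d \<in> ?D" for c d
    proof -
      from that obtain c' d' where cd: "c' \<in> minimal_rows Z" "c = restrict c' X" "d' \<in> minimal_rows Z" "d = restrict d' X"
        by blast
      have "c \<oplus>\<^bsub>row_module R X\<^esub> d = restrict (c' \<oplus>\<^bsub>row_module R Z\<^esub> d') X"
        using X cd by (auto simp: Int_absorb1 intro!: restrict_ext)
      then show ?thesis using Z.submodule_add[OF sub cd(1,3)] by blast
    qed
    show "r \<odot>\<^bsub>row_module R X\<^esub> c \<in> ?D" if r: "r \<in> carrier R" and "c \<in> ?D" for r c
    proof -
      from that obtain c' where c': "c' \<in> minimal_rows Z" "c = restrict c' X" by blast
      have "r \<odot>\<^bsub>row_module R X\<^esub> c = restrict (r \<odot>\<^bsub>row_module R Z\<^esub> c') X"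
        using X c' by (auto simp: Int_absorb1 intro!: restrict_ext)
      then show ?thesis using Z.submodule_smult[OF sub r c'(1)] by blast
    qed
  qed
  moreover have "coordinatized_by M X ?D" by (rule coordinatized_by_restrict[OF Z X])
  ultimately have "c \<in> ?D" using c unfolding minimal_rows_def by blast
  then show ?thesis using that by blast
qed

lemma relation_rows_submodule:
  fixes Q :: "('r, 'q) module"
  assumes Q: "left_module R Q" and q: "\<And>x. x \<in> set xs \<Longrightarrow> q x \<in> carrier Q"
  shows "submodule (relation_rows R Q q xs) R (row_module R (set xs))"
proof -
  interpret Q: sided_module R Q by (rule left_module_sided[OF Q])
  interpret F: sided_module R "row_module R (set xs)"
    by (rule left_module_sided[OF left_module_row_module[OF R.ring_axioms]])
  have restr: "row_eval Q q xs (restrict c (set xs)) = row_eval Q q xs c" for c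
    by (rule row_eval_cong) simp
  have z: "row_eval Q q xs (\<lambda>x. \<zero>\<^bsub>R\<^esub>) = \<zero>\<^bsub>Q\<^esub>" by (rule Q.row_eval_zero) (use q in auto)
  show ?thesis
  proof (rule F.submoduleI)
    show "relation_rows R Q q xs \<subseteq> carrier (row_module R (set xs))" by (auto simp: relation_rows_def)
    show "\<zero>\<^bsub>row_module R (set xs)\<^esub> \<in> relation_rows R Q q xs"
      using z by (auto simp: relation_rows_def restr)
  next
    fix c d assume "c \<in> relation_rows R Q q xs" "d \<in> relation_rows R Q q xs"
    then have c: "c \<in> set xs \<rightarrow>\<^sub>E carrier R" "row_eval Q q xs c = \<zero>\<^bsub>Q\<^esub>"
      and d: "d \<in> set xs \<rightarrow>\<^sub>E carrier R" "row_eval Q q xs d = \<zero>\<^bsub>Q\<^esub>" by (auto simp: relation_rows_def)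
    have "row_eval Q q xs (\<lambda>x. c x \<oplus>\<^bsub>R\<^esub> d x) = \<zero>\<^bsub>Q\<^esub>"
      using Q.row_eval_add[of xs q c d] q c d by auto
    then show "c \<oplus>\<^bsub>row_module R (set xs)\<^esub> d \<in> relation_rows R Q q xs"
      using c(1) d(1) by (auto simp: relation_rows_def restr)
  next
    fix r c assume r: "r \<in> carrier R" and "c \<in> relation_rows R Q q xs"
    then have c: "c \<in> set xs \<rightarrow>\<^sub>E carrier R" "row_eval Q q xs c = \<zero>\<^bsub>Q\<^esub>" by (auto simp: relation_rows_def)
    have "row_eval Q q xs (\<lambda>x. r \<otimes>\<^bsub>R\<^esub> c x) = \<zero>\<^bsub>Q\<^esub>"
      using row_eval_left_mult[OF Q r, of xs q c] q c Q.smult_r_zero[OF r] by auto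
    then show "r \<odot>\<^bsub>row_module R (set xs)\<^esub> c \<in> relation_rows R Q q xs"
      using c(1) r by (auto simp: relation_rows_def restr)
  qed
qed

text \<open>This is \<open>\<Sum> z \<otimes> a(z) = \<Sum> z a(z) \<otimes> 1 = 0\<close> in \<open>M \<otimes> R\<close>.\<close>

lemma relation_gives_zero_tensor:
  assumes zs: "set zs \<subseteq> carrier M" and a: "\<And>z. z \<in> set zs \<Longrightarrow> a z \<in> carrier R"
    and rel: "row_eval M (\<lambda>z. z) zs a = \<zero>\<^bsub>M\<^esub>"
  shows "(\<Sum>z\<leftarrow>zs. frag_of (z, a z)) \<in> tensor_kernel R M (left_regular R)"
proof -
  have L: "left_module R (left_regular R)" by (rule left_module_left_regular[OF R.ring_axioms])
  let ?K = "tensor_kernel R M (left_regular R)"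
  have "(\<Sum>z\<leftarrow>ys. frag_of (z, a z)) - frag_of (row_eval M (\<lambda>z. z) ys a, \<one>\<^bsub>R\<^esub>) \<in> ?K" (is "?d ys \<in> _")
    if "set ys \<subseteq> set zs" for ys
    using that
  proof (induction ys)
    case Nil
    then show ?case
      using tensor_kernel_uminus[OF is_right_module L tensor_kernel_zero_left[OF is_right_module L, of "\<one>\<^bsub>R\<^esub>"]] by simp
  next
    case (Cons y ys)
    then have y: "y \<in> carrier M" "a y \<in> carrier R" using zs a by auto
    have ev: "row_eval M (\<lambda>z. z) ys a \<in> carrier M"
      by (rule row_eval_closed) (use Cons.prems zs a in auto)
    have 1: "frag_of (a y \<odot>\<^bsub>M\<^esub> y, \<one>\<^bsub>R\<^esub>) - frag_of (y, a y) \<in> ?K"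
      using tensor_kernel_smult[OF is_right_module L y(2,1), of "\<one>\<^bsub>R\<^esub>"] y by simp
    have 2: "frag_of (a y \<odot>\<^bsub>M\<^esub> y \<oplus>\<^bsub>M\<^esub> row_eval M (\<lambda>z. z) ys a, \<one>\<^bsub>R\<^esub>) - frag_of (a y \<odot>\<^bsub>M\<^esub> y, \<one>\<^bsub>R\<^esub>)
        - frag_of (row_eval M (\<lambda>z. z) ys a, \<one>\<^bsub>R\<^esub>) \<in> ?K"
      by (rule tensor_kernel_add_left[OF is_right_module L]) (use y ev smult_closed in auto)
    have "?d ys \<in> ?K" using Cons by simp
    from tensor_kernel_diff[OF is_right_module L tensor_kernel_diff[OF is_right_module L this 2] 1]
    show ?case by (simp add: algebra_simps)
  qed
  from tensor_kernel_add[OF is_right_module L this[OF subset_refl] tensor_kernel_zero_left[OF is_right_module L, of "\<one>\<^bsub>R\<^esub>"]]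
  show ?thesis using rel by simp
qed

text \<open>The form maps \<open>\<Sum> z a(z)\<close> to \<open>\<Sum> c(z) a(z)\<close>; the assumption on relations makes this
  well-defined.\<close>

lemma relation_respecting_row_extends_to_form:
  assumes zs: "distinct zs" "set zs \<subseteq> carrier M" and c: "\<And>z. z \<in> set zs \<Longrightarrow> c z \<in> carrier R"
    and rel: "\<And>a. \<lbrakk>\<And>z. z \<in> set zs \<Longrightarrow> a z \<in> carrier R; row_eval M (\<lambda>z. z) zs a = \<zero>\<^bsub>M\<^esub>\<rbrakk> \<Longrightarrow>
      row_eval (left_regular R) a zs c = \<zero>\<^bsub>R\<^esub>"
  obtains \<psi> where "linear_form R M (lspan R M (set zs)) \<psi>" "\<And>z. z \<in> set zs \<Longrightarrow> \<psi> z = c z"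
proof -
  let ?e = "row_eval M (\<lambda>z. z) zs" and ?N = "lspan R M (set zs)"
  define T where "T a = row_eval (left_regular R) a zs c" for a
  define rows where "rows = {a. \<forall>z\<in>set zs. a z \<in> carrier R}"
  have N: "submodule ?N R M" by (rule lspan_submodule[OF zs(2)])
  have zM: "z \<in> carrier M" if "z \<in> set zs" for z using zs(2) that by blast
  have Tc: "T a \<in> carrier R" if "a \<in> rows" for a
    using left_reg.row_eval_closed[of zs a c] that c by (simp add: T_def rows_def)
  have Tadd: "T (\<lambda>z. a z \<oplus>\<^bsub>R\<^esub> b z) = T a \<oplus>\<^bsub>R\<^esub> T b" if "a \<in> rows" "b \<in> rows" for a b
  proof -
    have "row_eval (left_regular R) (\<lambda>z. a z \<oplus>\<^bsub>R\<^esub> b z) ys c =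
        row_eval (left_regular R) a ys c \<oplus>\<^bsub>R\<^esub> row_eval (left_regular R) b ys c" if "set ys \<subseteq> set zs" for ys
      using that
    proof (induction ys)
      case (Cons y ys)
      have "row_eval (left_regular R) a ys c \<in> carrier R" "row_eval (left_regular R) b ys c \<in> carrier R"
        using left_reg.row_eval_closed[of ys a c] left_reg.row_eval_closed[of ys b c] \<open>a \<in> rows\<close> \<open>b \<in> rows\<close> c Cons.prems
        by (auto simp: rows_def)
      then show ?case using Cons \<open>a \<in> rows\<close> \<open>b \<in> rows\<close> c by (simp add: rows_def R.r_distr R.a_ac)
    qed simp
    then show ?thesis by (simp add: T_def)
  qed
  have Tmult: "T (\<lambda>z. a z \<otimes>\<^bsub>R\<^esub> r) = T a \<otimes>\<^bsub>R\<^esub> r" if "a \<in> rows" "r \<in> carrier R" for a r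
  proof -
    have "row_eval (left_regular R) (\<lambda>z. a z \<otimes>\<^bsub>R\<^esub> r) ys c = row_eval (left_regular R) a ys c \<otimes>\<^bsub>R\<^esub> r"
      if "set ys \<subseteq> set zs" for ys
      using that
    proof (induction ys)
      case (Cons y ys)
      have "row_eval (left_regular R) a ys c \<in> carrier R"
        using left_reg.row_eval_closed[of ys a c] \<open>a \<in> rows\<close> c Cons.prems by (auto simp: rows_def)
      then show ?case using Cons \<open>a \<in> rows\<close> \<open>r \<in> carrier R\<close> c by (simp add: rows_def R.l_distr R.m_assoc)
    qed (simp add: \<open>r \<in> carrier R\<close>)
    then show ?thesis by (simp add: T_def)
  qed
  have welldef: "T a = T b" if ab: "a \<in> rows" "b \<in> rows" "?e a = ?e b" for a b
  proof -
    let ?b = "\<lambda>z. b z \<otimes>\<^bsub>R\<^esub> (\<ominus>\<^bsub>R\<^esub> \<one>\<^bsub>R\<^esub>)"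
    have b: "?b \<in> rows" using ab(2) by (simp add: rows_def)
    have m1: "\<ominus>\<^bsub>R\<^esub> \<one>\<^bsub>R\<^esub> \<in> carrier R" by simp
    have eb: "?e b \<in> carrier M" by (rule row_eval_closed) (use ab(2) zM in \<open>auto simp: rows_def\<close>)
    have "?e (\<lambda>z. a z \<oplus>\<^bsub>R\<^esub> ?b z) = ?e a \<oplus>\<^bsub>M\<^esub> ?e ?b"
      by (rule row_eval_add) (use ab(1) b zM in \<open>auto simp: rows_def\<close>)
    also have "?e ?b = \<ominus>\<^bsub>M\<^esub> ?e b"
      using row_eval_right_mult[OF m1, of zs "\<lambda>z. z" b] ab(2) zM smult_minus_one[OF eb] by (simp add: rows_def)
    finally have "?e (\<lambda>z. a z \<oplus>\<^bsub>R\<^esub> ?b z) = \<zero>\<^bsub>M\<^esub>" using ab(3) eb by (simp add: M.r_neg)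
    then have "T (\<lambda>z. a z \<oplus>\<^bsub>R\<^esub> ?b z) = \<zero>\<^bsub>R\<^esub>"
      unfolding T_def by (intro rel) (use ab(1) b in \<open>auto simp: rows_def\<close>)
    then have "T a \<oplus>\<^bsub>R\<^esub> \<ominus>\<^bsub>R\<^esub> T b = \<zero>\<^bsub>R\<^esub>"
      using Tadd[OF ab(1) b] Tmult[OF ab(2) m1] Tc[OF ab(2)] by (simp add: R.r_minus)
    then show ?thesis using Tc[OF ab(1)] Tc[OF ab(2)]
      by (metis R.a_inv_closed R.minus_equality R.minus_minus)
  qed
  have "\<exists>a. u \<in> ?N \<longrightarrow> a \<in> rows \<and> ?e a = u" for u
  proof (cases "u \<in> ?N")
    case True
    then have u: "u \<in> lspan R M ((\<lambda>z. z) ` set zs)" by simp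
    show ?thesis by (rule lspan_imp_row_eval[OF zs(1) _ u]) (auto simp: zM rows_def)
  qed simp
  then obtain a where a: "\<And>u. u \<in> ?N \<Longrightarrow> a u \<in> rows" "\<And>u. u \<in> ?N \<Longrightarrow> ?e (a u) = u" by metis
  define \<psi> where "\<psi> u = T (a u)" for u
  have \<psi>: "\<psi> u = T b" if "b \<in> rows" "?e b = u" "u \<in> ?N" for b u
    unfolding \<psi>_def by (rule welldef) (use that a in auto)
  have "linear_form R M ?N \<psi>"
    unfolding linear_form_def
  proof (intro conjI ballI)
    fix u assume u: "u \<in> ?N"
    show "\<psi> u \<in> carrier R" unfolding \<psi>_def by (rule Tc[OF a(1)[OF u]])
    fix v assume v: "v \<in> ?N"
    have "?e (\<lambda>z. a u z \<oplus>\<^bsub>R\<^esub> a v z) = u \<oplus>\<^bsub>M\<^esub> v"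
      using row_eval_add[of zs "\<lambda>z. z" "a u" "a v"] a(1)[OF u] a(1)[OF v] a(2)[OF u] a(2)[OF v] zM by (simp add: rows_def)
    then have "\<psi> (u \<oplus>\<^bsub>M\<^esub> v) = T (\<lambda>z. a u z \<oplus>\<^bsub>R\<^esub> a v z)"
      by (intro \<psi> submodule_add[OF N u v]) (use a(1)[OF u] a(1)[OF v] in \<open>auto simp: rows_def\<close>)
    then show "\<psi> (u \<oplus>\<^bsub>M\<^esub> v) = \<psi> u \<oplus>\<^bsub>R\<^esub> \<psi> v"
      using Tadd[OF a(1)[OF u] a(1)[OF v]] by (simp add: \<psi>_def)
  next
    fix r u assume r: "r \<in> carrier R" and u: "u \<in> ?N"
    have "?e (\<lambda>z. a u z \<otimes>\<^bsub>R\<^esub> r) = r \<odot>\<^bsub>M\<^esub> u"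
      using row_eval_right_mult[OF r, of zs "\<lambda>z. z" "a u"] a(1)[OF u] a(2)[OF u] zM by (simp add: rows_def)
    then have "\<psi> (r \<odot>\<^bsub>M\<^esub> u) = T (\<lambda>z. a u z \<otimes>\<^bsub>R\<^esub> r)"
      by (intro \<psi> submodule_smult[OF N r u]) (use a(1)[OF u] r in \<open>auto simp: rows_def\<close>)
    then show "\<psi> (r \<odot>\<^bsub>M\<^esub> u) = \<psi> u \<otimes>\<^bsub>R\<^esub> r"
      using Tmult[OF a(1)[OF u] r] by (simp add: \<psi>_def)
  qed
  moreover have "\<psi> z = c z" if z: "z \<in> set zs" for z
  proof -
    let ?d = "\<lambda>y. if y = z then \<one>\<^bsub>R\<^esub> else \<zero>\<^bsub>R\<^esub>"
    have "?e ?d = z" by (rule row_eval_delta[OF zs(1) z]) (rule zM)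
    then have "\<psi> z = T ?d"
      by (intro \<psi>) (use lspan_incl[OF zs(2)] z in \<open>auto simp: rows_def\<close>)
    also have "\<dots> = c z"
    proof -
      have "row_eval (left_regular R) ?d ys c = (if z \<in> set ys then c z else \<zero>\<^bsub>R\<^esub>)"
        if "distinct ys" "set ys \<subseteq> set zs" for ys
        using that by (induction ys) (auto simp: c)
      from this[OF zs(1) subset_refl] show ?thesis using z by (simp add: T_def)
    qed
    finally show ?thesis .
  qed
  ultimately show ?thesis by (rule that)
qed

text \<open>Minimal rows are stable: a minimal row on \<open>X\<close> extends to a minimal row on \<open>Z\<close>, and this respects
  every relation on \<open>Z\<close>, because the rows that respect a given relation form a left submodule
  that coordinatizes \<open>Z\<close> by flatness.\<close>

lemma flat_mittag_leffler_imp_stably_coordinatized: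
  assumes flat: "flat_module TYPE('q) R M" and ml: "mittag_leffler TYPE('i) TYPE('q) R M"
    and infq: "infinite (UNIV :: 'q set)" and cardq: "|carrier R| \<le>o |UNIV :: 'q set|"
    and infi: "infinite (UNIV :: 'i set)" and cardi: "|carrier R| \<le>o |UNIV :: 'i set|"
  shows "stably_coordinatized R M (carrier M)"
  unfolding stably_coordinatized_def
proof (intro allI impI)
  fix X assume X: "finite X \<and> X \<subseteq> carrier M"
  note coord = coordinatized_by_minimal_rows[OF flat ml infq cardq infi cardi]
  have L: "left_module R (left_regular R)" by (rule left_module_left_regular[OF R.ring_axioms])
  have "c \<in> stable_rows R M X" if c: "c \<in> minimal_rows X" for c
    unfolding stable_rows_def
  proof (intro CollectI allI impI)
    fix Z assume Z: "finite Z \<and> X \<subseteq> Z \<and> Z \<subseteq> carrier M"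
    obtain d where d: "d \<in> minimal_rows Z" "restrict d X = c"
      using minimal_rows_extend[OF coord _ c] Z by metis
    obtain zs where zs: "distinct zs" "set zs = Z" using finite_distinct_list Z by blast
    have dR: "d z \<in> carrier R" if "z \<in> set zs" for z
      using d(1) that zs(2) unfolding minimal_rows_def by auto
    have kills: "row_eval (left_regular R) a zs d = \<zero>\<^bsub>R\<^esub>"
      if a: "\<And>z. z \<in> set zs \<Longrightarrow> a z \<in> carrier R" and rel: "row_eval M (\<lambda>z. z) zs a = \<zero>\<^bsub>M\<^esub>" for a
    proof -
      have zM: "set zs \<subseteq> carrier M" using Z zs(2) by simp
      have "coordinatized_by M (set zs) (relation_rows R (left_regular R) a zs)"
        by (rule flat_vanishing_tensor[OF flat infq cardq L zs(1) zM _ relation_gives_zero_tensor[OF zM a rel]])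
          (simp_all add: a)
      moreover have "submodule (relation_rows R (left_regular R) a zs) R (row_module R (set zs))"
        by (rule relation_rows_submodule[OF L]) (simp add: a)
      ultimately have "d \<in> relation_rows R (left_regular R) a zs"
        using d(1) zs(2) unfolding minimal_rows_def by blast
      then show ?thesis by (simp add: relation_rows_def)
    qed
    have zM: "set zs \<subseteq> carrier M" using Z zs(2) by simp
    show "\<exists>\<psi>. linear_form R M (lspan R M Z) \<psi> \<and> (\<forall>x\<in>X. \<psi> x = c x)"
    proof (rule relation_respecting_row_extends_to_form[OF zs(1) zM dR kills])
      fix \<psi> assume \<psi>: "linear_form R M (lspan R M (set zs)) \<psi>" "\<And>z. z \<in> set zs \<Longrightarrow> \<psi> z = d z"
      have "\<psi> x = c x" if "x \<in> X" for x
        using \<psi>(2)[of x] that Z zs(2) d(2) by auto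
      then show ?thesis using \<psi>(1) zs(2) by auto
    qed
  qed
  moreover have "coordinatized_by M X (minimal_rows X)" using coord X by blast
  ultimately have "coordinatized_by M X (stable_rows R M X)" using coordinatized_by_mono by blast
  then show "\<exists>ps. (\<forall>y c. (y, c) \<in> set ps \<longrightarrow> y \<in> carrier M \<and> c \<in> stable_rows R M X) \<and>
      (\<forall>x\<in>X. coord_sum M ps x = x)" unfolding coordinatized_by_def .
qed

end

section \<open>The characterization\<close>

theorem theorem2p9:
  fixes R :: "'r ring" and M :: "('r, 'm) module" and \<kappa> :: "'k rel"
  assumes "ring R" and "right_module R M"
  shows "(large_type TYPE('i) R M \<and> large_type TYPE('q) R M \<longrightarrow>
            (kappa_projective aleph1 R M \<longleftrightarrow>
             flat_module TYPE('q) R M \<and> mittag_leffler TYPE('i) TYPE('q) R M))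
       \<and> (regular_uncountable \<kappa> \<and> kappa_projective \<kappa> R M \<longrightarrow>
            flat_module TYPE('q) R M \<and> mittag_leffler TYPE('i) TYPE('q) R M)"
proof -
  interpret right_mod R M using assms(2) by (rule right_mod.intro)
  have aleph1: "natLeq <o aleph1" by (rule cardSuc_greater[OF natLeq_Card_order])
  show ?thesis
  proof (intro conjI impI)
    assume large: "large_type TYPE('i) R M \<and> large_type TYPE('q) R M"
    show "kappa_projective aleph1 R M \<longleftrightarrow> flat_module TYPE('q) R M \<and> mittag_leffler TYPE('i) TYPE('q) R M"
    proof
      assume "kappa_projective aleph1 R M"
      then have "stably_coordinatized R M (carrier M)"
        by (rule kappa_projective_imp_stably_coordinatized[OF aleph1])
      then show "flat_module TYPE('q) R M \<and> mittag_leffler TYPE('i) TYPE('q) R M"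
        by (intro conjI stably_coordinatized_imp_flat stably_coordinatized_imp_mittag_leffler)
    next
      assume "flat_module TYPE('q) R M \<and> mittag_leffler TYPE('i) TYPE('q) R M"
      then have "stably_coordinatized R M (carrier M)"
        using large unfolding large_type_def
        by (intro flat_mittag_leffler_imp_stably_coordinatized[where 'q = 'q and 'i = 'i]) simp_all
      then show "kappa_projective aleph1 R M" by (rule stably_coordinatized_imp_aleph1_projective)
    qed
  next
    assume "regular_uncountable \<kappa> \<and> kappa_projective \<kappa> R M"
    then have "stably_coordinatized R M (carrier M)"
      unfolding regular_uncountable_def using kappa_projective_imp_stably_coordinatized by blast
    then show "flat_module TYPE('q) R M" "mittag_leffler TYPE('i) TYPE('q) R M"
      by (rule stably_coordinatized_imp_flat, rule stably_coordinatized_imp_mittag_leffler)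
  qed
qed

end
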